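(* Let $m, r$ and $d$ be integers such that $d \geq 1$ and $2 \leq 2r \leq m-1$. Then $$ \mathrm{POL}^{ss,neig}_{d,2r,m} = \left\{ L(\lambda)\begin{bmatrix} 0 & \Delta_r\\ -\Delta_r & 0\end{bmatrix} L(\lambda)^T \; : \; \begin{array}{l} L(\lambda)\in\mathrm{POL}^{m\times 2r},\\ L(\lambda) \text{ is a minimal basis},\\ \deg(L_{*1})\ge\cdots\ge\deg(L_{*2r}),\\ \deg(L_{*i})+\deg(L_{*(2r-i+1)})=d \text{ for } i=1,\ldots,2r\end{array}\right\}. $$
   Context: All matrix polynomials have coefficients in $\mathbb{C}$. $\mathrm{POL}^{p\times q}$ is the set of all $p\times q$ matrix polynomials. The degree of a matrix polynomial is the largest power of $\lambda$ with a nonzero matrix coefficient. $L_{*i}$ denotes the $i$-th column of $L(\lambda)$. $\Delta_r$ is the $r\times r$ matrix with ones on the anti-diagonal and zeros elsewhere. The (normal) rank of a matrix polynomial is its rank over the field $\mathbb{C}(\lambda)$. $\mathrm{POL}^{ss}_{d,2r,m}$ is the set of $m\times m$ skew-symmetric matrix polynomials $P(\lambda)=\sum_{i=0}^d\lambda^iA_i$ ($A_i\in\mathbb{C}^{m\times m}$, $A_i^T=-A_i$) of degree at most $d$ and normal rank at most $2r$. Eigenvalues: $\alpha\in\mathbb{C}$ is a finite eigenvalue of $P(\lambda)$ if it is a root of at least one of the invariant polynomials of $P(\lambda)$ (the nonzero diagonal entries of its Smith form over $\mathbb{C}[\lambda]$); equivalently, $\operatorname{rank}P(\alpha)<\operatorname{rank}(P)$.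 $\infty$ is an eigenvalue of $P(\lambda)$, regarded as a polynomial of grade $d$, if $0$ is an eigenvalue of $\mathrm{rev}_dP(\lambda):=\lambda^dP(1/\lambda)$. "$P$ has no eigenvalues" means no finite and no infinite eigenvalues. Then $$\mathrm{POL}^{ss,neig}_{d,2r,m}:=\{P(\lambda)\in\mathrm{POL}^{ss}_{d,2r,m} : \operatorname{rank}(P)=2r,\ \deg(P)=d,\ P(\lambda)\text{ has no eigenvalues}\}.$$ Minimal basis: for a subspace $\mathcal{V}$ of $\mathbb{C}(\lambda)^m$ (over $\mathbb{C}(\lambda)$), a minimal basis is a basis of $\mathcal{V}$ consisting of vector polynomials whose sum of degrees is minimal among all bases of $\mathcal{V}$ consisting of vector polynomials. A matrix polynomial is called a minimal basis if its columns form a minimal basis of the subspace they span over $\mathbb{C}(\lambda)$ (in particular the columns are linearly independent over $\mathbb{C}(\lambda)$). *)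

theory Defs
  imports
    "Jordan_Normal_Form.DL_Rank"
    "HOL-Computational_Algebra.Polynomial_Factorial"
begin

text \<open>
  A matrix polynomial is a matrix over \<open>complex poly\<close>; the field of rational functions is
  \<open>complex poly fract\<close>, into which \<open>to_fract\<close> embeds the polynomials. Indices of rows and
  columns start at 0.
\<close>

definition coeff_mat :: "'a::zero poly mat \<Rightarrow> nat \<Rightarrow> 'a mat" where
  "coeff_mat P k = map_mat (\<lambda>p. coeff p k) P"

definition coeff_vec :: "'a::zero poly vec \<Rightarrow> nat \<Rightarrow> 'a vec" where
  "coeff_vec v k = map_vec (\<lambda>p. coeff p k) v"

text \<open>Only finitely many coefficients are nonzero; the zero polynomial gets degree 0.\<close>

definition mat_degree :: "'a::zero poly mat \<Rightarrow> nat" where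
  "mat_degree P = Max (insert 0 {k. coeff_mat P k \<noteq> 0\<^sub>m (dim_row P) (dim_col P)})"

definition vec_degree :: "'a::zero poly vec \<Rightarrow> nat" where
  "vec_degree v = Max (insert 0 {k. coeff_vec v k \<noteq> 0\<^sub>v (dim_vec v)})"

definition normal_rank :: "complex poly mat \<Rightarrow> nat" where
  "normal_rank P = vec_space.rank (dim_row P) (map_mat to_fract P)"

text \<open>
  The divisibility condition forces the zero diagonal entries to the end, since 0 divides only 0.
  The unimodular matrices are the invertible ones over the polynomial ring.
\<close>

definition is_smith_form :: "complex poly mat \<Rightarrow> complex poly mat \<Rightarrow> bool" where
  "is_smith_form P S \<longleftrightarrow>
     S \<in> carrier_mat (dim_row P) (dim_col P) \<and>
     (\<exists>U V. U \<in> carrier_mat (dim_row P) (dim_row P) \<and> invertible_mat U \<and>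
            V \<in> carrier_mat (dim_col P) (dim_col P) \<and> invertible_mat V \<and>
            S = U * P * V) \<and>
     diagonal_mat S \<and>
     (\<forall>i < min (dim_row P) (dim_col P). S $$ (i,i) \<noteq> 0 \<longrightarrow> lead_coeff (S $$ (i,i)) = 1) \<and>
     (\<forall>i. Suc i < min (dim_row P) (dim_col P) \<longrightarrow> S $$ (i,i) dvd S $$ (Suc i, Suc i))"

definition invariant_polys :: "complex poly mat \<Rightarrow> complex poly set" where
  "invariant_polys P =
     {S $$ (i,i) | S i. is_smith_form P S \<and> i < min (dim_row P) (dim_col P) \<and> S $$ (i,i) \<noteq> 0}"

definition finite_eigenvalue :: "complex poly mat \<Rightarrow> complex \<Rightarrow> bool" where
  "finite_eigenvalue P \<alpha> \<longleftrightarrow> (\<exists>p \<in> invariant_polys P. poly p \<alpha> = 0)"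

text \<open>
  For \<open>p\<close> of degree at most \<open>d\<close>, \<open>rev_poly d p\<close> is \<open>x ^ d * p (1 / x)\<close>. It differs from
  \<open>reflect_poly p\<close> by a power of \<open>x\<close> if \<open>degree p < d\<close>.
\<close>

definition rev_poly :: "nat \<Rightarrow> complex poly \<Rightarrow> complex poly" where
  "rev_poly d p = (\<Sum>i\<le>d. monom (coeff p i) (d - i))"

definition rev_mat :: "nat \<Rightarrow> complex poly mat \<Rightarrow> complex poly mat" where
  "rev_mat d P = map_mat (rev_poly d) P"

definition infinite_eigenvalue :: "nat \<Rightarrow> complex poly mat \<Rightarrow> bool" where
  "infinite_eigenvalue d P \<longleftrightarrow> finite_eigenvalue (rev_mat d P) 0"

definition no_eigenvalues :: "nat \<Rightarrow> complex poly mat \<Rightarrow> bool" where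
  "no_eigenvalues d P \<longleftrightarrow> (\<forall>\<alpha>. \<not> finite_eigenvalue P \<alpha>) \<and> \<not> infinite_eigenvalue d P"

text \<open>In the following two sets the argument \<open>k\<close> is the rank bound (\<open>2 * r\<close> in the application).\<close>

definition POL_ss :: "nat \<Rightarrow> nat \<Rightarrow> nat \<Rightarrow> complex poly mat set" where
  "POL_ss d k m =
     {P \<in> carrier_mat m m.
        (\<forall>i. transpose_mat (coeff_mat P i) = - coeff_mat P i) \<and>
        mat_degree P \<le> d \<and> normal_rank P \<le> k}"

definition POL_ss_neig :: "nat \<Rightarrow> nat \<Rightarrow> nat \<Rightarrow> complex poly mat set" where
  "POL_ss_neig d k m =
     {P \<in> POL_ss d k m. normal_rank P = k \<and> mat_degree P = d \<and> no_eigenvalues d P}"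

abbreviation ratfun_space ::
  "nat \<Rightarrow> (complex poly fract, complex poly fract vec) module" where
  "ratfun_space m \<equiv> module_vec TYPE(complex poly fract) m"

abbreviation ratfun_span :: "nat \<Rightarrow> complex poly vec set \<Rightarrow> complex poly fract vec set" where
  "ratfun_span m B \<equiv>
     LinearCombinations.module.span class_ring (ratfun_space m) (map_vec to_fract ` B)"

definition is_poly_basis ::
  "nat \<Rightarrow> complex poly fract vec set \<Rightarrow> complex poly vec set \<Rightarrow> bool" where
  "is_poly_basis m W B \<longleftrightarrow>
     B \<subseteq> carrier_vec m \<and>
     \<not> LinearCombinations.module.lin_dep class_ring (ratfun_space m) (map_vec to_fract ` B) \<and>
     ratfun_span m B = W"

text \<open>
  Bases of subspaces of a space of dimension \<open>m\<close> are finite, so the sums below are finite sums.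
\<close>

definition is_minimal_basis ::
  "nat \<Rightarrow> complex poly fract vec set \<Rightarrow> complex poly vec set \<Rightarrow> bool" where
  "is_minimal_basis m W B \<longleftrightarrow>
     is_poly_basis m W B \<and>
     (\<forall>B'. is_poly_basis m W B' \<longrightarrow> (\<Sum>v\<in>B. vec_degree v) \<le> (\<Sum>v\<in>B'. vec_degree v))"

text \<open>
  Distinctness is needed because the set of columns forgets repetitions, which linear
  independence of the family of columns excludes.
\<close>

definition minimal_basis_mat :: "complex poly mat \<Rightarrow> bool" where
  "minimal_basis_mat L \<longleftrightarrow>
     distinct (cols L) \<and>
     is_minimal_basis (dim_row L) (ratfun_span (dim_row L) (set (cols L))) (set (cols L))"

definition antidiag_mat :: "nat \<Rightarrow> complex poly mat" where
  "antidiag_mat r = mat r r (\<lambda>(i,j). if i + j + 1 = r then 1 else 0)"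

definition skew_block_mat :: "nat \<Rightarrow> complex poly mat" where
  "skew_block_mat r =
     four_block_mat (0\<^sub>m r r) (antidiag_mat r) (- antidiag_mat r) (0\<^sub>m r r)"

end

theory Submission
  imports Defs "HOL-Computational_Algebra.Fundamental_Theorem_Algebra"
begin

text \<open>
  By the Smith form, \<open>P\<close> has no eigenvalues iff all \<open>P(\<alpha>)\<close> and the coefficient of \<open>\<lambda>\<^sup>d\<close> have the
  same rank as \<open>P\<close>. If \<open>L\<close> is a minimal basis, then every \<open>L(\<alpha>)\<close> and the matrix of leading column
  coefficients of \<open>L\<close> have full column rank, since otherwise some column could be replaced by one of
  smaller degree. Hence the products on the right have rank \<open>2r\<close> everywhere.

  Conversely, let \<open>L\<close> be a minimal basis of the column space of \<open>P\<close>. Then \<open>P = L Q L\<^sup>T\<close> with a skew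
  symmetric polynomial matrix \<open>Q\<close>, where \<open>deg Q\<^sub>i\<^sub>j \<le> d - e\<^sub>i - e\<^sub>j\<close> for the column degrees \<open>e\<close> of \<open>L\<close>.
  Without finite eigenvalues \<open>det Q\<close> is constant, and without infinite ones its coefficient of degree
  \<open>\<Sum>\<^sub>i (d - 2 e\<^sub>i)\<close> does not vanish; this forces \<open>e\<^sub>i + e\<^sub>2\<^sub>r\<^sub>+\<^sub>1\<^sub>-\<^sub>i = d\<close>. A symplectic Gram-Schmidt process
  that respects the degree bounds then turns \<open>Q\<close> into the block matrix of the theorem. The new columns
  have degrees at most \<open>e\<close>, so they form a minimal basis with the same degrees.
\<close>

section \<open>Diagonal form under equivalence\<close>

text \<open>The carrier premises of this rule leave dimensions to be guessed; \<open>mat_mult_assoc\<close> below does not.\<close>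

declare assoc_mult_mat [simp del]

definition mat_equiv :: "'a::comm_ring_1 mat \<Rightarrow> 'a mat \<Rightarrow> bool" where
  "mat_equiv A B \<longleftrightarrow>
     (\<exists>U V. U \<in> carrier_mat (dim_row A) (dim_row A) \<and> invertible_mat U \<and>
            V \<in> carrier_mat (dim_col A) (dim_col A) \<and> invertible_mat V \<and> B = U * A * V)"

lemma mat_mult_assoc:
  "dim_col A = dim_row B \<Longrightarrow> dim_col B = dim_row C \<Longrightarrow> (A * B) * C = A * (B * (C :: 'a :: semiring_0 mat))"
  by (rule assoc_mult_mat[of _ "dim_row A" "dim_row B" _ "dim_row C" _ "dim_col C"]) auto

lemma invertible_matI:
  assumes "U \<in> carrier_mat n n" "U' \<in> carrier_mat n n" "U * U' = 1\<^sub>m n" "U' * U = 1\<^sub>m n"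
  shows "invertible_mat U"
  using assms unfolding invertible_mat_def inverts_mat_def square_mat.simps by (metis carrier_matD)

lemma invertible_matE:
  assumes "invertible_mat U" "U \<in> carrier_mat n n"
  obtains U' where "U' \<in> carrier_mat n n" "U * U' = 1\<^sub>m n" "U' * U = 1\<^sub>m n"
proof -
  from assms obtain B where B: "U * B = 1\<^sub>m n" "B * U = 1\<^sub>m (dim_row B)"
    unfolding invertible_mat_def inverts_mat_def by auto
  have "dim_col B = n" using arg_cong[OF B(1), of dim_col] by simp
  moreover have "dim_row B = n" using arg_cong[OF B(2), of dim_col] assms by simp
  ultimately have "B \<in> carrier_mat n n" by auto
  with B show ?thesis by (intro that[of B]) auto
qed

lemma invertible_mat_one: "invertible_mat (1\<^sub>m n)"
  by (rule invertible_matI[of _ n "1\<^sub>m n"]) auto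

lemma invertible_mat_mult:
  assumes "U \<in> carrier_mat n n" "V \<in> carrier_mat n n" "invertible_mat U" "invertible_mat V"
  shows "invertible_mat (U * V)"
proof -
  obtain U' where U: "U' \<in> carrier_mat n n" "U * U' = 1\<^sub>m n" "U' * U = 1\<^sub>m n"
    using invertible_matE assms by metis
  obtain V' where V: "V' \<in> carrier_mat n n" "V * V' = 1\<^sub>m n" "V' * V = 1\<^sub>m n"
    using invertible_matE assms by metis
  show ?thesis
  proof (rule invertible_matI)
    show "U * V \<in> carrier_mat n n" "V' * U' \<in> carrier_mat n n" using U V assms by auto
    have "U * V * (V' * U') = U * (V * V') * U'"
      using assms U(1) V(1) by (simp add: mat_mult_assoc)
    then show "U * V * (V' * U') = 1\<^sub>m n"
      using U V assms by (simp add: right_mult_one_mat[OF assms(1)])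
    have "V' * U' * (U * V) = V' * (U' * U) * V"
      using assms U(1) V(1) by (simp add: mat_mult_assoc)
    then show "V' * U' * (U * V) = 1\<^sub>m n"
      using U V assms by (simp add: right_mult_one_mat[OF V(1)])
  qed
qed

lemma mat_equivI:
  assumes "A \<in> carrier_mat m n" "U \<in> carrier_mat m m" "V \<in> carrier_mat n n"
    "invertible_mat U" "invertible_mat V" "B = U * A * V"
  shows "mat_equiv A B"
  unfolding mat_equiv_def by (intro exI[of _ U] exI[of _ V]) (use assms in simp)

lemma mat_equivE:
  assumes "mat_equiv A B" "A \<in> carrier_mat m n"
  obtains U V where "U \<in> carrier_mat m m" "V \<in> carrier_mat n n"
    "invertible_mat U" "invertible_mat V" "B = U * A * V" "B \<in> carrier_mat m n"
proof -
  obtain U V where "U \<in> carrier_mat m m" "V \<in> carrier_mat n n"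
    "invertible_mat U" "invertible_mat V" and B: "B = U * A * V"
    using assms unfolding mat_equiv_def by auto
  moreover have "B \<in> carrier_mat m n" unfolding B using calculation assms(2) by auto
  ultimately show ?thesis using that by blast
qed

lemma mat_equiv_carrier: "mat_equiv A B \<Longrightarrow> A \<in> carrier_mat m n \<Longrightarrow> B \<in> carrier_mat m n"
  by (erule mat_equivE) auto

lemma mat_equiv_refl: "mat_equiv A A"
  by (rule mat_equivI[of A "dim_row A" "dim_col A" "1\<^sub>m (dim_row A)" "1\<^sub>m (dim_col A)"])
     (auto simp: invertible_mat_one)

lemma mat_equiv_trans:
  assumes "mat_equiv A B" "mat_equiv B C"
  shows "mat_equiv A C"
proof -
  define m n where "m = dim_row A" and "n = dim_col A"
  have A: "A \<in> carrier_mat m n" by (auto simp: m_def n_def)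
  obtain U V where 1: "U \<in> carrier_mat m m" "V \<in> carrier_mat n n"
    "invertible_mat U" "invertible_mat V" "B = U * A * V" "B \<in> carrier_mat m n"
    using mat_equivE[OF assms(1) A] by metis
  obtain U' V' where 2: "U' \<in> carrier_mat m m" "V' \<in> carrier_mat n n"
    "invertible_mat U'" "invertible_mat V'" "C = U' * B * V'"
    using mat_equivE[OF assms(2) 1(6)] by metis
  have "C = (U' * U) * A * (V * V')" using 1(1,2) 2(1,2) A unfolding 2(5) 1(5)
    by (simp add: mat_mult_assoc)
  then show ?thesis using 1 2 A by (intro mat_equivI[OF A, of "U' * U" "V * V'"] invertible_mat_mult) auto
qed

lemma mat_equiv_left:
  assumes "A \<in> carrier_mat m n" "U \<in> carrier_mat m m" "invertible_mat U"
  shows "mat_equiv A (U * A)"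
  using assms by (intro mat_equivI[OF assms(1,2), of "1\<^sub>m n"]) (auto simp: invertible_mat_one)

lemma mat_equiv_right:
  assumes "A \<in> carrier_mat m n" "V \<in> carrier_mat n n" "invertible_mat V"
  shows "mat_equiv A (A * V)"
  using assms by (intro mat_equivI[OF assms(1), of "1\<^sub>m m" V]) (auto simp: invertible_mat_one)

lemma invertible_swaprows_mat: "k < n \<Longrightarrow> l < n \<Longrightarrow> invertible_mat (swaprows_mat n k l)"
  by (rule invertible_matI[of _ n "swaprows_mat n k l"]) (auto simp: swaprows_mat_inv)

lemma invertible_addrow_mat:
  "k < n \<Longrightarrow> l < n \<Longrightarrow> k \<noteq> l \<Longrightarrow> invertible_mat (addrow_mat n (a :: 'a :: comm_ring_1) k l)"
  using addrow_mat_inv[of k n l a] addrow_mat_inv[of k n l "-a"]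
  by (intro invertible_matI[of _ n "addrow_mat n (-a) k l"]) auto

lemma mat_equiv_ops:
  assumes A: "(A :: 'a :: comm_ring_1 mat) \<in> carrier_mat m n"
  shows "k < m \<Longrightarrow> l < m \<Longrightarrow> mat_equiv A (swaprows k l A)"
    "k < n \<Longrightarrow> l < n \<Longrightarrow> mat_equiv A (swapcols k l A)"
    "k < m \<Longrightarrow> l < m \<Longrightarrow> k \<noteq> l \<Longrightarrow> mat_equiv A (addrow a k l A)"
    "k < n \<Longrightarrow> l < n \<Longrightarrow> k \<noteq> l \<Longrightarrow> mat_equiv A (addcol a k l A)"
  using A by (auto simp: swaprows_mat[OF A] swapcols_mat[OF A] addrow_mat[OF A] addcol_mat[OF A]
      intro!: mat_equiv_left mat_equiv_right invertible_swaprows_mat invertible_addrow_mat)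

lemma mat_equiv_move:
  assumes A: "(A :: 'a :: comm_ring_1 mat) \<in> carrier_mat m n" and ij: "i < m" "j < n"
  obtains B where "mat_equiv A B" "B $$ (0,0) = A $$ (i,j)"
proof
  have 1: "mat_equiv A (swaprows 0 i A)" using mat_equiv_ops(1)[OF A] ij by auto
  then have "swaprows 0 i A \<in> carrier_mat m n" using mat_equiv_carrier A by blast
  from mat_equiv_ops(2)[OF this, of 0 j] 1
  show "mat_equiv A (swapcols 0 j (swaprows 0 i A))" using mat_equiv_trans ij by fastforce
  show "swapcols 0 j (swaprows 0 i A) $$ (0,0) = A $$ (i,j)" using A ij by auto
qed

lemma dvd_mat_mult:
  fixes A :: "'a :: comm_ring_1 mat"
  assumes A: "A \<in> carrier_mat m n" and B: "B \<in> carrier_mat n k"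
    and "(\<forall>i<m. \<forall>j<n. g dvd A $$ (i,j)) \<or> (\<forall>i<n. \<forall>j<k. g dvd B $$ (i,j))"
    and ij: "i < m" "j < k"
  shows "g dvd (A * B) $$ (i,j)"
proof -
  have "(A * B) $$ (i,j) = (\<Sum>l<n. A $$ (i,l) * B $$ (l,j))"
    using A B ij by (auto simp: scalar_prod_def atLeast0LessThan intro!: sum.cong)
  also have "g dvd \<dots>" using assms(3) ij by (intro dvd_sum) auto
  finally show ?thesis .
qed

lemma mat_equiv_dvd:
  fixes A :: "'a :: comm_ring_1 mat"
  assumes "mat_equiv A B" and A: "A \<in> carrier_mat m n" and "\<And>i j. i < m \<Longrightarrow> j < n \<Longrightarrow> g dvd A $$ (i,j)"
    and ij: "i < m" "j < n"
  shows "g dvd B $$ (i,j)"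
proof -
  obtain U V where 1: "U \<in> carrier_mat m m" "V \<in> carrier_mat n n" "B = U * A * V"
    using mat_equivE[OF assms(1) A] by metis
  have "g dvd (U * A) $$ (i,j)" if "i < m" "j < n" for i j
    using dvd_mat_mult[OF 1(1) A] assms(3) that by auto
  then show ?thesis unfolding 1(3) using 1 A ij by (intro dvd_mat_mult[of _ m n _ n]) auto
qed

text \<open>A Euclidean division on \<open>'a\<close> is passed as a size function, so that the result applies
  to the polynomials and also to every field, which need not be an instance of a Euclidean class.\<close>

lemma mat_equiv_pivot:
  fixes A :: "'a :: comm_ring_1 mat" and f :: "'a \<Rightarrow> nat"
  assumes division: "\<And>a b. b \<noteq> 0 \<Longrightarrow> \<exists>q. a = q * b \<or> f (a - q * b) < f b"
    and A: "A \<in> carrier_mat m n" and A0: "A \<noteq> 0\<^sub>m m n"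
  obtains B where "mat_equiv A B" "B $$ (0,0) \<noteq> 0"
    "\<And>i j. i < m \<Longrightarrow> j < n \<Longrightarrow> B $$ (0,0) dvd B $$ (i,j)"
proof -
  obtain i j where ij: "i < m" "j < n" "A $$ (i,j) \<noteq> 0" using A A0 by (auto simp: mat_eq_iff)
  have mn: "0 < m" "0 < n" using ij by auto
  obtain B0 where "mat_equiv A B0 \<and> B0 $$ (0,0) \<noteq> 0"
    using mat_equiv_move[OF A ij(1,2)] ij(3) by metis
  from ex_has_least_nat[of "\<lambda>B. mat_equiv A B \<and> B $$ (0,0) \<noteq> 0", OF this, of "\<lambda>B. f (B $$ (0,0))"]
  obtain B where B: "mat_equiv A B" "B $$ (0,0) \<noteq> 0"
    and least: "\<And>C. mat_equiv A C \<Longrightarrow> C $$ (0,0) \<noteq> 0 \<Longrightarrow> f (B $$ (0,0)) \<le> f (C $$ (0,0))" by blast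
  define g where "g = B $$ (0,0)"
  have g0: "g \<noteq> 0" using B g_def by auto
  have least': "f g \<le> f (C $$ (i,j))" if "mat_equiv A C" "C $$ (i,j) \<noteq> 0" "i < m" "j < n" for C i j
    using mat_equiv_move[of C m n i j] that least mat_equiv_trans mat_equiv_carrier[OF _ A] g_def
    by metis
  have carr: "C \<in> carrier_mat m n" if "mat_equiv A C" for C using mat_equiv_carrier[OF that A] .
  have row: "g dvd C $$ (0,j)" if C: "mat_equiv A C" "C $$ (0,0) = g" and j: "j < n" for C j
  proof (cases "j = 0")
    case False
    obtain q where q: "C $$ (0,j) = q * g \<or> f (C $$ (0,j) - q * g) < f g" using division[OF g0] by blast
    have "mat_equiv A (addcol (-q) j 0 C)"
      using mat_equiv_ops(4)[OF carr[OF C(1)], of j 0] j False C(1) mat_equiv_trans by blast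
    moreover have "addcol (-q) j 0 C $$ (0,j) = C $$ (0,j) - q * g"
      using carr[OF C(1)] C mn j by auto
    ultimately have "C $$ (0,j) = q * g" using q least' j mn by (metis eq_iff_diff_eq_0 linorder_not_less)
    then show ?thesis by simp
  qed (use C in auto)
  have col: "g dvd B $$ (i,0)" if i: "i < m" for i
  proof (cases "i = 0")
    case False
    obtain q where q: "B $$ (i,0) = q * g \<or> f (B $$ (i,0) - q * g) < f g" using division[OF g0] by blast
    have "mat_equiv A (addrow (-q) i 0 B)"
      using mat_equiv_ops(3)[OF carr[OF B(1)], of i 0] i False B(1) mat_equiv_trans by blast
    moreover have "addrow (-q) i 0 B $$ (i,0) = B $$ (i,0) - q * g"
      using carr[OF B(1)] g_def mn i by auto
    ultimately have "B $$ (i,0) = q * g" using q least' i mn by (metis eq_iff_diff_eq_0 linorder_not_less)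
    then show ?thesis by simp
  qed (use g_def in auto)
  have "g dvd B $$ (i,j)" if ij: "i < m" "j < n" for i j
  proof (cases "i = 0")
    case False
    obtain h where h: "B $$ (i,0) = h * g" using col[OF ij(1)] by (metis dvd_def mult.commute)
    define C where "C = addrow (-h) i 0 B"
    define D where "D = addrow 1 0 i C"
    have C: "mat_equiv A C" unfolding C_def
      using mat_equiv_ops(3)[OF carr[OF B(1)], of i 0] ij False B(1) mat_equiv_trans by blast
    have D: "mat_equiv A D" unfolding D_def
      using mat_equiv_ops(3)[OF carr[OF C], of 0 i] ij mn False C mat_equiv_trans by blast
    have Bc: "dim_row B = m" "dim_col B = n" using carr[OF B(1)] by auto
    have "D $$ (0,0) = g" unfolding D_def C_def using Bc mn ij False h g_def by auto
    from row[OF D this ij(2)] have "g dvd D $$ (0,j)" .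
    moreover have "D $$ (0,j) = B $$ (i,j) + (B $$ (0,j) - h * B $$ (0,j))"
      unfolding D_def C_def using Bc mn ij False by auto
    moreover have "g dvd B $$ (0,j)" using row[OF B(1) g_def[symmetric] ij(2)] .
    ultimately show ?thesis by (metis dvd_add_left_iff dvd_diff dvd_mult)
  qed (use row[OF B(1) g_def[symmetric]] ij in auto)
  with B show ?thesis using that g_def by blast
qed

lemma mat_equiv_four_block:
  fixes D :: "'a :: comm_ring_1 mat"
  assumes D: "D \<in> carrier_mat m n" and G: "G \<in> carrier_mat 1 1" and "mat_equiv D S"
  shows "mat_equiv (four_block_mat G (0\<^sub>m 1 n) (0\<^sub>m m 1) D) (four_block_mat G (0\<^sub>m 1 n) (0\<^sub>m m 1) S)"
proof -
  obtain U V where 1: "U \<in> carrier_mat m m" "V \<in> carrier_mat n n"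
    "invertible_mat U" "invertible_mat V" "S = U * D * V"
    using mat_equivE[OF assms(3) D] by metis
  have inv: "invertible_mat (four_block_mat (1\<^sub>m 1) (0\<^sub>m 1 k) (0\<^sub>m k 1) W)"
    if W0: "W \<in> carrier_mat k k" "invertible_mat W" for W :: "'a mat" and k
  proof -
    obtain W' where W: "W' \<in> carrier_mat k k" "W * W' = 1\<^sub>m k" "W' * W = 1\<^sub>m k"
      using invertible_matE[OF W0(2,1)] by blast
    show ?thesis
      by (rule invertible_matI[of _ "1 + k" "four_block_mat (1\<^sub>m 1) (0\<^sub>m 1 k) (0\<^sub>m k 1) W'"])
         (use W that in \<open>auto simp: mult_four_block_mat[of _ 1 1 _ k _ k _ _ 1 _ k]
            left_add_zero_mat[of _ 1 1] left_add_zero_mat[of _ k k] right_add_zero_mat[of _ 1 1]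
            simp del: One_nat_def\<close>)
  qed
  show ?thesis
    by (rule mat_equivI[of _ "1 + m" "1 + n" "four_block_mat (1\<^sub>m 1) (0\<^sub>m 1 m) (0\<^sub>m m 1) U"
          "four_block_mat (1\<^sub>m 1) (0\<^sub>m 1 n) (0\<^sub>m n 1) V"])
       (use 1 D G in \<open>auto intro!: inv simp: mult_four_block_mat[of _ 1 1 _ m _ m _ _ 1 _ n]
          mult_four_block_mat[of _ 1 1 _ n _ m _ _ 1 _ n] left_add_zero_mat[of _ 1 1]
          right_add_zero_mat[of _ 1 1] left_add_zero_mat[of _ m n]
          simp del: One_nat_def\<close>)
qed

lemma mat_equiv_clear_pivot:
  fixes B :: "'a :: comm_ring_1 mat"
  assumes B: "B \<in> carrier_mat (Suc m) (Suc n)"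
    and dvd: "\<And>i j. i < Suc m \<Longrightarrow> j < Suc n \<Longrightarrow> g dvd B $$ (i,j)" and g: "B $$ (0,0) = g"
  obtains D where "D \<in> carrier_mat m n"
    "mat_equiv B (four_block_mat (mat 1 1 (\<lambda>_. g)) (0\<^sub>m 1 n) (0\<^sub>m m 1) D)"
proof -
  define x where "x i = (SOME x. B $$ (Suc i, 0) = x * g)" for i
  define y where "y j = (SOME y. B $$ (0, Suc j) = g * y)" for j
  have x: "B $$ (Suc i, 0) = x i * g" if "i < m" for i
    unfolding x_def by (rule someI_ex) (use dvd[of "Suc i" 0] that in \<open>auto simp: dvd_def mult.commute\<close>)
  have y: "B $$ (0, Suc j) = g * y j" if "j < n" for j
    unfolding y_def by (rule someI_ex) (use dvd[of 0 "Suc j"] that in \<open>auto simp: dvd_def\<close>)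
  define G where "G = mat 1 1 (\<lambda>_. g)"
  define X where "X = mat m 1 (\<lambda>(i,_). x i)"
  define Y where "Y = mat 1 n (\<lambda>(_,j). y j)"
  define B4 where "B4 = mat m n (\<lambda>(i,j). B $$ (Suc i, Suc j))"
  define D where "D = (- X) * (G * Y) + B4"
  have c: "G \<in> carrier_mat 1 1" "X \<in> carrier_mat m 1" "Y \<in> carrier_mat 1 n" "B4 \<in> carrier_mat m n"
    "D \<in> carrier_mat m n"
    unfolding G_def X_def Y_def B4_def D_def by auto
  have Beq: "B = four_block_mat G (G * Y) (X * G) B4"
  proof (rule eq_matI)
    fix i j assume "i < dim_row (four_block_mat G (G * Y) (X * G) B4)"
      "j < dim_col (four_block_mat G (G * Y) (X * G) B4)"
    then show "B $$ (i,j) = four_block_mat G (G * Y) (X * G) B4 $$ (i,j)"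
      by (cases i; cases j) (auto simp: G_def X_def Y_def B4_def scalar_prod_def x y g)
  qed (use B c in auto)
  define U where "U = four_block_mat (1\<^sub>m 1) (0\<^sub>m 1 m) (- X) (1\<^sub>m m)"
  define U' where "U' = four_block_mat (1\<^sub>m 1) (0\<^sub>m 1 m) X (1\<^sub>m m)"
  define V where "V = four_block_mat (1\<^sub>m 1) (- Y) (0\<^sub>m n 1) (1\<^sub>m n)"
  define V' where "V' = four_block_mat (1\<^sub>m 1) Y (0\<^sub>m n 1) (1\<^sub>m n)"
  have uz: "- (0\<^sub>m a b) = (0\<^sub>m a b :: 'a mat)" for a b by (rule eq_matI) auto
  have canc: "A + - A = 0\<^sub>m a b" "- A + A = 0\<^sub>m a b" if "A \<in> carrier_mat a b" for A :: "'a mat" and a b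
    using that by auto
  note canc = canc[OF c(2)] canc[OF c(3)] canc[of "G * Y" 1 n, OF mult_carrier_mat[OF c(1) c(3)]]
    canc[of "X * G" m 1, OF mult_carrier_mat[OF c(2) c(1)]]
  have "U * U' = 1\<^sub>m (1 + m)" "U' * U = 1\<^sub>m (1 + m)"
    unfolding U_def U'_def four_block_one_mat[symmetric] using c
    by (auto simp: mult_four_block_mat[of _ 1 1 _ m _ m _ _ 1 _ m] simp: uz canc simp del: One_nat_def intro!: cong_four_block_mat)
  moreover have "U \<in> carrier_mat (1 + m) (1 + m)" "U' \<in> carrier_mat (1 + m) (1 + m)"
    unfolding U_def U'_def using c by (intro four_block_carrier_mat; simp)+
  ultimately have U: "U \<in> carrier_mat (1 + m) (1 + m)" "invertible_mat U" using invertible_matI by blast+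
  have "V * V' = 1\<^sub>m (1 + n)" "V' * V = 1\<^sub>m (1 + n)"
    unfolding V_def V'_def four_block_one_mat[symmetric] using c
    by (auto simp: mult_four_block_mat[of _ 1 1 _ n _ n _ _ 1 _ n] simp: uz canc simp del: One_nat_def intro!: cong_four_block_mat)
  moreover have "V \<in> carrier_mat (1 + n) (1 + n)" "V' \<in> carrier_mat (1 + n) (1 + n)"
    unfolding V_def V'_def using c by (intro four_block_carrier_mat; simp)+
  ultimately have V: "V \<in> carrier_mat (1 + n) (1 + n)" "invertible_mat V" using invertible_matI by blast+
  have "U * B = four_block_mat G (G * Y) (0\<^sub>m m 1) D"
    unfolding Beq U_def using c
    by (subst mult_four_block_mat[of _ 1 1 _ m _ m _ _ 1 _ n])
       (auto simp del: One_nat_def intro!: cong_four_block_mat simp: D_def uz canc)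
  also have "\<dots> * V = four_block_mat G (0\<^sub>m 1 n) (0\<^sub>m m 1) D"
    unfolding V_def using c
    by (subst mult_four_block_mat[of _ 1 1 _ n _ m _ _ 1 _ n])
       (auto simp: uz canc simp del: One_nat_def intro!: cong_four_block_mat)
  finally have "mat_equiv B (four_block_mat G (0\<^sub>m 1 n) (0\<^sub>m m 1) D)"
    using U V B by (intro mat_equivI[of B "1 + m" "1 + n" U V]) auto
  with that c(5) show ?thesis unfolding G_def by blast
qed

lemma mat_equiv_diagonal:
  fixes A :: "'a :: comm_ring_1 mat" and f :: "'a \<Rightarrow> nat"
  assumes division: "\<And>a b. b \<noteq> 0 \<Longrightarrow> \<exists>q. a = q * b \<or> f (a - q * b) < f b"
    and A: "A \<in> carrier_mat m n"
  shows "\<exists>S. mat_equiv A S \<and> diagonal_mat S \<and> (\<forall>i. Suc i < min m n \<longrightarrow> S $$ (i,i) dvd S $$ (Suc i, Suc i))"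
  using A
proof (induction m arbitrary: n A)
  case 0
  then show ?case by (intro exI[of _ A]) (auto simp: diagonal_mat_def mat_equiv_refl)
next
  case (Suc m)
  show ?case
  proof (cases "A = 0\<^sub>m (Suc m) n")
    case True
    then show ?thesis by (intro exI[of _ A]) (auto simp: diagonal_mat_def mat_equiv_refl)
  next
    case False
    then obtain k where n: "n = Suc k" using Suc.prems by (cases n) (auto simp: mat_eq_iff)
    obtain B where B: "mat_equiv A B" "B $$ (0,0) \<noteq> 0"
      "\<And>i j. i < Suc m \<Longrightarrow> j < Suc k \<Longrightarrow> B $$ (0,0) dvd B $$ (i,j)"
      using mat_equiv_pivot[OF division Suc.prems False] n by metis
    have Bc: "B \<in> carrier_mat (Suc m) (Suc k)" using mat_equiv_carrier[OF B(1) Suc.prems] n by simp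
    define g where "g = B $$ (0,0)"
    define G where "G = mat 1 1 (\<lambda>_. g)"
    have G: "G \<in> carrier_mat 1 1" by (simp add: G_def)
    obtain D where D: "D \<in> carrier_mat m k" and
      BD: "mat_equiv B (four_block_mat G (0\<^sub>m 1 k) (0\<^sub>m m 1) D)" (is "mat_equiv B ?BD")
      using mat_equiv_clear_pivot[OF Bc B(3)] unfolding g_def G_def by blast
    obtain S where S: "mat_equiv D S" "diagonal_mat S"
      "\<And>i. Suc i < min m k \<Longrightarrow> S $$ (i,i) dvd S $$ (Suc i, Suc i)"
      using Suc.IH[OF D] by blast
    have Sc: "S \<in> carrier_mat m k" using mat_equiv_carrier[OF S(1) D] .
    have gdvd: "g dvd ?BD $$ (i,j)" if "i < Suc m" "j < Suc k" for i j
      using mat_equiv_dvd[OF BD Bc] B(3) that unfolding g_def by blast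
    have "g dvd D $$ (i,j)" if "i < m" "j < k" for i j
      using gdvd[of "Suc i" "Suc j"] that D G by simp
    then have gS: "g dvd S $$ (i,j)" if "i < m" "j < k" for i j
      using mat_equiv_dvd[OF S(1) D] that by blast
    let ?T = "four_block_mat G (0\<^sub>m 1 k) (0\<^sub>m m 1) S"
    have "mat_equiv A ?T"
      using mat_equiv_trans[OF B(1) mat_equiv_trans[OF BD mat_equiv_four_block[OF D G S(1)]]] .
    moreover have "diagonal_mat ?T"
      using S(2) Sc G unfolding diagonal_mat_def by auto
    moreover have "?T $$ (i,i) dvd ?T $$ (Suc i, Suc i)" if "Suc i < min (Suc m) n" for i
      using that S(3)[of "i - 1"] gS[of 0 0] Sc G n by (cases i) (auto simp: G_def)
    ultimately show ?thesis by blast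
  qed
qed


section \<open>Injective matrices and rank\<close>

definition inj_mat :: "'a::semiring_0 mat \<Rightarrow> bool" where
  "inj_mat A \<longleftrightarrow> (\<forall>v \<in> carrier_vec (dim_col A). A *\<^sub>v v = 0\<^sub>v (dim_row A) \<longrightarrow> v = 0\<^sub>v (dim_col A))"

lemma inj_matD:
  "inj_mat A \<Longrightarrow> A \<in> carrier_mat m n \<Longrightarrow> v \<in> carrier_vec n \<Longrightarrow> A *\<^sub>v v = 0\<^sub>v m \<Longrightarrow> v = 0\<^sub>v n"
  unfolding inj_mat_def by auto

lemma inj_matI:
  "A \<in> carrier_mat m n \<Longrightarrow> (\<And>v. v \<in> carrier_vec n \<Longrightarrow> A *\<^sub>v v = 0\<^sub>v m \<Longrightarrow> v = 0\<^sub>v n) \<Longrightarrow> inj_mat A"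
  unfolding inj_mat_def by auto

lemma mult_mat_unit_vec:
  "A \<in> carrier_mat m n \<Longrightarrow> i < n \<Longrightarrow> A *\<^sub>v unit_vec n i = col (A :: 'a :: semiring_1 mat) i"
  by (rule eq_vecI) auto

lemma inj_mat_cancel:
  fixes A :: "'a :: comm_ring_1 mat"
  assumes "inj_mat A" and A: "A \<in> carrier_mat m n" and X: "X \<in> carrier_mat n k"
    and Y: "Y \<in> carrier_mat n k" and eq: "A * X = A * Y"
  shows "X = Y"
proof (rule mat_col_eqI)
  fix i assume i: "i < dim_col Y"
  then have c: "col X i \<in> carrier_vec n" "col Y i \<in> carrier_vec n" using X Y by auto
  have "A *\<^sub>v (col X i - col Y i) = A *\<^sub>v col X i - A *\<^sub>v col Y i"
    using A c by (rule mult_minus_distrib_mat_vec)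
  also have "A *\<^sub>v col X i = col (A * X) i" using A X Y i by auto
  also have "A *\<^sub>v col Y i = col (A * Y) i" using A X Y i by auto
  finally have "A *\<^sub>v (col X i - col Y i) = 0\<^sub>v m" using eq A by auto
  from inj_matD[OF assms(1) A _ this] c have 0: "col X i - col Y i = 0\<^sub>v n" by auto
  show "col X i = col Y i"
  proof (rule eq_vecI)
    fix k assume "k < dim_vec (col Y i)"
    then show "col X i $ k = col Y i $ k"
      using arg_cong[OF 0, of "\<lambda>v. v $ k"] c Y by simp
  qed (use X Y in auto)
qed (use X Y in auto)

lemma inj_mat_right_factor:
  fixes A :: "'a :: comm_ring_1 mat"
  assumes "inj_mat (A * B)" "A \<in> carrier_mat m n" "B \<in> carrier_mat n k"
  shows "inj_mat B"
proof (rule inj_matI[OF assms(3)])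
  fix v assume v: "v \<in> carrier_vec k" "B *\<^sub>v v = 0\<^sub>v n"
  have "(A * B) *\<^sub>v v = A *\<^sub>v (B *\<^sub>v v)" using assms v by (intro assoc_mult_mat_vec) auto
  then have "(A * B) *\<^sub>v v = 0\<^sub>v m"
    using v assms by (auto)
  then show "v = 0\<^sub>v k" using inj_matD[OF assms(1) mult_carrier_mat[OF assms(2,3)] v(1)] by simp
qed

lemma left_inverse_imp_inj_mat:
  fixes A :: "'a :: comm_ring_1 mat"
  assumes "A \<in> carrier_mat m n" "N \<in> carrier_mat n m" "N * A = 1\<^sub>m n"
  shows "inj_mat A"
proof (rule inj_mat_right_factor)
  show "inj_mat (N * A)" unfolding assms(3) by (rule inj_matI[of _ n n]) auto
qed (use assms in auto)

lemma inj_mat_square_iff_det: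
  fixes A :: "'a :: idom mat"
  assumes "A \<in> carrier_mat n n"
  shows "inj_mat A \<longleftrightarrow> det A \<noteq> 0"
  using assms unfolding det_0_iff_vec_prod_zero[OF assms] inj_mat_def by auto

lemma wide_not_inj_mat:
  fixes A :: "'a :: idom mat"
  assumes A: "A \<in> carrier_mat m n" and "m < n"
  shows "\<not> inj_mat A"
proof
  assume inj: "inj_mat A"
  define B where "B = mat n n (\<lambda>(i,j). if i < m then A $$ (i,j) else 0)"
  have B: "B \<in> carrier_mat n n" by (simp add: B_def)
  have "B\<^sup>T *\<^sub>v unit_vec n (n - 1) = 0\<^sub>v n"
    using mult_mat_unit_vec[of "B\<^sup>T" n n "n - 1"] assms by (auto simp: B_def)
  then have "det B\<^sup>T = 0"
    unfolding det_0_iff_vec_prod_zero[OF transpose_carrier_mat[THEN iffD2, OF B]]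
    using unit_vec_nonzero[of "n - 1" n] assms(2) by (intro exI[of _ "unit_vec n (n - 1)"]) auto
  then have "det B = 0" using det_transpose[OF B] by simp
  then obtain v where v: "v \<in> carrier_vec n" "v \<noteq> 0\<^sub>v n" "B *\<^sub>v v = 0\<^sub>v n"
    using det_0_iff_vec_prod_zero[OF B] by auto
  have "A *\<^sub>v v = 0\<^sub>v m"
  proof (rule eq_vecI)
    fix i assume "i < dim_vec (0\<^sub>v m :: 'a vec)"
    then have i: "i < m" by simp
    have "row A i = row B i" using i assms by (auto simp: B_def)
    then have "(A *\<^sub>v v) $ i = (B *\<^sub>v v) $ i" using i assms by (simp add: B_def)
    then show "(A *\<^sub>v v) $ i = 0\<^sub>v m $ i" using v i assms by simp
  qed (use A in auto)
  then show False using inj_matD[OF inj A v(1)] v by auto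
qed

lemma factor_through_colsI:
  fixes A :: "'a :: semiring_0 mat"
  assumes A: "A \<in> carrier_mat m n" and B: "B \<in> carrier_mat m k"
    and ex: "\<And>j. j < n \<Longrightarrow> \<exists>x \<in> carrier_vec k. B *\<^sub>v x = col A j"
  obtains X where "X \<in> carrier_mat k n" "A = B * X"
proof -
  have "\<forall>j. \<exists>x. j < n \<longrightarrow> x \<in> carrier_vec k \<and> B *\<^sub>v x = col A j" using ex by blast
  then obtain x where x: "\<And>j. j < n \<Longrightarrow> x j \<in> carrier_vec k \<and> B *\<^sub>v x j = col A j" by metis
  define X where "X = mat_of_cols k (map x [0..<n])"
  have X: "X \<in> carrier_mat k n" by (auto simp: X_def)
  have "A = B * X"
  proof (rule mat_col_eqI)
    fix i assume "i < dim_col (B * X)"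
    then have i: "i < n" using X by auto
    have "col X i = x i" unfolding X_def using x i by (subst col_mat_of_cols) auto
    moreover have "col (B * X) i = B *\<^sub>v col X i" by (rule eq_vecI) (use B X i in auto)
    ultimately show "col A i = col (B * X) i" using x[OF i] by simp
  qed (use A B X in auto)
  then show ?thesis using that X by blast
qed

context vec_space begin

lemma maximal_indpt_cols:
  assumes A: "A \<in> carrier_mat n k"
  obtains B C where "B \<in> carrier_mat n (rank A)" "set (cols B) \<subseteq> set (cols A)"
    "distinct (cols B)" "lin_indpt (set (cols B))" "C \<in> carrier_mat (rank A) k" "A = B * C"
proof -
  have cA: "set (cols A) \<subseteq> carrier_vec n" using A cols_dim by blast
  have e: "{} \<subseteq> set (cols A) \<and> lin_indpt {}" by (simp add: lin_dep_def)
  from maximal_exists_superset[of "set (cols A)" "\<lambda>T. T \<subseteq> set (cols A) \<and> lin_indpt T", OF _ _ e]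
  obtain S where S: "finite S" "maximal S (\<lambda>T. T \<subseteq> set (cols A) \<and> lin_indpt T)" by auto
  then have S': "S \<subseteq> set (cols A)" "lin_indpt S" and cS: "S \<subseteq> carrier_vec n"
    using cA by (auto simp: maximal_def)
  have r: "rank A = card S" using rank_card_indpt[OF A S(2)] .
  obtain xs where xs: "set xs = S" "distinct xs" using finite_distinct_list S(1) by auto
  define B where "B = mat_of_cols n xs"
  have colsB: "cols B = xs" unfolding B_def using xs cS by auto
  have B: "B \<in> carrier_mat n (rank A)" unfolding B_def r using xs distinct_card by fastforce
  have ex: "\<exists>x \<in> carrier_vec (rank A). B *\<^sub>v x = col A j" if j: "j < k" for j
  proof -
    have s: "col A j \<in> set (cols A)"
      using A j by (metis carrier_matD(2) cols_length cols_nth nth_mem)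
    have "col A j \<in> span S"
    proof (cases "col A j \<in> S")
      case True
      then show ?thesis using span_mem[OF cS] by auto
    next
      case False
      then have "lin_dep (S \<union> {col A j})" using S(2) s S' unfolding maximal_def by blast
      then show ?thesis using lin_dep_iff_in_span[OF cS S'(2), of "col A j"] s cA False by auto
    qed
    then show ?thesis using col_space_eq[OF B] B unfolding col_space_def colsB xs by auto
  qed
  obtain C where C: "C \<in> carrier_mat (rank A) k" "A = B * C" using factor_through_colsI[OF A B ex] .
  then show ?thesis using that[OF B _ _ _ C(1)] colsB xs S' C(2) by auto
qed

lemma rank_le_factor:
  assumes A: "A = B * C" and B: "B \<in> carrier_mat n k" and C: "C \<in> carrier_mat k l"
  shows "rank A \<le> k"
proof (rule ccontr)
  assume neg: "\<not> ?thesis"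
  have Ac: "A \<in> carrier_mat n l" using assms by auto
  obtain D where D: "D \<in> carrier_mat n (rank A)" "set (cols D) \<subseteq> set (cols A)"
    "distinct (cols D)" "lin_indpt (set (cols D))" using maximal_indpt_cols[OF Ac] by metis
  have ex: "\<exists>x \<in> carrier_vec k. B *\<^sub>v x = col D j" if "j < rank A" for j
  proof -
    have "col D j \<in> set (cols D)" using D(1) that by (metis carrier_matD(2) cols_length cols_nth nth_mem)
    then obtain i where "i < l" "col D j = col A i"
      using D(2) Ac by (metis carrier_matD(2) cols_length cols_nth in_set_conv_nth subsetD)
    then show ?thesis unfolding A using B C by (intro bexI[of _ "col C i"]) auto
  qed
  obtain F where F: "F \<in> carrier_mat k (rank A)" "D = B * F" using factor_through_colsI[OF D(1) B ex] .
  have "inj_mat D"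
    using lin_depI[OF D(1) _ _ _ D(3)] D(4) by (intro inj_matI[OF D(1)]) auto
  then have "inj_mat F" using inj_mat_right_factor[OF _ B F(1)] F(2) by auto
  then show False using wide_not_inj_mat[OF F(1)] neg by auto
qed

end

lemma rank_mult_le_left:
  fixes A :: "'a :: field mat"
  assumes A: "A \<in> carrier_mat m n" and B: "B \<in> carrier_mat n k"
  shows "vec_space.rank m (A * B) \<le> vec_space.rank m A"
proof -
  obtain X Y where XY: "X \<in> carrier_mat m (vec_space.rank m A)" "Y \<in> carrier_mat (vec_space.rank m A) n"
    "A = X * Y" using vec_space.maximal_indpt_cols[OF A] by metis
  then have "A * B = X * (Y * B)" using B by (simp add: mat_mult_assoc)
  from vec_space.rank_le_factor[OF this XY(1) mult_carrier_mat[OF XY(2) B]] show ?thesis .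
qed

lemma rank_mult_le_right:
  fixes A :: "'a :: field mat"
  assumes A: "A \<in> carrier_mat m n" and B: "B \<in> carrier_mat n k"
  shows "vec_space.rank m (A * B) \<le> vec_space.rank n B"
proof -
  obtain X Y where XY: "X \<in> carrier_mat n (vec_space.rank n B)" "Y \<in> carrier_mat (vec_space.rank n B) k"
    "B = X * Y" using vec_space.maximal_indpt_cols[OF B] by metis
  then have "A * B = (A * X) * Y" using A by (simp add: mat_mult_assoc)
  from vec_space.rank_le_factor[OF this mult_carrier_mat[OF A XY(1)] XY(2)] show ?thesis .
qed

lemma rank_mat_equiv:
  fixes A :: "'a :: field mat"
  assumes "mat_equiv A B" and A: "A \<in> carrier_mat m n"
  shows "vec_space.rank m B = vec_space.rank m A"
proof -
  obtain U V where UV: "U \<in> carrier_mat m m" "V \<in> carrier_mat n n"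
    "invertible_mat U" "invertible_mat V" "B = U * A * V" using mat_equivE[OF assms] by metis
  obtain U' where U': "U' \<in> carrier_mat m m" "U' * U = 1\<^sub>m m" using invertible_matE[OF UV(3,1)] by metis
  obtain V' where V': "V' \<in> carrier_mat n n" "V * V' = 1\<^sub>m n" using invertible_matE[OF UV(4,2)] by metis
  have "U' * B * V' = (U' * U) * A * (V * V')"
    unfolding UV(5) using UV(1,2) U'(1) V'(1) A by (simp add: mat_mult_assoc)
  then have A': "A = U' * B * V'" using U' V' A by simp
  have *: "vec_space.rank m (P * X * Q) \<le> vec_space.rank m X"
    if "X \<in> carrier_mat m n" "P \<in> carrier_mat m m" "Q \<in> carrier_mat n n" for X P Q :: "'a mat"
    using rank_mult_le_left[of "P * X" m n Q n] rank_mult_le_right[of P m m X n] that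
    by (meson le_trans mult_carrier_mat)
  have "B \<in> carrier_mat m n" using mat_equiv_carrier assms by blast
  from *[OF this U'(1) V'(1)] have "vec_space.rank m A \<le> vec_space.rank m B" unfolding A'[symmetric] .
  moreover have "vec_space.rank m B \<le> vec_space.rank m A"
    using *[OF A UV(1,2)] unfolding UV(5)[symmetric] .
  ultimately show ?thesis by simp
qed

lemma inj_mat_left_inverse:
  fixes A :: "'a :: field mat"
  assumes "inj_mat A" and A: "A \<in> carrier_mat m n"
  obtains N where "N \<in> carrier_mat n m" "N * A = 1\<^sub>m n"
proof -
  have "\<exists>q. a = q * b \<or> (\<lambda>_. 0::nat) (a - q * b) < (\<lambda>_. 0) b" if "b \<noteq> 0" for a b :: 'a
    using that by (intro exI[of _ "a / b"]) auto
  from mat_equiv_diagonal[of "\<lambda>_. 0", OF this A]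
  obtain D where D: "mat_equiv A D" "diagonal_mat D" by blast
  obtain U V where UV: "U \<in> carrier_mat m m" "V \<in> carrier_mat n n"
    "invertible_mat U" "invertible_mat V" "D = U * A * V" and Dc: "D \<in> carrier_mat m n"
    using mat_equivE[OF D(1) A] by metis
  obtain V' where V': "V' \<in> carrier_mat n n" "V * V' = 1\<^sub>m n" "V' * V = 1\<^sub>m n"
    using invertible_matE[OF UV(4,2)] by metis
  obtain U' where U': "U' \<in> carrier_mat m m" "U' * U = 1\<^sub>m m" using invertible_matE[OF UV(3,1)] by metis
  have inj: "inj_mat D"
  proof -
    have "inj_mat V" using left_inverse_imp_inj_mat[OF UV(2) V'(1,3)] .
    moreover have "U' * D = A * V"
    proof -
      have "U' * D = (U' * U) * A * V" unfolding UV(5) using U'(1) UV(1,2) A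
        by (simp add: mat_mult_assoc)
      then show ?thesis using U' A by simp
    qed
    moreover have "inj_mat (A * V)"
    proof (rule inj_matI)
      show "A * V \<in> carrier_mat m n" using A UV by auto
      fix v :: "'a vec" assume v: "v \<in> carrier_vec n" "(A * V) *\<^sub>v v = 0\<^sub>v m"
      then have "A *\<^sub>v (V *\<^sub>v v) = 0\<^sub>v m" using A UV(2) by simp
      then have "V *\<^sub>v v = 0\<^sub>v n" using inj_matD[OF assms(1) A] UV(2) v by auto
      then show "v = 0\<^sub>v n" using inj_matD[OF \<open>inj_mat V\<close> UV(2) v(1)] by auto
    qed
    ultimately show ?thesis using inj_mat_right_factor[of U' D m m n] U' Dc by auto
  qed
  have ne: "j < m \<and> D $$ (j,j) \<noteq> 0" if j: "j < n" for j
  proof (rule ccontr)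
    assume neg: "\<not> ?thesis"
    have "col D j = 0\<^sub>v m"
    proof (rule eq_vecI)
      fix i assume "i < dim_vec (0\<^sub>v m :: 'a vec)"
      then show "col D j $ i = 0\<^sub>v m $ i"
        using neg j D(2) Dc unfolding diagonal_mat_def by (cases "i = j") auto
    qed (use Dc in auto)
    then have "D *\<^sub>v unit_vec n j = 0\<^sub>v m" using mult_mat_unit_vec[OF Dc j] by auto
    then have "unit_vec n j = (0\<^sub>v n :: 'a vec)" using inj_matD[OF inj Dc] by auto
    then show False using j by simp
  qed
  define N0 where "N0 = mat n m (\<lambda>(i,j). if i = j then 1 / D $$ (i,i) else 0)"
  have N0: "N0 \<in> carrier_mat n m" by (simp add: N0_def)
  have N0D: "N0 * D = 1\<^sub>m n"
  proof (rule eq_matI)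
    fix i j assume "i < dim_row (1\<^sub>m n :: 'a mat)" "j < dim_col (1\<^sub>m n :: 'a mat)"
    then have ij: "i < n" "j < n" by auto
    have "(N0 * D) $$ (i,j) = (\<Sum>l\<in>{0..<m}. (if i = l then 1 / D $$ (i,i) else 0) * D $$ (l,j))"
      using ij N0 Dc by (auto simp: scalar_prod_def N0_def)
    also have "\<dots> = (\<Sum>l\<in>{0..<m}. if i = l then D $$ (l,j) / D $$ (i,i) else 0)"
      by (intro sum.cong) auto
    also have "\<dots> = D $$ (i,j) / D $$ (i,i)" using ne[OF ij(1)] by simp
    also have "\<dots> = 1\<^sub>m n $$ (i,j)" using ij ne[OF ij(1)] D(2) Dc by (auto simp: diagonal_mat_def)
    finally show "(N0 * D) $$ (i,j) = 1\<^sub>m n $$ (i,j)" .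
  qed (use N0 Dc in auto)
  have "V * N0 * U * A = V * (N0 * (U * A * (V * V')))"
    using UV(1,2) V' N0 A by (simp add: mat_mult_assoc)
  also have "\<dots> = V * (N0 * D) * V'"
    unfolding UV(5) using UV(1,2) V'(1) N0 A by (simp add: mat_mult_assoc)
  also have "\<dots> = 1\<^sub>m n" unfolding N0D using UV(2) V' by simp
  finally show ?thesis
    using that[OF mult_carrier_mat[OF mult_carrier_mat[OF UV(2) N0] UV(1)]] by blast
qed

lemma rank_inj_congruence:
  fixes L :: "'a :: field mat"
  assumes "inj_mat L" and L: "L \<in> carrier_mat m n" and Q: "Q \<in> carrier_mat n n"
  shows "vec_space.rank m (L * Q * L\<^sup>T) = n \<longleftrightarrow> det Q \<noteq> 0"
proof -
  let ?P = "L * Q * L\<^sup>T"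
  have P: "?P \<in> carrier_mat m m" using L Q by auto
  obtain N where N: "N \<in> carrier_mat n m" "N * L = 1\<^sub>m n" using inj_mat_left_inverse[OF assms(1,2)] .
  have LN: "L\<^sup>T * N\<^sup>T = 1\<^sub>m n" using transpose_mult[OF N(1) L] N by simp
  have "N * ?P * N\<^sup>T = (N * L) * Q * (L\<^sup>T * N\<^sup>T)"
    using N(1) L Q by (simp add: mat_mult_assoc)
  then have NPN: "N * ?P * N\<^sup>T = Q" using N LN Q by simp
  have "vec_space.rank n Q \<le> vec_space.rank n (N * ?P)"
    using rank_mult_le_left[of "N * ?P" n m "N\<^sup>T" n] N(1) P unfolding NPN by auto
  also have "\<dots> \<le> vec_space.rank m ?P" using rank_mult_le_right[OF N(1) P] .
  finally have 1: "vec_space.rank n Q \<le> vec_space.rank m ?P" .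
  have "vec_space.rank m ?P \<le> vec_space.rank m (L * Q)"
    using rank_mult_le_left[of "L * Q" m n "L\<^sup>T" m] L Q by auto
  also have "\<dots> \<le> vec_space.rank n Q" using rank_mult_le_right[OF L Q] .
  finally have "vec_space.rank m ?P = vec_space.rank n Q" using 1 by simp
  then show ?thesis using vec_space.det_rank_iff[OF Q] by simp
qed

lemma rank_full_imp_inj_mat:
  fixes L :: "'a :: field mat"
  assumes L: "L \<in> carrier_mat m n" and X: "X \<in> carrier_mat n k" and r: "vec_space.rank m (L * X) = n"
  shows "inj_mat L"
proof -
  have "vec_space.rank m L = n"
    using rank_mult_le_left[OF L X] r vec_space.rank_le_nc[OF L] by simp
  then obtain B where B: "B \<in> carrier_mat m n" "set (cols B) \<subseteq> set (cols L)" "distinct (cols B)"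
    using vec_space.maximal_indpt_cols[OF L] by metis
  have d: "distinct (cols L)"
  proof (rule card_distinct)
    have "n = card (set (cols B))" using B distinct_card by fastforce
    also have "\<dots> \<le> card (set (cols L))" using B(2) by (intro card_mono) auto
    finally show "card (set (cols L)) = length (cols L)" using card_length[of "cols L"] L by auto
  qed
  show ?thesis
    using vec_space.full_rank_lin_indpt[OF L \<open>vec_space.rank m L = n\<close> d] vec_space.lin_depI[OF L _ _ _ d]
    by (intro inj_matI[OF L]) auto
qed

lemma rank_diagonal_mat:
  fixes D :: "'a :: field mat"
  assumes D: "D \<in> carrier_mat m n" and diag: "diagonal_mat D"
  shows "vec_space.rank m D = card {i. i < min m n \<and> D $$ (i,i) \<noteq> 0}"
proof -
  let ?K = "{i. i < min m n \<and> D $$ (i,i) \<noteq> 0}"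
  define k where "k = card ?K"
  obtain e where e: "bij_betw e {..<k} ?K"
    using ex_bij_betw_nat_finite[of ?K] unfolding k_def atLeast0LessThan by auto
  have eK: "e a < m" "e a < n" "D $$ (e a, e a) \<noteq> 0" if "a < k" for a
    using bij_betw_apply[OF e, of a] that by auto
  have inj: "e a = e b \<longleftrightarrow> a = b" if "a < k" "b < k" for a b
    using e that unfolding bij_betw_def inj_on_def by auto
  define B where "B = mat m k (\<lambda>(i,a). if i = e a then 1 else 0 :: 'a)"
  define C where "C = mat k n (\<lambda>(a,j). if j = e a then D $$ (j,j) else 0)"
  have "D = B * C"
  proof (rule eq_matI)
    fix i j assume "i < dim_row (B * C)" "j < dim_col (B * C)"
    then have ij: "i < m" "j < n" by (auto simp: B_def C_def)
    have s: "(B * C) $$ (i,j) = (\<Sum>a<k. if i = e a \<and> j = e a then D $$ (j,j) else 0)"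
      using ij by (auto simp: B_def C_def scalar_prod_def atLeast0LessThan intro!: sum.cong)
    show "D $$ (i,j) = (B * C) $$ (i,j)"
    proof (cases "i = j \<and> D $$ (i,j) \<noteq> 0")
      case True
      then have "i \<in> ?K" using ij by auto
      moreover have "?K = e ` {..<k}" using bij_betw_imp_surj_on[OF e] by (rule sym)
      ultimately obtain b where b: "b < k" "i = e b" by (auto simp del: mem_Collect_eq)
      have "(\<Sum>a<k. if i = e a \<and> j = e a then D $$ (j,j) else 0) = (\<Sum>a<k. if a = b then D $$ (j,j) else 0)"
        using True b inj by (intro sum.cong) auto
      then show ?thesis using s b True by simp
    next
      case False
      then have "D $$ (i,j) = 0" using diag ij D by (auto simp: diagonal_mat_def)
      moreover have "(\<Sum>a<k. if i = e a \<and> j = e a then D $$ (j,j) else 0) = 0"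
        using False by (intro sum.neutral) auto
      ultimately show ?thesis using s by simp
    qed
  qed (use D in \<open>auto simp: B_def C_def\<close>)
  then have le: "vec_space.rank m D \<le> k"
    by (rule vec_space.rank_le_factor) (auto simp: B_def C_def)
  define S where "S = mat k m (\<lambda>(a,i). if i = e a then 1 else 0 :: 'a)"
  define T where "T = mat n k (\<lambda>(j,b). if j = e b then 1 / D $$ (j,j) else 0)"
  have S: "S \<in> carrier_mat k m" and T: "T \<in> carrier_mat n k" by (auto simp: S_def T_def)
  have "S * (D * T) = 1\<^sub>m k"
  proof (rule eq_matI)
    fix a b assume "a < dim_row (1\<^sub>m k :: 'a mat)" "b < dim_col (1\<^sub>m k :: 'a mat)"
    then have ab: "a < k" "b < k" by auto
    have DT: "(D * T) $$ (i,b) = D $$ (i, e b) / D $$ (e b, e b)" if i: "i < m" for i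
    proof -
      have "(D * T) $$ (i,b) = (\<Sum>j<n. if j = e b then D $$ (i, j) / D $$ (j,j) else 0)"
      proof -
        have "(D * T) $$ (i,b) = (\<Sum>j<n. D $$ (i,j) * (if j = e b then 1 / D $$ (j,j) else 0))"
          using i ab D by (simp add: T_def scalar_prod_def atLeast0LessThan)
        also have "\<dots> = (\<Sum>j<n. if j = e b then D $$ (i, j) / D $$ (j,j) else 0)"
          by (intro sum.cong) auto
        finally show ?thesis .
      qed
      then show ?thesis using eK[OF ab(2)] by simp
    qed
    have "(S * (D * T)) $$ (a,b) = (\<Sum>i<m. (if i = e a then 1 else 0) * (D * T) $$ (i,b))"
      using ab S T D by (auto simp: S_def scalar_prod_def atLeast0LessThan intro!: sum.cong)
    also have "\<dots> = (\<Sum>i<m. if i = e a then (D * T) $$ (i,b) else 0)" by (intro sum.cong) auto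
    also have "\<dots> = (D * T) $$ (e a,b)" using eK[OF ab(1)] by simp
    also have "\<dots> = D $$ (e a, e b) / D $$ (e b, e b)" using DT eK[OF ab(1)] by simp
    also have "\<dots> = 1\<^sub>m k $$ (a,b)"
      using ab eK[OF ab(1)] eK[OF ab(2)] inj[OF ab] diag D by (auto simp: diagonal_mat_def)
    finally show "(S * (D * T)) $$ (a,b) = 1\<^sub>m k $$ (a,b)" .
  qed (auto simp: S_def T_def)
  moreover have "vec_space.rank k (1\<^sub>m k :: 'a mat) = k" by (intro vec_space.low_rank_det_zero) auto
  ultimately have "k \<le> vec_space.rank m (D * T)"
    using rank_mult_le_right[OF S, of "D * T" k] D T by auto
  also have "\<dots> \<le> vec_space.rank m D" using rank_mult_le_left[OF D T] .
  finally show ?thesis using le k_def by simp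
qed

section \<open>Smith form and eigenvalues\<close>

definition eval_mat :: "'a::comm_semiring_0 \<Rightarrow> 'a poly mat \<Rightarrow> 'a mat" where
  "eval_mat a P = map_mat (\<lambda>p. poly p a) P"

lemma eval_mat_carrier [simp]: "eval_mat a P \<in> carrier_mat m n \<longleftrightarrow> P \<in> carrier_mat m n"
  by (simp add: eval_mat_def)

lemma eval_mat_index [simp]:
  "i < dim_row P \<Longrightarrow> j < dim_col P \<Longrightarrow> eval_mat a P $$ (i,j) = poly (P $$ (i,j)) a"
  "dim_row (eval_mat a P) = dim_row P" "dim_col (eval_mat a P) = dim_col P"
  by (simp_all add: eval_mat_def)

lemma poly_eval_hom: "comm_ring_hom (\<lambda>p. poly p (a :: 'a :: comm_ring_1))"
  by unfold_locales auto

lemma to_fract_comm_ring_hom: "comm_ring_hom (to_fract :: 'a :: idom \<Rightarrow> 'a fract)"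
  by unfold_locales auto

lemma hom_mult_mat:
  assumes "comm_ring_hom h" "A \<in> carrier_mat m n" "B \<in> carrier_mat n k"
  shows "map_mat h (A * B) = map_mat h A * map_mat h B"
proof -
  interpret comm_ring_hom h by fact
  show ?thesis using mat_hom_mult assms by blast
qed

lemma hom_mult_mat_vec:
  assumes "comm_ring_hom h" "A \<in> carrier_mat m n" "v \<in> carrier_vec n"
  shows "map_vec h (A *\<^sub>v v) = map_mat h A *\<^sub>v map_vec h v"
proof -
  interpret comm_ring_hom h by fact
  show ?thesis using mult_mat_vec_hom assms by blast
qed

lemma hom_one_mat: "comm_ring_hom h \<Longrightarrow> map_mat h (1\<^sub>m n) = 1\<^sub>m n"
proof -
  assume "comm_ring_hom h"
  then interpret comm_ring_hom h .
  show ?thesis by (rule mat_hom_one)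
qed

lemma hom_mat_equiv:
  assumes h: "comm_ring_hom h" and "mat_equiv A B"
  shows "mat_equiv (map_mat h A) (map_mat h B)"
proof -
  define m n where "m = dim_row A" and "n = dim_col A"
  have A: "A \<in> carrier_mat m n" by (auto simp: m_def n_def)
  obtain U V where UV: "U \<in> carrier_mat m m" "V \<in> carrier_mat n n"
    "invertible_mat U" "invertible_mat V" "B = U * A * V" using mat_equivE[OF assms(2) A] by metis
  have inv: "invertible_mat (map_mat h W)" if "invertible_mat W" "W \<in> carrier_mat k k" for W k
  proof -
    obtain W' where W': "W' \<in> carrier_mat k k" "W * W' = 1\<^sub>m k" "W' * W = 1\<^sub>m k"
      using invertible_matE[OF \<open>invertible_mat W\<close> \<open>W \<in> carrier_mat k k\<close>] by blast
    show ?thesis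
      by (rule invertible_matI[of _ k "map_mat h W'"])
         (use that W' in \<open>simp_all add: hom_mult_mat[OF h, symmetric] hom_one_mat[OF h]\<close>)
  qed
  have "map_mat h B = map_mat h U * map_mat h A * map_mat h V"
    unfolding UV(5) using UV(1,2) A
    by (simp add: hom_mult_mat[OF h, of _ m n _ n] hom_mult_mat[OF h, of _ m m _ n])
  then show ?thesis
    using UV A by (intro mat_equivI[of _ m n "map_mat h U" "map_mat h V"] inv) auto
qed

lemma smith_form_iff_mat_equiv:
  assumes "P \<in> carrier_mat m n"
  shows "is_smith_form P S \<longleftrightarrow> mat_equiv P S \<and> diagonal_mat S \<and>
     (\<forall>i < min m n. S $$ (i,i) \<noteq> 0 \<longrightarrow> lead_coeff (S $$ (i,i)) = 1) \<and>
     (\<forall>i. Suc i < min m n \<longrightarrow> S $$ (i,i) dvd S $$ (Suc i, Suc i))"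
  using assms mat_equiv_carrier[of P S m n] unfolding is_smith_form_def mat_equiv_def by auto

lemma smith_form_exists:
  assumes P: "P \<in> carrier_mat m n"
  shows "\<exists>S. is_smith_form P S"
proof -
  have div: "\<exists>q. a = q * b \<or> degree (a - q * b) < degree b" if "b \<noteq> 0" for a b :: "complex poly"
    using degree_mod_less[OF that, of a]
    by (metis diff_eq_eq div_mult_mod_eq add_0 add_diff_cancel_left')
  obtain T where T: "mat_equiv P T" "diagonal_mat T"
    "\<And>i. Suc i < min m n \<Longrightarrow> T $$ (i,i) dvd T $$ (Suc i, Suc i)"
    using mat_equiv_diagonal[of degree, OF div P] by blast
  have Tc: "T \<in> carrier_mat m n" using mat_equiv_carrier[OF T(1) P] .
  define c where "c i = (if i < n \<and> T $$ (i,i) \<noteq> 0 then [:inverse (lead_coeff (T $$ (i,i))):] else 1)" for i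
  define c' where "c' i = (if i < n \<and> T $$ (i,i) \<noteq> 0 then [:lead_coeff (T $$ (i,i)):] else 1)" for i
  have cc': "c i * c' i = 1" "c' i * c i = 1" for i unfolding c_def c'_def by (auto simp: one_pCons)
  define W where "W = mat m m (\<lambda>(i,j). if i = j then c i else 0)"
  define W' where "W' = mat m m (\<lambda>(i,j). if i = j then c' i else 0)"
  have W: "W \<in> carrier_mat m m" "W' \<in> carrier_mat m m" by (auto simp: W_def W'_def)
  have diag_mult: "(mat m m (\<lambda>(i,j). if i = j then x i else 0) * X) $$ (i,j) = x i * X $$ (i,j)"
    if "X \<in> carrier_mat m k" "i < m" "j < k" for x :: "nat \<Rightarrow> complex poly" and X i j k
  proof -
    have "(mat m m (\<lambda>(i,j). if i = j then x i else 0) * X) $$ (i,j)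
        = (\<Sum>l<m. (if i = l then x i else 0) * X $$ (l,j))"
      using that by (simp add: scalar_prod_def atLeast0LessThan)
    also have "\<dots> = (\<Sum>l<m. if i = l then x i * X $$ (l,j) else 0)" by (intro sum.cong) auto
    finally show ?thesis using that by simp
  qed
  have "invertible_mat W"
  proof (rule invertible_matI[OF W])
    show "W * W' = 1\<^sub>m m"
    proof (rule eq_matI)
      fix i j assume "i < dim_row (1\<^sub>m m :: complex poly mat)" "j < dim_col (1\<^sub>m m :: complex poly mat)"
      then have ij: "i < m" "j < m" by auto
      have "(W * W') $$ (i,j) = c i * W' $$ (i,j)" using diag_mult[OF W(2) ij] unfolding W_def .
      then show "(W * W') $$ (i,j) = 1\<^sub>m m $$ (i,j)" using ij cc' by (auto simp: W'_def)
    qed (use W in auto)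
    show "W' * W = 1\<^sub>m m"
    proof (rule eq_matI)
      fix i j assume "i < dim_row (1\<^sub>m m :: complex poly mat)" "j < dim_col (1\<^sub>m m :: complex poly mat)"
      then have ij: "i < m" "j < m" by auto
      have "(W' * W) $$ (i,j) = c' i * W $$ (i,j)" using diag_mult[OF W(1) ij] unfolding W'_def .
      then show "(W' * W) $$ (i,j) = 1\<^sub>m m $$ (i,j)" using ij cc' by (auto simp: W_def)
    qed (use W in auto)
  qed
  define S where "S = W * T"
  have S: "S $$ (i,j) = c i * T $$ (i,j)" if "i < m" "j < n" for i j
    unfolding S_def W_def using diag_mult[OF Tc that] .
  have "mat_equiv P S"
    unfolding S_def using mat_equiv_trans[OF T(1) mat_equiv_left[OF Tc W(1) \<open>invertible_mat W\<close>]] .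
  moreover have "diagonal_mat S" using T(2) Tc W S unfolding diagonal_mat_def by (auto simp: S_def)
  moreover have "lead_coeff (S $$ (i,i)) = 1" if "i < min m n" "S $$ (i,i) \<noteq> 0" for i
    using that S[of i i] by (auto simp: c_def lead_coeff_mult)
  moreover have "S $$ (i,i) dvd S $$ (Suc i, Suc i)" if "Suc i < min m n" for i
  proof -
    have "c i dvd 1" using cc'[of i] by (metis dvd_triv_left)
    then show ?thesis using S[of i i] S[of "Suc i" "Suc i"] T(3)[OF that] that
      by (auto intro!: mult_dvd_mono dvd_trans[of _ 1])
  qed
  ultimately show ?thesis using smith_form_iff_mat_equiv[OF P] by blast
qed

lemma rank_smith_form:
  assumes P: "P \<in> carrier_mat m n" and S: "is_smith_form P S"
  shows "normal_rank P = card {i. i < min m n \<and> S $$ (i,i) \<noteq> 0}"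
    and "vec_space.rank m (eval_mat a P) = card {i. i < min m n \<and> poly (S $$ (i,i)) a \<noteq> 0}"
proof -
  have eq: "mat_equiv P S" and d: "diagonal_mat S" using S smith_form_iff_mat_equiv[OF P] by auto
  have Sc: "S \<in> carrier_mat m n" using mat_equiv_carrier[OF eq P] .
  have "normal_rank P = vec_space.rank m (map_mat to_fract S)"
    unfolding normal_rank_def
    using rank_mat_equiv[OF hom_mat_equiv[OF to_fract_comm_ring_hom eq], where m = m and n = n] P by simp
  also have "\<dots> = card {i. i < min m n \<and> map_mat to_fract S $$ (i,i) \<noteq> 0}"
    using d Sc by (intro rank_diagonal_mat) (auto simp: diagonal_mat_def)
  also have "{i. i < min m n \<and> map_mat to_fract S $$ (i,i) \<noteq> 0} = {i. i < min m n \<and> S $$ (i,i) \<noteq> 0}"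
    using Sc by auto
  finally show "normal_rank P = card {i. i < min m n \<and> S $$ (i,i) \<noteq> 0}" .
  have "vec_space.rank m (eval_mat a P) = vec_space.rank m (eval_mat a S)"
    unfolding eval_mat_def
    using rank_mat_equiv[OF hom_mat_equiv[OF poly_eval_hom eq], where m = m and n = n] P by simp
  also have "\<dots> = card {i. i < min m n \<and> eval_mat a S $$ (i,i) \<noteq> 0}"
    using d Sc by (intro rank_diagonal_mat) (auto simp: diagonal_mat_def)
  also have "{i. i < min m n \<and> eval_mat a S $$ (i,i) \<noteq> 0} = {i. i < min m n \<and> poly (S $$ (i,i)) a \<noteq> 0}"
    using Sc by auto
  finally show "vec_space.rank m (eval_mat a P) = card {i. i < min m n \<and> poly (S $$ (i,i)) a \<noteq> 0}" .
qed

lemma rank_eval_le_normal_rank: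
  assumes P: "P \<in> carrier_mat m n"
  shows "vec_space.rank m (eval_mat a P) \<le> normal_rank P"
proof -
  obtain S where S: "is_smith_form P S" using smith_form_exists[OF P] by blast
  show ?thesis unfolding rank_smith_form[OF P S] by (rule card_mono) auto
qed

lemma finite_eigenvalue_iff_rank:
  assumes P: "P \<in> carrier_mat m n"
  shows "finite_eigenvalue P a \<longleftrightarrow> vec_space.rank m (eval_mat a P) < normal_rank P"
proof -
  have *: "vec_space.rank m (eval_mat a P) < normal_rank P \<longleftrightarrow>
     (\<exists>i < min m n. S $$ (i,i) \<noteq> 0 \<and> poly (S $$ (i,i)) a = 0)" if S: "is_smith_form P S" for S
  proof -
    let ?A = "{i. i < min m n \<and> S $$ (i,i) \<noteq> 0}" and ?B = "{i. i < min m n \<and> poly (S $$ (i,i)) a \<noteq> 0}"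
    have sub: "?B \<subseteq> ?A" "finite ?A" by auto
    have "card ?B < card ?A \<longleftrightarrow> ?B \<noteq> ?A"
    proof (cases "?B = ?A")
      case True
      show ?thesis unfolding True by simp
    next
      case False
      with sub psubset_card_mono[OF sub(2), of ?B] show ?thesis by blast
    qed
    then show ?thesis unfolding rank_smith_form[OF P S] by auto
  qed
  obtain S where S: "is_smith_form P S" using smith_form_exists[OF P] by blast
  show ?thesis
  proof
    assume "finite_eigenvalue P a"
    then show "vec_space.rank m (eval_mat a P) < normal_rank P"
      using * P unfolding finite_eigenvalue_def invariant_polys_def by auto
  next
    assume "vec_space.rank m (eval_mat a P) < normal_rank P"
    then show "finite_eigenvalue P a"
      using *[OF S] S P unfolding finite_eigenvalue_def invariant_polys_def by auto
  qed
qed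

lemma generic_rank_attained:
  assumes P: "P \<in> carrier_mat m n"
  obtains a where "a \<noteq> 0" "vec_space.rank m (eval_mat a P) = normal_rank P"
proof -
  obtain S where S: "is_smith_form P S" using smith_form_exists[OF P] by blast
  let ?A = "{i. i < min m n \<and> S $$ (i,i) \<noteq> 0}"
  define p where "p = [:0,1:] * (\<Prod>i\<in>?A. S $$ (i,i))"
  have "p \<noteq> 0" unfolding p_def by simp
  then have "finite {a. poly p a = 0}" by (rule poly_roots_finite)
  then obtain a where "poly p a \<noteq> 0" using infinite_UNIV_char_0 by (metis (mono_tags) ex_new_if_finite mem_Collect_eq)
  then have a: "a \<noteq> 0" "\<And>i. i \<in> ?A \<Longrightarrow> poly (S $$ (i,i)) a \<noteq> 0"
    unfolding p_def by (auto simp: poly_prod)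
  have "{i. i < min m n \<and> poly (S $$ (i,i)) a \<noteq> 0} = ?A" using a by auto
  then have "vec_space.rank m (eval_mat a P) = normal_rank P" unfolding rank_smith_form[OF P S] by simp
  then show ?thesis using that[OF a(1)] by blast
qed

section \<open>Minimal bases\<close>

lemma vec_degree_le_iff: "vec_degree v \<le> k \<longleftrightarrow> (\<forall>i<dim_vec v. degree (v $ i) \<le> k)"
proof -
  let ?K = "{k. coeff_vec v k \<noteq> 0\<^sub>v (dim_vec v)}"
  have K: "l \<in> ?K \<longleftrightarrow> (\<exists>i<dim_vec v. coeff (v $ i) l \<noteq> 0)" for l
    by (auto simp: coeff_vec_def vec_eq_iff)
  have "?K \<subseteq> (\<Union>i<dim_vec v. {..degree (v $ i)})" using K by (auto simp: le_degree)
  then have "finite ?K" by (rule finite_subset) auto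
  then have "vec_degree v \<le> k \<longleftrightarrow> (\<forall>l\<in>?K. l \<le> k)" unfolding vec_degree_def by auto
  also have "\<dots> \<longleftrightarrow> (\<forall>i<dim_vec v. degree (v $ i) \<le> k)"
  proof safe
    fix i assume *: "\<forall>l\<in>?K. l \<le> k" "i < dim_vec v"
    show "degree (v $ i) \<le> k"
    proof (cases "v $ i = 0")
      case False
      then have "degree (v $ i) \<in> ?K" using * K by (auto intro!: exI[of _ i])
      then show ?thesis using * by blast
    qed simp
  next
    fix l assume *: "\<forall>i<dim_vec v. degree (v $ i) \<le> k" and l: "coeff_vec v l \<noteq> 0\<^sub>v (dim_vec v)"
    then obtain i where "i < dim_vec v" "coeff (v $ i) l \<noteq> 0" using K[of l] by auto
    then show "l \<le> k" using * le_degree le_trans by blast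
  qed
  finally show ?thesis .
qed

lemma mat_degree_le_iff:
  "mat_degree P \<le> k \<longleftrightarrow> (\<forall>i<dim_row P. \<forall>j<dim_col P. degree (P $$ (i,j)) \<le> k)"
proof -
  let ?K = "{k. coeff_mat P k \<noteq> 0\<^sub>m (dim_row P) (dim_col P)}"
  have K: "l \<in> ?K \<longleftrightarrow> (\<exists>i<dim_row P. \<exists>j<dim_col P. coeff (P $$ (i,j)) l \<noteq> 0)" for l
    by (auto simp: coeff_mat_def mat_eq_iff)
  have "?K \<subseteq> (\<Union>i<dim_row P. \<Union>j<dim_col P. {..degree (P $$ (i,j))})"
  proof
    fix l assume "l \<in> ?K"
    then obtain i j where "i < dim_row P" "j < dim_col P" "coeff (P $$ (i,j)) l \<noteq> 0" using K[of l] by auto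
    then show "l \<in> (\<Union>i<dim_row P. \<Union>j<dim_col P. {..degree (P $$ (i,j))})" using le_degree by blast
  qed
  then have "finite ?K" by (rule finite_subset) auto
  then have "mat_degree P \<le> k \<longleftrightarrow> (\<forall>l\<in>?K. l \<le> k)" unfolding mat_degree_def by auto
  also have "\<dots> \<longleftrightarrow> (\<forall>i<dim_row P. \<forall>j<dim_col P. degree (P $$ (i,j)) \<le> k)"
  proof safe
    fix i j assume *: "\<forall>l\<in>?K. l \<le> k" "i < dim_row P" "j < dim_col P"
    show "degree (P $$ (i,j)) \<le> k"
    proof (cases "P $$ (i,j) = 0")
      case False
      then have "coeff (P $$ (i,j)) (degree (P $$ (i,j))) \<noteq> 0" by simp
      then have "degree (P $$ (i,j)) \<in> ?K" using *(2,3) unfolding K by blast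
      then show ?thesis using * by blast
    qed simp
  next
    fix l assume *: "\<forall>i<dim_row P. \<forall>j<dim_col P. degree (P $$ (i,j)) \<le> k"
      and l: "coeff_mat P l \<noteq> 0\<^sub>m (dim_row P) (dim_col P)"
    then obtain i j where "i < dim_row P" "j < dim_col P" "coeff (P $$ (i,j)) l \<noteq> 0" using K[of l] by auto
    then show "l \<le> k" using * le_degree le_trans by blast
  qed
  finally show ?thesis .
qed

lemma clear_denominators:
  fixes f :: "'b \<Rightarrow> 'a :: idom fract"
  assumes "finite K"
  obtains q g where "q \<noteq> 0" "\<And>k. k \<in> K \<Longrightarrow> to_fract q * f k = to_fract (g k)"
proof -
  have "\<exists>b a. b \<noteq> 0 \<and> to_fract b * x = to_fract a" for x :: "'a fract"
  proof (cases x)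
    case (Fract a b)
    then show ?thesis
      by (intro exI[of _ b] exI[of _ a]) (auto simp: to_fract_def eq_fract)
  qed
  then obtain b a where ba: "\<And>x :: 'a fract. b x \<noteq> 0 \<and> to_fract (b x) * x = to_fract (a x)" by metis
  define q where "q = (\<Prod>k\<in>K. b (f k))"
  define g where "g k = (\<Prod>l\<in>K - {k}. b (f l)) * a (f k)" for k
  have "to_fract q * f k = to_fract (g k)" if "k \<in> K" for k
    unfolding q_def g_def using prod.remove[OF assms that, of "\<lambda>k. b (f k)"] ba[of "f k"]
    by (simp add: mult.assoc mult.left_commute)
  moreover have "q \<noteq> 0" unfolding q_def using ba assms by simp
  ultimately show ?thesis using that by blast
qed

abbreviation fract_mat :: "'a::idom mat \<Rightarrow> 'a fract mat" where
  "fract_mat \<equiv> map_mat to_fract"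

lemma fract_mat_mult:
  "A \<in> carrier_mat m n \<Longrightarrow> B \<in> carrier_mat n k \<Longrightarrow> fract_mat (A * B) = fract_mat A * fract_mat B"
  by (rule hom_mult_mat[OF to_fract_comm_ring_hom])

lemma fract_mat_inj: "fract_mat A = fract_mat B \<Longrightarrow> A = B"
  by (auto simp: mat_eq_iff)

lemma fract_mat_smult: "fract_mat (q \<cdot>\<^sub>m A) = to_fract q \<cdot>\<^sub>m fract_mat A"
  by (rule eq_matI) auto

lemma clear_denominators_mat:
  fixes X :: "'a :: idom fract mat"
  assumes "X \<in> carrier_mat m n"
  obtains q Y where "q \<noteq> 0" "Y \<in> carrier_mat m n" "to_fract q \<cdot>\<^sub>m X = fract_mat Y"
proof -
  obtain q g where "q \<noteq> 0" "\<And>k. k \<in> {..<m} \<times> {..<n} \<Longrightarrow> to_fract q * (X $$ k) = to_fract (g k)"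
    using clear_denominators[of "{..<m} \<times> {..<n}" "\<lambda>k. X $$ k"] by auto
  then show ?thesis using assms by (intro that[of q "mat m n g"]) auto
qed

lemma inj_fract_mat_iff:
  fixes L :: "'a :: idom mat"
  assumes L: "L \<in> carrier_mat m n"
  shows "inj_mat (fract_mat L) \<longleftrightarrow> inj_mat L"
proof
  assume inj: "inj_mat (fract_mat L)"
  show "inj_mat L"
  proof (rule inj_matI[OF L])
    fix v assume v: "v \<in> carrier_vec n" "L *\<^sub>v v = 0\<^sub>v m"
    have "fract_mat L *\<^sub>v map_vec to_fract v = map_vec to_fract (0\<^sub>v m)"
      using hom_mult_mat_vec[OF to_fract_comm_ring_hom L v(1)] v by simp
    also have "\<dots> = 0\<^sub>v m" by auto
    finally have "map_vec to_fract v = 0\<^sub>v n" using inj_matD[OF inj, of m n] L v by simp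
    then show "v = 0\<^sub>v n" using v by (auto simp: vec_eq_iff)
  qed
next
  assume inj: "inj_mat L"
  show "inj_mat (fract_mat L)"
  proof (rule inj_matI)
    show "fract_mat L \<in> carrier_mat m n" using L by simp
    fix x assume x: "x \<in> carrier_vec n" "fract_mat L *\<^sub>v x = 0\<^sub>v m"
    obtain q g where q: "q \<noteq> 0" "\<And>i. i \<in> {..<n} \<Longrightarrow> to_fract q * x $ i = to_fract (g i)"
      using clear_denominators[of "{..<n}" "\<lambda>i. x $ i"] by auto
    define y where "y = vec n g"
    have y: "y \<in> carrier_vec n" "map_vec to_fract y = to_fract q \<cdot>\<^sub>v x"
      using q x by (auto simp: y_def)
    have "map_vec to_fract (L *\<^sub>v y) = fract_mat L *\<^sub>v (to_fract q \<cdot>\<^sub>v x)"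
      using hom_mult_mat_vec[OF to_fract_comm_ring_hom L y(1)] y by simp
    also have "\<dots> = to_fract q \<cdot>\<^sub>v (fract_mat L *\<^sub>v x)" using L x by (intro mult_mat_vec) auto
    finally have "map_vec to_fract (L *\<^sub>v y) = 0\<^sub>v m" using x by auto
    then have "L *\<^sub>v y = 0\<^sub>v m" using L by (auto simp: vec_eq_iff)
    then have "y = 0\<^sub>v n" using inj_matD[OF inj L y(1)] by simp
    then have "to_fract q \<cdot>\<^sub>v x = map_vec to_fract (0\<^sub>v n)" using y(2) by simp
    then show "x = 0\<^sub>v n" using q(1) x(1) by (auto simp: vec_eq_iff)
  qed
qed

text \<open>
  The columns of \<open>A\<close> lie in the span of the columns of \<open>L\<close> over the field of fractions; \<open>q\<close> is a common
  denominator of the coefficients.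
\<close>

definition frac_factor :: "'a::idom mat \<Rightarrow> 'a mat \<Rightarrow> bool" where
  "frac_factor A L \<longleftrightarrow>
     (\<exists>q X. q \<noteq> 0 \<and> X \<in> carrier_mat (dim_col L) (dim_col A) \<and> q \<cdot>\<^sub>m A = L * X)"

lemma frac_factorI:
  "q \<noteq> 0 \<Longrightarrow> X \<in> carrier_mat n k \<Longrightarrow> L \<in> carrier_mat m n \<Longrightarrow> A \<in> carrier_mat m k \<Longrightarrow>
   q \<cdot>\<^sub>m A = L * X \<Longrightarrow> frac_factor A L"
  unfolding frac_factor_def by auto

lemma frac_factor_iff:
  assumes A: "A \<in> carrier_mat m k" and L: "L \<in> carrier_mat m n"
  shows "frac_factor A L \<longleftrightarrow> (\<exists>X \<in> carrier_mat n k. fract_mat A = fract_mat L * X)"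
proof
  assume "frac_factor A L"
  then obtain q Y where q: "q \<noteq> 0" "Y \<in> carrier_mat n k" "q \<cdot>\<^sub>m A = L * Y"
    using A L unfolding frac_factor_def by auto
  have "to_fract q \<cdot>\<^sub>m fract_mat A = fract_mat L * fract_mat Y"
    using q(3) fract_mat_mult[OF L q(2)] fract_mat_smult by metis
  then have "inverse (to_fract q) \<cdot>\<^sub>m (to_fract q \<cdot>\<^sub>m fract_mat A) = fract_mat L * (inverse (to_fract q) \<cdot>\<^sub>m fract_mat Y)"
    using L q by (simp add: mult_smult_distrib[of _ m n _ k])
  moreover have "inverse (to_fract q) \<cdot>\<^sub>m (to_fract q \<cdot>\<^sub>m fract_mat A) = fract_mat A"
    using q by (intro eq_matI) auto
  ultimately show "\<exists>X \<in> carrier_mat n k. fract_mat A = fract_mat L * X" using q(2) by auto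
next
  assume "\<exists>X \<in> carrier_mat n k. fract_mat A = fract_mat L * X"
  then obtain X where X: "X \<in> carrier_mat n k" "fract_mat A = fract_mat L * X" by blast
  obtain q Y where q: "q \<noteq> 0" "Y \<in> carrier_mat n k" "to_fract q \<cdot>\<^sub>m X = fract_mat Y"
    using clear_denominators_mat[OF X(1)] by metis
  have "fract_mat (q \<cdot>\<^sub>m A) = fract_mat L * (to_fract q \<cdot>\<^sub>m X)"
    unfolding fract_mat_smult X(2) using L X(1) by (simp add: mult_smult_distrib[of _ m n _ k])
  also have "\<dots> = fract_mat (L * Y)" using q fract_mat_mult[OF L q(2)] by simp
  finally show "frac_factor A L" using q fract_mat_inj L A by (intro frac_factorI) auto
qed

lemma frac_factor_trans:
  assumes "frac_factor A L" "frac_factor L M"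
    and A: "A \<in> carrier_mat m k" and L: "L \<in> carrier_mat m n" and M: "M \<in> carrier_mat m l"
  shows "frac_factor A M"
proof -
  obtain X where X: "X \<in> carrier_mat n k" "fract_mat A = fract_mat L * X"
    using assms(1) frac_factor_iff[OF A L] by blast
  obtain Y where Y: "Y \<in> carrier_mat l n" "fract_mat L = fract_mat M * Y"
    using assms(2) frac_factor_iff[OF L M] by blast
  have "fract_mat A = fract_mat M * (Y * X)" using X Y M by (simp add: mat_mult_assoc)
  then show ?thesis using frac_factor_iff[OF A M] X Y by (intro iffD2[OF frac_factor_iff[OF A M]] bexI) auto
qed

definition col_degree_sum :: "'a::zero poly mat \<Rightarrow> nat" where
  "col_degree_sum L = (\<Sum>j<dim_col L. vec_degree (col L j))"

definition min_degree_cols :: "complex poly mat \<Rightarrow> bool" where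
  "min_degree_cols L \<longleftrightarrow> inj_mat L \<and>
     (\<forall>L' \<in> carrier_mat (dim_row L) (dim_col L). frac_factor L L' \<longrightarrow> col_degree_sum L \<le> col_degree_sum L')"

lemma inj_mat_distinct_cols:
  fixes L :: "'a :: comm_ring_1 mat"
  assumes "inj_mat L"
  shows "distinct (cols L)"
proof (rule ccontr)
  assume "\<not> ?thesis"
  then obtain i j where ij: "i < dim_col L" "j < dim_col L" "i \<noteq> j" "col L i = col L j"
    unfolding distinct_conv_nth by auto
  define n where "n = dim_col L"
  have L: "L \<in> carrier_mat (dim_row L) n" by (auto simp: n_def)
  have "L *\<^sub>v (unit_vec n i - unit_vec n j) = L *\<^sub>v unit_vec n i - L *\<^sub>v unit_vec n j"
    by (rule mult_minus_distrib_mat_vec[OF L]) auto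
  also have "\<dots> = col L i - col L j" using ij mult_mat_unit_vec[OF L] by (simp add: n_def)
  also have "\<dots> = 0\<^sub>v (dim_row L)" unfolding ij(4) by auto
  finally have "L *\<^sub>v (unit_vec n i - unit_vec n j) = 0\<^sub>v (dim_row L)" .
  then have "unit_vec n i - unit_vec n j = (0\<^sub>v n :: 'a vec)" using inj_matD[OF assms L] by auto
  from arg_cong[OF this, of "\<lambda>v. v $ i"] show False using ij by (simp add: n_def)
qed

lemma cols_fract_mat: "set (cols (fract_mat L)) = map_vec to_fract ` set (cols L)"
  by (auto simp: cols_def)

lemma sum_vec_degree_cols:
  "distinct (cols L) \<Longrightarrow> (\<Sum>v\<in>set (cols L). vec_degree v) = col_degree_sum L"
  by (subst sum_list_distinct_conv_sum_set[symmetric])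
     (auto simp: col_degree_sum_def cols_def sum_list_sum_nth atLeast0LessThan comp_def)

lemma ratfun_span_cols:
  assumes "L \<in> carrier_mat m n"
  shows "ratfun_span m (set (cols L)) = {y \<in> carrier_vec m. \<exists>x \<in> carrier_vec n. fract_mat L *\<^sub>v x = y}"
  using vec_space.col_space_eq[of "fract_mat L" m n] assms
  unfolding vec_space.col_space_def cols_fract_mat by auto

lemma is_poly_basis_colsI:
  assumes L: "L \<in> carrier_mat m n" and "inj_mat L"
  shows "is_poly_basis m (ratfun_span m (set (cols L))) (set (cols L))"
proof -
  have inj: "inj_mat (fract_mat L)" using inj_fract_mat_iff[OF L] assms by simp
  have FL: "fract_mat L \<in> carrier_mat m n" using L by simp
  have "\<not> LinearCombinations.module.lin_dep class_ring (ratfun_space m) (set (cols (fract_mat L)))"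
    using vec_space.lin_depE[OF FL _ inj_mat_distinct_cols[OF inj]] inj_matD[OF inj FL] by metis
  then show ?thesis unfolding is_poly_basis_def cols_fract_mat using cols_dim[of L] L by auto
qed

lemma ratfun_span_cols_subset_imp:
  assumes L: "L \<in> carrier_mat m n" and M: "M \<in> carrier_mat m k"
    and sub: "ratfun_span m (set (cols L)) \<subseteq> ratfun_span m (set (cols M))"
  shows "frac_factor L M"
proof -
  have "\<exists>x \<in> carrier_vec k. fract_mat M *\<^sub>v x = col (fract_mat L) j" if "j < n" for j
  proof -
    have "col (fract_mat L) j \<in> ratfun_span m (set (cols L))"
      unfolding ratfun_span_cols[OF L] using L that mult_mat_unit_vec[of "fract_mat L" m n j]
      by (auto intro!: bexI[of _ "unit_vec n j"])
    then show ?thesis using sub unfolding ratfun_span_cols[OF M] by blast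
  qed
  then obtain X where "X \<in> carrier_mat k n" "fract_mat L = fract_mat M * X"
    using factor_through_colsI[of "fract_mat L" m n "fract_mat M" k] L M by auto
  then show ?thesis unfolding frac_factor_iff[OF L M] by blast
qed

lemma frac_factor_imp_ratfun_span_subset:
  assumes L: "L \<in> carrier_mat m n" and M: "M \<in> carrier_mat m k" and "frac_factor L M"
  shows "ratfun_span m (set (cols L)) \<subseteq> ratfun_span m (set (cols M))"
proof
  obtain X where X: "X \<in> carrier_mat k n" "fract_mat L = fract_mat M * X"
    using assms(3) unfolding frac_factor_iff[OF L M] by blast
  fix y assume "y \<in> ratfun_span m (set (cols L))"
  then obtain x where x: "y \<in> carrier_vec m" "x \<in> carrier_vec n" "fract_mat L *\<^sub>v x = y"
    unfolding ratfun_span_cols[OF L] by blast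
  have "(fract_mat M * X) *\<^sub>v x = fract_mat M *\<^sub>v (X *\<^sub>v x)"
    using M X x by (intro assoc_mult_mat_vec) auto
  then have "fract_mat M *\<^sub>v (X *\<^sub>v x) = y" using x X by simp
  then show "y \<in> ratfun_span m (set (cols M))" unfolding ratfun_span_cols[OF M] using x X by auto
qed

lemma frac_factor_inj_square:
  assumes L: "L \<in> carrier_mat m n" and M: "M \<in> carrier_mat m n"
    and "inj_mat L" and "frac_factor L M"
  shows "inj_mat M" "frac_factor M L"
proof -
  obtain X where X: "X \<in> carrier_mat n n" "fract_mat L = fract_mat M * X"
    using assms(4) unfolding frac_factor_iff[OF L M] by blast
  have injF: "inj_mat (fract_mat L)" using inj_fract_mat_iff[OF L] assms by simp
  then have "inj_mat X" using inj_mat_right_factor[of "fract_mat M" X m n n] X M by auto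
  then obtain N where N: "N \<in> carrier_mat n n" "N * X = 1\<^sub>m n" using inj_mat_left_inverse[OF _ X(1)] by blast
  then have XN: "X * N = 1\<^sub>m n" using mat_mult_left_right_inverse[OF N(1) X(1)] by simp
  have M_eq: "fract_mat M = fract_mat L * N" unfolding X(2) using X(1) N(1) M XN
    by (simp add: mat_mult_assoc)
  then show "frac_factor M L" unfolding frac_factor_iff[OF M L] using N by blast
  have "inj_mat N" using left_inverse_imp_inj_mat[OF N(1) X(1) XN] .
  have "inj_mat (fract_mat L * N)"
  proof (rule inj_matI)
    show "fract_mat L * N \<in> carrier_mat m n" using L N by auto
    fix v assume v: "v \<in> carrier_vec n" "fract_mat L * N *\<^sub>v v = 0\<^sub>v m"
    then have "fract_mat L *\<^sub>v (N *\<^sub>v v) = 0\<^sub>v m" using L N by (simp add: assoc_mult_mat_vec[of _ m n _ n])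
    then have "N *\<^sub>v v = 0\<^sub>v n" using inj_matD[OF injF, of m n "N *\<^sub>v v"] L N v by auto
    then show "v = 0\<^sub>v n" using inj_matD[OF \<open>inj_mat N\<close> N(1) v(1)] by simp
  qed
  then show "inj_mat M" unfolding M_eq[symmetric] using inj_fract_mat_iff[OF M] by simp
qed

lemma is_poly_basis_imp_cols:
  assumes "is_poly_basis m W B"
  obtains n M where "M \<in> carrier_mat m n" "B = set (cols M)" "distinct (cols M)" "inj_mat M"
    "W = ratfun_span m (set (cols M))"
proof -
  interpret vs: vec_space "TYPE(complex poly fract)" m .
  have B: "B \<subseteq> carrier_vec m" "vs.lin_indpt (map_vec to_fract ` B)"
    and W: "ratfun_span m B = W" using assms unfolding is_poly_basis_def by auto
  have "map_vec to_fract ` B \<subseteq> carrier_vec m" using B by auto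
  then have "finite (map_vec to_fract ` B)"
    using vs.fin_dim_li_fin[OF vs.fin_dim B(2)] by auto
  moreover have inj: "inj_on (map_vec to_fract) B"
    by (auto simp: inj_on_def vec_eq_iff)
  ultimately have "finite B" using finite_imageD by blast
  then obtain xs where xs: "set xs = B" "distinct xs" using finite_distinct_list by blast
  define M where "M = mat_of_cols m xs"
  have M: "M \<in> carrier_mat m (length xs)" by (simp add: M_def)
  have c: "cols M = xs" unfolding M_def using xs B by auto
  have FM: "fract_mat M \<in> carrier_mat m (length xs)" using M by simp
  have "cols (fract_mat M) = map (map_vec to_fract) xs"
    unfolding c[symmetric] using M by (auto simp: cols_def)
  then have d: "distinct (cols (fract_mat M))" using xs inj by (simp add: distinct_map)
  have "inj_mat (fract_mat M)"
    using vs.lin_depI[OF FM _ _ _ d] B(2) xs c unfolding cols_fract_mat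
    by (intro inj_matI[OF FM]) auto
  then have "inj_mat M" using inj_fract_mat_iff[OF M] by simp
  then show ?thesis using that[OF M] c xs W by auto
qed

lemma minimal_basis_mat_iff:
  assumes L: "L \<in> carrier_mat m n"
  shows "minimal_basis_mat L \<longleftrightarrow> min_degree_cols L"
proof
  assume mb: "minimal_basis_mat L"
  let ?W = "ratfun_span m (set (cols L))"
  have d: "distinct (cols L)" and bas: "is_poly_basis m ?W (set (cols L))"
    and min: "\<And>B. is_poly_basis m ?W B \<Longrightarrow> (\<Sum>v\<in>set (cols L). vec_degree v) \<le> (\<Sum>v\<in>B. vec_degree v)"
    using mb L unfolding minimal_basis_mat_def is_minimal_basis_def by auto
  have FL: "fract_mat L \<in> carrier_mat m n" using L by simp
  have "cols (fract_mat L) = map (map_vec to_fract) (cols L)" by (auto simp: cols_def)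
  moreover have "inj_on (map_vec to_fract) (set (cols L))" by (auto simp: inj_on_def vec_eq_iff)
  ultimately have d': "distinct (cols (fract_mat L))" using d by (simp add: distinct_map)
  have "inj_mat (fract_mat L)"
    using vec_space.lin_depI[OF FL _ _ _ d'] bas unfolding cols_fract_mat is_poly_basis_def
    by (intro inj_matI[OF FL]) auto
  then have inj: "inj_mat L" using inj_fract_mat_iff[OF L] by simp
  have "col_degree_sum L \<le> col_degree_sum M" if M: "M \<in> carrier_mat m n" and LM: "frac_factor L M" for M
  proof -
    have M': "inj_mat M" "frac_factor M L" using frac_factor_inj_square[OF L M inj LM] by auto
    have "ratfun_span m (set (cols M)) = ?W"
      using frac_factor_imp_ratfun_span_subset[OF L M LM] frac_factor_imp_ratfun_span_subset[OF M L M'(2)] by blast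
    then have "is_poly_basis m ?W (set (cols M))" using is_poly_basis_colsI[OF M M'(1)] by simp
    from min[OF this] show ?thesis
      unfolding sum_vec_degree_cols[OF d] sum_vec_degree_cols[OF inj_mat_distinct_cols[OF M'(1)]] .
  qed
  then show "min_degree_cols L" unfolding min_degree_cols_def using inj L by auto
next
  assume mc: "min_degree_cols L"
  then have inj: "inj_mat L" unfolding min_degree_cols_def by simp
  note d = inj_mat_distinct_cols[OF inj]
  have "(\<Sum>v\<in>set (cols L). vec_degree v) \<le> (\<Sum>v\<in>B. vec_degree v)"
    if B: "is_poly_basis m (ratfun_span m (set (cols L))) B" for B
  proof -
    obtain k M where M: "M \<in> carrier_mat m k" "B = set (cols M)" "distinct (cols M)" "inj_mat M"
      and W: "ratfun_span m (set (cols L)) = ratfun_span m (set (cols M))"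
      using is_poly_basis_imp_cols[OF B] by metis
    have ff: "frac_factor L M" "frac_factor M L"
      using ratfun_span_cols_subset_imp[OF L M(1)] ratfun_span_cols_subset_imp[OF M(1) L] W by auto
    have le: "k' \<le> n'" if PQ: "frac_factor P Q" "P \<in> carrier_mat m k'" "Q \<in> carrier_mat m n'" "inj_mat P"
      for P Q :: "complex poly mat" and k' n'
    proof -
      obtain X where X: "X \<in> carrier_mat n' k'" "fract_mat P = fract_mat Q * X"
        using PQ(1) unfolding frac_factor_iff[OF PQ(2,3)] by blast
      have "inj_mat (fract_mat P)" using inj_fract_mat_iff[OF PQ(2)] PQ(4) by simp
      then have "inj_mat X" using inj_mat_right_factor[of "fract_mat Q" X m n' k'] X PQ(3) by auto
      then show ?thesis using wide_not_inj_mat[OF X(1)] by fastforce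
    qed
    have "k = n" using le[OF ff(1) L M(1) inj] le[OF ff(2) M(1) L M(4)] by simp
    then have "col_degree_sum L \<le> col_degree_sum M"
      using mc M(1) ff(1) L unfolding min_degree_cols_def by auto
    then show ?thesis unfolding M(2) sum_vec_degree_cols[OF d] sum_vec_degree_cols[OF M(3)] .
  qed
  then show "minimal_basis_mat L"
    unfolding minimal_basis_mat_def is_minimal_basis_def using d is_poly_basis_colsI[OF L inj] L by auto
qed

lemma min_degree_cols_exchange:
  assumes L: "L \<in> carrier_mat m n" and mc: "min_degree_cols L"
    and w: "w \<in> carrier_vec m" and c: "c \<in> carrier_vec n" and q: "q \<noteq> 0"
    and eq: "q \<cdot>\<^sub>v w = L *\<^sub>v c" and j: "j < n" "c $ j \<noteq> 0"
  shows "w \<noteq> 0\<^sub>v m" "vec_degree (col L j) \<le> vec_degree w"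
proof -
  have inj: "inj_mat L" using mc unfolding min_degree_cols_def by simp
  show "w \<noteq> 0\<^sub>v m"
  proof
    assume "w = 0\<^sub>v m"
    moreover have "q \<cdot>\<^sub>v 0\<^sub>v m = 0\<^sub>v m" by auto
    ultimately have "L *\<^sub>v c = 0\<^sub>v m" using eq by simp
    then have "c = 0\<^sub>v n" using inj_matD[OF inj L c] by simp
    then show False using j by simp
  qed
  define M where "M = mat m n (\<lambda>(a,i). if i = j then w $ a else L $$ (a,i))"
  define X where "X = mat n n (\<lambda>(a,i). if i = j then (if a = j then q else - c $ a)
    else if a = i then c $ j else 0)"
  have M: "M \<in> carrier_mat m n" and X: "X \<in> carrier_mat n n" by (auto simp: M_def X_def)
  have "c $ j \<cdot>\<^sub>m L = M * X"
  proof (rule eq_matI)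
    fix a i assume "a < dim_row (M * X)" "i < dim_col (M * X)"
    then have ai: "a < m" "i < n" using M X by auto
    have MX: "(M * X) $$ (a,i) = (\<Sum>b<n. M $$ (a,b) * X $$ (b,i))"
      using ai M X by (simp add: scalar_prod_def atLeast0LessThan)
    show "(c $ j \<cdot>\<^sub>m L) $$ (a,i) = (M * X) $$ (a,i)"
    proof (cases "i = j")
      case False
      have "(M * X) $$ (a,i) = (\<Sum>b<n. if b = i then L $$ (a,i) * c $ j else 0)"
        unfolding MX using ai False by (intro sum.cong) (auto simp: M_def X_def)
      then show ?thesis using ai L by (simp add: mult.commute)
    next
      case True
      have "q * w $ a = (\<Sum>b<n. L $$ (a,b) * c $ b)"
        using arg_cong[OF eq, of "\<lambda>v. v $ a"] ai L w c by (simp add: scalar_prod_def atLeast0LessThan)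
      also have "\<dots> = L $$ (a,j) * c $ j + (\<Sum>b\<in>{..<n}-{j}. L $$ (a,b) * c $ b)"
        using j by (intro sum.remove) auto
      finally have qw: "q * w $ a = \<dots>" .
      have "(M * X) $$ (a,i) = M $$ (a,j) * X $$ (j,i) + (\<Sum>b\<in>{..<n}-{j}. M $$ (a,b) * X $$ (b,i))"
        unfolding MX using j by (intro sum.remove) auto
      also have "(\<Sum>b\<in>{..<n}-{j}. M $$ (a,b) * X $$ (b,i)) = (\<Sum>b\<in>{..<n}-{j}. - (L $$ (a,b) * c $ b))"
        using ai True by (intro sum.cong) (auto simp: M_def X_def)
      also have "M $$ (a,j) * X $$ (j,i) = q * w $ a" using ai True j by (simp add: M_def X_def)
      finally show ?thesis using qw ai L True by (simp add: sum_negf)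
    qed
  qed (use L M X in auto)
  then have "frac_factor L M" using j X M L by (intro frac_factorI) auto
  then have "col_degree_sum L \<le> col_degree_sum M"
    using mc L M unfolding min_degree_cols_def by auto
  moreover have "col_degree_sum L = vec_degree (col L j) + (\<Sum>i\<in>{..<n}-{j}. vec_degree (col L i))"
    unfolding col_degree_sum_def using j L by (subst sum.remove[of _ j]) auto
  moreover have "col_degree_sum M = vec_degree (col M j) + (\<Sum>i\<in>{..<n}-{j}. vec_degree (col M i))"
    unfolding col_degree_sum_def using j M by (subst sum.remove[of _ j]) auto
  moreover have "col M j = w" using j w by (auto simp: M_def)
  moreover have "col M i = col L i" if "i < n" "i \<noteq> j" for i using that L by (auto simp: M_def)
  ultimately show "vec_degree (col L j) \<le> vec_degree w" by simp
qed

lemma nonzero_index_max: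
  fixes f :: "nat \<Rightarrow> nat"
  assumes "v \<in> carrier_vec n" "v \<noteq> 0\<^sub>v n"
  obtains j where "j < n" "v $ j \<noteq> 0" "\<And>i. i < n \<Longrightarrow> v $ i \<noteq> 0 \<Longrightarrow> f i \<le> f j"
proof -
  let ?A = "{i. i < n \<and> v $ i \<noteq> 0}"
  have "?A \<noteq> {}" using assms by (auto simp: vec_eq_iff)
  then obtain j where j: "j \<in> ?A" "Max (f ` ?A) = f j" using obtains_MAX[of ?A] by auto
  have "f i \<le> f j" if "i < n" "v $ i \<noteq> 0" for i
    unfolding j(2)[symmetric] using that by (intro Max_ge) auto
  then show ?thesis using that j(1) by blast
qed

lemma min_degree_cols_eval_inj:
  assumes L: "L \<in> carrier_mat m n" and mc: "min_degree_cols L"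
  shows "inj_mat (eval_mat a L)"
proof (rule inj_matI)
  show "eval_mat a L \<in> carrier_mat m n" using L by simp
  fix v :: "complex vec" assume v: "v \<in> carrier_vec n" "eval_mat a L *\<^sub>v v = 0\<^sub>v m"
  show "v = 0\<^sub>v n"
  proof (rule ccontr)
    assume "v \<noteq> 0\<^sub>v n"
    then obtain j where j: "j < n" "v $ j \<noteq> 0"
      and jmax: "\<And>i. i < n \<Longrightarrow> v $ i \<noteq> 0 \<Longrightarrow> vec_degree (col L i) \<le> vec_degree (col L j)"
      using nonzero_index_max[OF v(1), of "\<lambda>i. vec_degree (col L i)"] by metis
    define c where "c = map_vec (\<lambda>x. [:x:]) v"
    have c: "c \<in> carrier_vec n" using v by (simp add: c_def)
    define u where "u = L *\<^sub>v c"
    have u: "u \<in> carrier_vec m" unfolding u_def using L c by (rule mult_mat_vec_carrier)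
    have ui: "u $ i = (\<Sum>l<n. Polynomial.smult (v $ l) (L $$ (i,l)))" if "i < m" for i
      using that L v(1) by (auto simp: u_def c_def scalar_prod_def atLeast0LessThan intro!: sum.cong)
    have "poly (u $ i) a = 0" if i: "i < m" for i
    proof -
      have "poly (u $ i) a = (eval_mat a L *\<^sub>v v) $ i"
        using i L v(1) by (simp add: ui poly_sum scalar_prod_def atLeast0LessThan mult.commute)
      then show ?thesis using v i by simp
    qed
    then have "[:-a, 1:] dvd u $ i" if "i < m" for i using that poly_eq_0_iff_dvd by blast
    then obtain g where g: "\<And>i. i < m \<Longrightarrow> u $ i = [:-a, 1:] * g i" unfolding dvd_def by metis
    define w where "w = vec m g"
    have w: "w \<in> carrier_vec m" by (simp add: w_def)
    have eq: "[:-a, 1:] \<cdot>\<^sub>v w = L *\<^sub>v c" using g u by (auto simp: w_def u_def[symmetric])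
    have cj: "c $ j \<noteq> 0" using j v by (simp add: c_def)
    have w0: "w \<noteq> 0\<^sub>v m" and le: "vec_degree (col L j) \<le> vec_degree w"
      using min_degree_cols_exchange[OF L mc w c _ eq j(1) cj] by auto
    have du: "degree (u $ i) \<le> vec_degree (col L j)" if i: "i < m" for i
      unfolding ui[OF i]
    proof (rule degree_sum_le)
      fix l assume l: "l \<in> {..<n}"
      have "degree (L $$ (i,l)) \<le> vec_degree (col L l)"
        using vec_degree_le_iff[of "col L l" "vec_degree (col L l)"] i l L by auto
      then show "degree (Polynomial.smult (v $ l) (L $$ (i,l))) \<le> vec_degree (col L j)"
        using jmax[of l] l by (cases "v $ l = 0") auto
    qed simp
    have dw: "degree (g i) + 1 \<le> vec_degree (col L j)" if i: "i < m" "g i \<noteq> 0" for i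
    proof -
      have "degree (u $ i) = degree [:-a, 1:] + degree (g i)"
        unfolding g[OF i(1)] using i(2) by (intro degree_mult_eq) auto
      then show ?thesis using du[OF i(1)] by simp
    qed
    obtain i where i: "i < m" "g i \<noteq> 0" using w0 by (auto simp: w_def vec_eq_iff)
    have pos: "vec_degree (col L j) \<ge> 1" using dw[OF i] by simp
    have "degree (g i) \<le> vec_degree (col L j) - 1" if "i < m" for i
      using dw[OF that] pos by (cases "g i = 0") auto
    then have "vec_degree w \<le> vec_degree (col L j) - 1" unfolding vec_degree_le_iff by (simp add: w_def)
    then show False using le pos by simp
  qed
qed

definition lead_coeff_cols :: "'a::zero poly mat \<Rightarrow> 'a mat" where
  "lead_coeff_cols L = mat (dim_row L) (dim_col L) (\<lambda>(i,j). coeff (L $$ (i,j)) (vec_degree (col L j)))"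

lemma min_degree_cols_lead_inj:
  assumes L: "L \<in> carrier_mat m n" and mc: "min_degree_cols L"
  shows "inj_mat (lead_coeff_cols L)"
proof (rule inj_matI)
  show "lead_coeff_cols L \<in> carrier_mat m n" using L by (simp add: lead_coeff_cols_def)
  let ?d = "\<lambda>j. vec_degree (col L j)"
  fix v :: "complex vec" assume v: "v \<in> carrier_vec n" "lead_coeff_cols L *\<^sub>v v = 0\<^sub>v m"
  show "v = 0\<^sub>v n"
  proof (rule ccontr)
    assume "v \<noteq> 0\<^sub>v n"
    then obtain j where j: "j < n" "v $ j \<noteq> 0"
      and jmax: "\<And>i. i < n \<Longrightarrow> v $ i \<noteq> 0 \<Longrightarrow> ?d i \<le> ?d j"
      using nonzero_index_max[OF v(1), of ?d] by metis
    define c where "c = vec n (\<lambda>i. monom (v $ i) (?d j - ?d i))"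
    have c: "c \<in> carrier_vec n" by (simp add: c_def)
    define w where "w = L *\<^sub>v c"
    have w: "w \<in> carrier_vec m" unfolding w_def using L c by (rule mult_mat_vec_carrier)
    have wi: "w $ i = (\<Sum>l<n. L $$ (i,l) * monom (v $ l) (?d j - ?d l))" if "i < m" for i
      using that L by (auto simp: w_def c_def scalar_prod_def atLeast0LessThan intro!: sum.cong)
    have dL: "degree (L $$ (i,l)) \<le> ?d l" if "i < m" "l < n" for i l
      using vec_degree_le_iff[of "col L l" "?d l"] that L by auto
    have "1 \<cdot>\<^sub>v w = L *\<^sub>v c" by (simp add: w_def)
    moreover have "c $ j \<noteq> 0" using j by (simp add: c_def)
    ultimately have w0: "w \<noteq> 0\<^sub>v m" and le: "?d j \<le> vec_degree w"
      using min_degree_cols_exchange[OF L mc w c _ _ j(1), of 1] by auto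
    have deg: "degree (w $ i) \<le> ?d j" if i: "i < m" for i
      unfolding wi[OF i]
    proof (rule degree_sum_le)
      fix l assume l: "l \<in> {..<n}"
      show "degree (L $$ (i,l) * monom (v $ l) (?d j - ?d l)) \<le> ?d j"
      proof (cases "v $ l = 0")
        case False
        then have "degree (L $$ (i,l) * monom (v $ l) (?d j - ?d l)) \<le> ?d l + (?d j - ?d l)"
          using dL[OF i] l by (intro order.trans[OF degree_mult_le] add_mono) (auto simp: degree_monom_eq)
        then show ?thesis using jmax[of l] l False by simp
      qed simp
    qed simp
    have top: "coeff (w $ i) (?d j) = 0" if i: "i < m" for i
    proof -
      have "coeff (w $ i) (?d j) = (\<Sum>l<n. coeff (L $$ (i,l)) (?d l) * v $ l)"
        unfolding wi[OF i] coeff_sum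
      proof (rule sum.cong)
        fix l assume l: "l \<in> {..<n}"
        show "coeff (L $$ (i,l) * monom (v $ l) (?d j - ?d l)) (?d j) = coeff (L $$ (i,l)) (?d l) * v $ l"
        proof (cases "v $ l = 0")
          case False
          then have "?d l \<le> ?d j" using jmax l by auto
          then show ?thesis by (simp add: mult.commute[of _ "monom _ _"] coeff_monom_mult)
        qed simp
      qed simp
      also have "\<dots> = (lead_coeff_cols L *\<^sub>v v) $ i"
        using i L v(1) by (simp add: lead_coeff_cols_def scalar_prod_def atLeast0LessThan)
      finally show ?thesis using v i by simp
    qed
    have lt: "w $ i = 0 \<or> degree (w $ i) < ?d j" if "i < m" for i
      using deg[OF that] top[OF that] leading_coeff_0_iff le_neq_implies_less by metis
    obtain i where i: "i < m" "w $ i \<noteq> 0" using w0 w by (auto simp: vec_eq_iff)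
    then have pos: "?d j \<ge> 1" using lt[OF i(1)] by simp
    have "vec_degree w \<le> ?d j - 1" unfolding vec_degree_le_iff
    proof (intro allI impI)
      fix i assume "i < dim_vec w"
      then show "degree (w $ i) \<le> ?d j - 1" using lt[of i] w pos by auto
    qed
    then show False using le pos by simp
  qed
qed

section \<open>Eigenvalues of congruent products\<close>

lemma congruence_index:
  fixes L :: "'a :: comm_semiring_0 mat"
  assumes "L \<in> carrier_mat m n" "Q \<in> carrier_mat n n" "a < m" "b < m"
  shows "(L * Q * L\<^sup>T) $$ (a,b) = (\<Sum>i<n. \<Sum>j<n. L $$ (a,i) * Q $$ (i,j) * L $$ (b,j))"
proof -
  have "(L * Q * L\<^sup>T) $$ (a,b) = (\<Sum>j<n. (\<Sum>i<n. L $$ (a,i) * Q $$ (i,j)) * L $$ (b,j))"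
    using assms by (simp add: scalar_prod_def atLeast0LessThan)
  also have "\<dots> = (\<Sum>j<n. \<Sum>i<n. L $$ (a,i) * Q $$ (i,j) * L $$ (b,j))"
    by (simp add: sum_distrib_right)
  also have "\<dots> = (\<Sum>i<n. \<Sum>j<n. L $$ (a,i) * Q $$ (i,j) * L $$ (b,j))" by (rule sum.swap)
  finally show ?thesis .
qed

lemma coeff_mult_degree_le:
  fixes p q :: "'a :: comm_semiring_0 poly"
  assumes "degree p \<le> a" "degree q \<le> b"
  shows "coeff (p * q) (a + b) = coeff p a * coeff q b"
proof -
  have "coeff (p * q) (a + b) = (\<Sum>i\<le>a + b. coeff p i * coeff q (a + b - i))" by (rule coeff_mult)
  also have "\<dots> = (\<Sum>i\<le>a + b. if i = a then coeff p a * coeff q b else 0)"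
  proof (rule sum.cong)
    fix i assume i: "i \<in> {..a + b}"
    show "coeff p i * coeff q (a + b - i) = (if i = a then coeff p a * coeff q b else 0)"
    proof (cases "i < a")
      case True
      then have "coeff q (a + b - i) = 0" using assms(2) by (intro coeff_eq_0) auto
      then show ?thesis using True by simp
    next
      case False
      then show ?thesis using assms(1) coeff_eq_0[of p i] by auto
    qed
  qed simp
  finally show ?thesis by simp
qed

lemma degree_mult3_le:
  fixes p q s :: "'a :: idom poly"
  assumes "degree p \<le> a" "degree s \<le> b" "q \<noteq> 0 \<Longrightarrow> degree q + a + b \<le> D"
  shows "degree (p * q * s) \<le> D"
proof (cases "q = 0")
  case False
  have "degree (p * q * s) \<le> degree p + degree q + degree s"
    by (meson add_mono degree_mult_le le_refl le_trans)
  then show ?thesis using assms False by simp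
qed simp

text \<open>Multiplying entry \<open>(i,j)\<close> by \<open>x ^ (e i + e j)\<close> avoids the negative degrees in the
  condition that entry \<open>(i,j)\<close> has degree at most \<open>D - e i - e j\<close>.\<close>

definition weighted_mat :: "(nat \<Rightarrow> nat) \<Rightarrow> 'a::comm_semiring_1 poly mat \<Rightarrow> 'a poly mat" where
  "weighted_mat e Q = mat (dim_row Q) (dim_col Q) (\<lambda>(i,j). monom 1 (e i + e j) * Q $$ (i,j))"

lemma congruence_degree_le:
  fixes L :: "'a :: idom poly mat"
  assumes L: "L \<in> carrier_mat m n" and Q: "Q \<in> carrier_mat n n"
    and dL: "\<And>a i. a < m \<Longrightarrow> i < n \<Longrightarrow> degree (L $$ (a,i)) \<le> e i"
    and dQ: "\<And>i j. i < n \<Longrightarrow> j < n \<Longrightarrow> Q $$ (i,j) \<noteq> 0 \<Longrightarrow> degree (Q $$ (i,j)) + e i + e j \<le> D"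
    and ab: "a < m" "b < m"
  shows "degree ((L * Q * L\<^sup>T) $$ (a,b)) \<le> D"
  unfolding congruence_index[OF L Q ab]
  using assms by (intro degree_sum_le degree_mult3_le[of _ "e i" _ "e j" for i j]) auto

lemma congruence_coeff_mat:
  fixes L :: "'a :: idom poly mat"
  assumes L: "L \<in> carrier_mat m n" and Q: "Q \<in> carrier_mat n n"
    and dL: "\<And>a i. a < m \<Longrightarrow> i < n \<Longrightarrow> degree (L $$ (a,i)) \<le> e i"
    and dQ: "\<And>i j. i < n \<Longrightarrow> j < n \<Longrightarrow> Q $$ (i,j) \<noteq> 0 \<Longrightarrow> degree (Q $$ (i,j)) + e i + e j \<le> D"
  defines "H \<equiv> mat m n (\<lambda>(a,i). coeff (L $$ (a,i)) (e i))"
  shows "coeff_mat (L * Q * L\<^sup>T) D = H * coeff_mat (weighted_mat e Q) D * H\<^sup>T"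
proof (rule eq_matI)
  let ?W = "coeff_mat (weighted_mat e Q) D"
  have H: "H \<in> carrier_mat m n" and W: "?W \<in> carrier_mat n n"
    using Q by (auto simp: H_def weighted_mat_def coeff_mat_def)
  fix a b assume "a < dim_row (H * ?W * H\<^sup>T)" "b < dim_col (H * ?W * H\<^sup>T)"
  then have ab: "a < m" "b < m" using H by auto
  have "coeff_mat (L * Q * L\<^sup>T) D $$ (a,b) = coeff ((L * Q * L\<^sup>T) $$ (a,b)) D"
    using ab L by (simp add: coeff_mat_def)
  also have "\<dots> = (\<Sum>i<n. \<Sum>j<n. coeff (L $$ (a,i) * Q $$ (i,j) * L $$ (b,j)) D)"
    unfolding congruence_index[OF L Q ab] coeff_sum ..
  also have "\<dots> = (\<Sum>i<n. \<Sum>j<n. H $$ (a,i) * ?W $$ (i,j) * H $$ (b,j))"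
  proof (intro sum.cong refl)
    fix i j assume "i \<in> {..<n}" "j \<in> {..<n}"
    then have ij: "i < n" "j < n" by auto
    have Wij: "?W $$ (i,j) = coeff (monom 1 (e i + e j) * Q $$ (i,j)) D"
      using ij Q by (simp add: coeff_mat_def weighted_mat_def)
    show "coeff (L $$ (a,i) * Q $$ (i,j) * L $$ (b,j)) D = H $$ (a,i) * ?W $$ (i,j) * H $$ (b,j)"
    proof (cases "Q $$ (i,j) = 0")
      case False
      define k where "k = D - e i - e j"
      have D: "D = e i + k + e j" and k: "degree (Q $$ (i,j)) \<le> k"
        using dQ[OF ij False] by (auto simp: k_def)
      have "coeff (L $$ (a,i) * Q $$ (i,j) * L $$ (b,j)) D
          = coeff (L $$ (a,i) * Q $$ (i,j)) (e i + k) * coeff (L $$ (b,j)) (e j)"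
        unfolding D using dL[OF ab(1) ij(1)] dL[OF ab(2) ij(2)] k
        by (intro coeff_mult_degree_le) (auto intro: order.trans[OF degree_mult_le])
      also have "coeff (L $$ (a,i) * Q $$ (i,j)) (e i + k) = coeff (L $$ (a,i)) (e i) * coeff (Q $$ (i,j)) k"
        using dL[OF ab(1) ij(1)] k by (intro coeff_mult_degree_le) auto
      also have "coeff (Q $$ (i,j)) k = ?W $$ (i,j)"
        unfolding Wij using dQ[OF ij False] by (simp add: coeff_monom_mult k_def)
      finally show ?thesis using ab ij by (simp add: H_def)
    qed (simp add: Wij)
  qed
  also have "\<dots> = (H * ?W * H\<^sup>T) $$ (a,b)" by (rule congruence_index[OF H W ab, symmetric])
  finally show "coeff_mat (L * Q * L\<^sup>T) D $$ (a,b) = (H * ?W * H\<^sup>T) $$ (a,b)" .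
qed (use L in \<open>auto simp: H_def coeff_mat_def\<close>)

lemma poly_rev_poly_0: "poly (rev_poly d p) 0 = coeff p d"
proof -
  have "poly (rev_poly d p) 0 = (\<Sum>i\<le>d. if i = d then coeff p i else 0)"
    unfolding rev_poly_def poly_sum by (intro sum.cong) (auto simp: poly_monom power_0_left)
  then show ?thesis by simp
qed

lemma poly_rev_poly:
  assumes "degree p \<le> d" "a \<noteq> 0"
  shows "poly (rev_poly d p) a = a ^ d * poly p (1 / a)"
proof -
  have "poly p (1 / a) = (\<Sum>i\<le>d. coeff p i * (1 / a) ^ i)"
    unfolding poly_altdef using assms by (intro sum.mono_neutral_left) (auto simp: coeff_eq_0)
  then have "a ^ d * poly p (1 / a) = (\<Sum>i\<le>d. coeff p i * (a ^ d * (1 / a) ^ i))"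
    by (simp add: sum_distrib_left mult_ac)
  also have "\<dots> = (\<Sum>i\<le>d. coeff p i * a ^ (d - i))"
    using assms by (intro sum.cong) (auto simp: power_diff power_one_over field_simps)
  finally show ?thesis unfolding rev_poly_def poly_sum by (simp add: poly_monom)
qed

lemma rank_smult_mat:
  fixes A :: "'a :: field mat"
  assumes A: "A \<in> carrier_mat m n" and c: "c \<noteq> 0"
  shows "vec_space.rank m (c \<cdot>\<^sub>m A) = vec_space.rank m A"
proof -
  have *: "vec_space.rank m (c \<cdot>\<^sub>m A) \<le> vec_space.rank m A" if "A \<in> carrier_mat m n" for c and A :: "'a mat"
  proof -
    have "c \<cdot>\<^sub>m A = A * (c \<cdot>\<^sub>m 1\<^sub>m n)"
      using that by (simp add: mult_smult_distrib[OF that, of _ n])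
    then show ?thesis using rank_mult_le_left[OF that, of "c \<cdot>\<^sub>m 1\<^sub>m n" n] by simp
  qed
  have "(1 / c) \<cdot>\<^sub>m (c \<cdot>\<^sub>m A) = A" using c by (intro eq_matI) auto
  then show ?thesis using *[OF A, of c] *[of "c \<cdot>\<^sub>m A" "1 / c"] A by simp
qed

lemma rank_eval_rev_mat:
  assumes P: "P \<in> carrier_mat m n" and d: "mat_degree P \<le> d" and a: "a \<noteq> 0"
  shows "vec_space.rank m (eval_mat a (rev_mat d P)) = vec_space.rank m (eval_mat (1 / a) P)"
proof -
  have "eval_mat a (rev_mat d P) = a ^ d \<cdot>\<^sub>m eval_mat (1 / a) P"
    using P d a unfolding mat_degree_le_iff
    by (intro eq_matI) (auto simp: rev_mat_def poly_rev_poly)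
  then show ?thesis using rank_smult_mat[of "eval_mat (1 / a) P" m n "a ^ d"] P a by simp
qed

lemma normal_rank_rev_mat:
  assumes P: "P \<in> carrier_mat m n" and d: "mat_degree P \<le> d"
  shows "normal_rank (rev_mat d P) = normal_rank P"
proof -
  have R: "rev_mat d P \<in> carrier_mat m n" using P by (simp add: rev_mat_def)
  obtain a where a: "a \<noteq> 0" "vec_space.rank m (eval_mat a P) = normal_rank P"
    using generic_rank_attained[OF P] .
  obtain b where b: "b \<noteq> 0" "vec_space.rank m (eval_mat b (rev_mat d P)) = normal_rank (rev_mat d P)"
    using generic_rank_attained[OF R] .
  have "normal_rank P = vec_space.rank m (eval_mat (1 / a) (rev_mat d P))"
    using rank_eval_rev_mat[OF P d, of "1 / a"] a by simp
  also have "\<dots> \<le> normal_rank (rev_mat d P)" using rank_eval_le_normal_rank[OF R] .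
  finally have 1: "normal_rank P \<le> normal_rank (rev_mat d P)" .
  have "normal_rank (rev_mat d P) \<le> normal_rank P"
    using rank_eval_rev_mat[OF P d b(1)] b(2) rank_eval_le_normal_rank[OF P, of "1 / b"] by simp
  with 1 show ?thesis by simp
qed

lemma no_eigenvalues_iff_rank:
  assumes P: "P \<in> carrier_mat m n" and d: "mat_degree P \<le> d"
  shows "no_eigenvalues d P \<longleftrightarrow> (\<forall>a. vec_space.rank m (eval_mat a P) = normal_rank P) \<and>
    vec_space.rank m (coeff_mat P d) = normal_rank P"
proof -
  have R: "rev_mat d P \<in> carrier_mat m n" using P by (simp add: rev_mat_def)
  have e: "eval_mat 0 (rev_mat d P) = coeff_mat P d"
    by (rule eq_matI) (auto simp: rev_mat_def coeff_mat_def poly_rev_poly_0)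
  have "\<not> infinite_eigenvalue d P \<longleftrightarrow> vec_space.rank m (coeff_mat P d) = normal_rank P"
    using rank_eval_le_normal_rank[OF R, of 0]
    unfolding infinite_eigenvalue_def finite_eigenvalue_iff_rank[OF R] normal_rank_rev_mat[OF P d] e
    by auto
  moreover have "\<not> finite_eigenvalue P a \<longleftrightarrow> vec_space.rank m (eval_mat a P) = normal_rank P" for a
    using rank_eval_le_normal_rank[OF P, of a] unfolding finite_eigenvalue_iff_rank[OF P] by auto
  ultimately show ?thesis unfolding no_eigenvalues_def by blast
qed

lemma POL_ss_neig_iff:
  "P \<in> POL_ss_neig d k m \<longleftrightarrow> P \<in> carrier_mat m m \<and> P\<^sup>T = - P \<and> mat_degree P = d \<and>
     normal_rank P = k \<and> (\<forall>a. vec_space.rank m (eval_mat a P) = k) \<and>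
     vec_space.rank m (coeff_mat P d) = k"
proof -
  have skew: "(\<forall>i. (coeff_mat P i)\<^sup>T = - coeff_mat P i) \<longleftrightarrow> P\<^sup>T = - P" if P: "P \<in> carrier_mat m m"
  proof
    assume *: "\<forall>i. (coeff_mat P i)\<^sup>T = - coeff_mat P i"
    show "P\<^sup>T = - P"
    proof (rule eq_matI)
      fix a b assume "a < dim_row (- P)" "b < dim_col (- P)"
      then have ab: "a < m" "b < m" using P by auto
      have "coeff (P $$ (b,a)) i = - coeff (P $$ (a,b)) i" for i
        using arg_cong[OF spec[OF *, of i], of "\<lambda>A. A $$ (a,b)"] ab P by (simp add: coeff_mat_def)
      then show "P\<^sup>T $$ (a,b) = (- P) $$ (a,b)" using ab P by (simp add: poly_eq_iff)
    qed (use P in auto)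
  next
    assume *: "P\<^sup>T = - P"
    have "P $$ (b,a) = - P $$ (a,b)" if "a < m" "b < m" for a b
      using arg_cong[OF *, of "\<lambda>A. A $$ (a,b)"] that P by simp
    note neg = this
    show "\<forall>i. (coeff_mat P i)\<^sup>T = - coeff_mat P i"
    proof
      fix i
      show "(coeff_mat P i)\<^sup>T = - coeff_mat P i"
      proof (rule eq_matI)
        fix a b assume "a < dim_row (- coeff_mat P i)" "b < dim_col (- coeff_mat P i)"
        then have "a < m" "b < m" using P by (auto simp: coeff_mat_def)
        then show "(coeff_mat P i)\<^sup>T $$ (a,b) = (- coeff_mat P i) $$ (a,b)"
          using neg[of a b] P by (simp add: coeff_mat_def)
      qed (use P in \<open>auto simp: coeff_mat_def\<close>)
    qed
  qed
  show ?thesis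
  proof (cases "P \<in> carrier_mat m m \<and> mat_degree P = d")
    case True
    then have P: "P \<in> carrier_mat m m" and d: "mat_degree P = d" by auto
    have "P \<in> POL_ss_neig d k m \<longleftrightarrow> P\<^sup>T = - P \<and> normal_rank P = k \<and> no_eigenvalues d P"
      using P d skew[OF P] by (auto simp: POL_ss_neig_def POL_ss_def)
    then show ?thesis using P d no_eigenvalues_iff_rank[OF P eq_refl[OF d]] by auto
  qed (auto simp: POL_ss_neig_def POL_ss_def)
qed

definition exchange_mat :: "nat \<Rightarrow> 'a::ring_1 mat" where
  "exchange_mat r = mat (2 * r) (2 * r)
     (\<lambda>(i,j). if i + j + 1 = 2 * r then (if i < r then 1 else - 1) else 0)"

lemma skew_block_mat_eq: "skew_block_mat r = exchange_mat r"
  by (rule eq_matI) (auto simp: skew_block_mat_def exchange_mat_def antidiag_mat_def)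

lemma exchange_mat_carrier [simp]: "exchange_mat r \<in> carrier_mat (2 * r) (2 * r)"
  by (simp add: exchange_mat_def)

lemma exchange_mat_dim [simp]: "dim_row (exchange_mat r) = 2 * r" "dim_col (exchange_mat r) = 2 * r"
  by (simp_all add: exchange_mat_def)

lemma exchange_mat_transpose: "(exchange_mat r)\<^sup>T = - exchange_mat r"
  by (rule eq_matI) (auto simp: exchange_mat_def)

lemma exchange_mat_square: "- exchange_mat r * exchange_mat r = (1\<^sub>m (2 * r) :: 'a :: comm_ring_1 mat)"
proof (rule eq_matI)
  let ?n = "2 * r"
  let ?J = "exchange_mat r :: 'a mat"
  fix i j assume "i < dim_row (1\<^sub>m ?n :: 'a mat)" "j < dim_col (1\<^sub>m ?n :: 'a mat)"
  then have ij: "i < ?n" "j < ?n" by auto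
  have "(- ?J * ?J) $$ (i,j) = (\<Sum>k<?n. (- ?J) $$ (i,k) * ?J $$ (k,j))"
    using ij by (simp add: scalar_prod_def atLeast0LessThan exchange_mat_def del: uminus_mult_left_mat)
  also have "\<dots> = (\<Sum>k<?n. if k = ?n - 1 - i then (- ?J) $$ (i,k) * ?J $$ (k,j) else 0)"
    using ij by (intro sum.cong) (auto simp: exchange_mat_def)
  also have "\<dots> = (- ?J) $$ (i, ?n - 1 - i) * ?J $$ (?n - 1 - i, j)" using ij by simp
  also have "\<dots> = 1\<^sub>m ?n $$ (i,j)" using ij by (auto simp: exchange_mat_def)
  finally show "(- ?J * ?J) $$ (i,j) = 1\<^sub>m ?n $$ (i,j)" .
qed (auto simp: exchange_mat_def)

lemma det_exchange_mat: "det (exchange_mat r :: 'a :: field mat) \<noteq> 0"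
proof -
  have "inj_mat (exchange_mat r :: 'a mat)"
    by (rule left_inverse_imp_inj_mat[of _ "2 * r" "2 * r", OF _ _ exchange_mat_square]) auto
  then show ?thesis using inj_mat_square_iff_det[OF exchange_mat_carrier] by blast
qed

lemma transpose_congruence:
  fixes L :: "'a :: comm_ring_1 mat"
  assumes "L \<in> carrier_mat m n" "Q \<in> carrier_mat n n"
  shows "(L * Q * L\<^sup>T)\<^sup>T = L * Q\<^sup>T * L\<^sup>T"
proof -
  have "(L * Q * L\<^sup>T)\<^sup>T = L\<^sup>T\<^sup>T * (L * Q)\<^sup>T" using assms by (intro transpose_mult) auto
  also have "(L * Q)\<^sup>T = Q\<^sup>T * L\<^sup>T" using assms by (intro transpose_mult) auto
  finally show ?thesis using assms by (simp add: mat_mult_assoc)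
qed

lemma eval_congruence:
  fixes L :: "complex poly mat"
  assumes "L \<in> carrier_mat m n" "Q \<in> carrier_mat n n"
  shows "eval_mat a (L * Q * L\<^sup>T) = eval_mat a L * eval_mat a Q * (eval_mat a L)\<^sup>T"
proof -
  have "eval_mat a (L * Q * L\<^sup>T) = eval_mat a (L * Q) * eval_mat a (L\<^sup>T)"
    unfolding eval_mat_def using assms by (intro hom_mult_mat[OF poly_eval_hom, of _ m n _ m]) auto
  also have "eval_mat a (L * Q) = eval_mat a L * eval_mat a Q"
    unfolding eval_mat_def using assms by (intro hom_mult_mat[OF poly_eval_hom]) auto
  also have "eval_mat a (L\<^sup>T) = (eval_mat a L)\<^sup>T" by (rule eq_matI) (use assms in auto)
  finally show ?thesis .
qed

lemma normal_rank_congruence_le: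
  assumes "L \<in> carrier_mat m n" "Q \<in> carrier_mat n n"
  shows "normal_rank (L * Q * L\<^sup>T) \<le> n"
proof -
  have "fract_mat (L * Q * L\<^sup>T) = fract_mat L * fract_mat (Q * L\<^sup>T)"
    using assms fract_mat_mult[of L m n "Q * L\<^sup>T" m] by (simp add: mat_mult_assoc)
  then have "vec_space.rank m (fract_mat (L * Q * L\<^sup>T)) \<le> n"
    using assms by (rule_tac vec_space.rank_le_factor) auto
  then show ?thesis unfolding normal_rank_def using assms by simp
qed

lemma skew_congruence_in_POL_ss_neig:
  assumes r: "r > 0" and L: "L \<in> carrier_mat m (2 * r)" and mc: "min_degree_cols L"
    and sum: "\<And>i. i < 2 * r \<Longrightarrow> vec_degree (col L i) + vec_degree (col L (2 * r - 1 - i)) = d"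
  shows "L * exchange_mat r * L\<^sup>T \<in> POL_ss_neig d (2 * r) m"
proof -
  define P where "P = L * exchange_mat r * L\<^sup>T"
  let ?n = "2 * r"
  let ?J = "exchange_mat r :: complex poly mat"
  let ?e = "\<lambda>i. vec_degree (col L i)"
  have P: "P \<in> carrier_mat m m"
    unfolding P_def using L by (intro mult_carrier_mat[of _ m "2 * r"]) auto
  have J: "?J \<in> carrier_mat ?n ?n" by simp
  have skew: "P\<^sup>T = - P"
    unfolding P_def using L by (simp add: transpose_congruence[OF L J] exchange_mat_transpose)
  have dL: "degree (L $$ (a,i)) \<le> ?e i" if "a < m" "i < ?n" for a i
    using vec_degree_le_iff[of "col L i" "?e i"] that L by auto
  have dJ: "degree (?J $$ (i,j)) + ?e i + ?e j \<le> d" if "i < ?n" "j < ?n" "?J $$ (i,j) \<noteq> 0" for i j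
  proof -
    have "j = ?n - 1 - i" using that by (auto simp: exchange_mat_def split: if_splits)
    then show ?thesis using sum[OF that(1)] that by (simp add: exchange_mat_def)
  qed
  have W: "coeff_mat (weighted_mat ?e ?J) d = exchange_mat r"
  proof (rule eq_matI)
    fix i j assume "i < dim_row (exchange_mat r :: complex mat)" "j < dim_col (exchange_mat r :: complex mat)"
    then have ij: "i < ?n" "j < ?n" by (auto simp: exchange_mat_def)
    show "coeff_mat (weighted_mat ?e ?J) d $$ (i,j) = exchange_mat r $$ (i,j)"
    proof (cases "i + j + 1 = ?n")
      case True
      then have "j = ?n - 1 - i" by simp
      then show ?thesis using sum[OF ij(1)] ij by (simp add: exchange_mat_def coeff_mat_def weighted_mat_def)
    qed (use ij in \<open>simp add: exchange_mat_def coeff_mat_def weighted_mat_def\<close>)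
  qed (auto simp: exchange_mat_def coeff_mat_def weighted_mat_def)
  have "mat m ?n (\<lambda>(a,i). coeff (L $$ (a,i)) (?e i)) = lead_coeff_cols L"
    using L by (simp add: lead_coeff_cols_def)
  then have top: "coeff_mat P d = lead_coeff_cols L * exchange_mat r * (lead_coeff_cols L)\<^sup>T"
    unfolding P_def using congruence_coeff_mat[OF L J, of ?e d, OF dL dJ] W by simp
  have "lead_coeff_cols L \<in> carrier_mat m ?n" using L by (simp add: lead_coeff_cols_def)
  then have rtop: "vec_space.rank m (coeff_mat P d) = ?n"
    unfolding top using rank_inj_congruence[OF min_degree_cols_lead_inj[OF L mc]] det_exchange_mat by simp
  have reval: "vec_space.rank m (eval_mat a P) = ?n" for a
  proof -
    have "eval_mat a ?J = exchange_mat r" by (rule eq_matI) (auto simp: exchange_mat_def)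
    then show ?thesis unfolding P_def eval_congruence[OF L J]
      using rank_inj_congruence[OF min_degree_cols_eval_inj[OF L mc], where m = m and n = ?n] L det_exchange_mat by simp
  qed
  have nr: "normal_rank P = ?n"
    using normal_rank_congruence_le[OF L J] rank_eval_le_normal_rank[OF P, of 0] reval[of 0]
    unfolding P_def by simp
  have le: "mat_degree P \<le> d"
    unfolding mat_degree_le_iff P_def using congruence_degree_le[OF L J, of ?e d, OF dL dJ] L by auto
  have "mat_degree P = d"
  proof (rule ccontr)
    assume "mat_degree P \<noteq> d"
    then have "d > 0" "mat_degree P \<le> d - 1" using le by auto
    then have "degree (P $$ (a,b)) < d" if "a < m" "b < m" for a b
      using that P unfolding mat_degree_le_iff by fastforce
    then have "coeff_mat P d = 0\<^sub>m m m" using P by (intro eq_matI) (auto simp: coeff_mat_def coeff_eq_0)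
    then show False using rtop r vec_space.rank_0I[of m m] by (metis mult_eq_0_iff neq0_conv zero_neq_numeral)
  qed
  then show ?thesis unfolding POL_ss_neig_iff P_def[symmetric] using P skew nr reval rtop by simp
qed

section \<open>Factorization through a minimal basis\<close>

lemma col_degree_sum_cols: "col_degree_sum L = sum_list (map vec_degree (cols L))"
  by (simp add: col_degree_sum_def sum_list_sum_nth atLeast0LessThan)

lemma frac_factor_full_rank_exists:
  assumes P: "P \<in> carrier_mat m k" and r: "normal_rank P = n"
  obtains L where "L \<in> carrier_mat m n" "frac_factor P L"
proof -
  have FP: "fract_mat P \<in> carrier_mat m k" and r': "vec_space.rank m (fract_mat P) = n"
    using P r unfolding normal_rank_def by auto
  obtain B C where B: "B \<in> carrier_mat m n" and C: "C \<in> carrier_mat n k" "fract_mat P = B * C"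
    using vec_space.maximal_indpt_cols[OF FP] unfolding r' by metis
  obtain q L where q: "q \<noteq> 0" and L: "L \<in> carrier_mat m n" "to_fract q \<cdot>\<^sub>m B = fract_mat L"
    using clear_denominators_mat[OF B] by metis
  have "fract_mat L * (inverse (to_fract q) \<cdot>\<^sub>m C) = inverse (to_fract q) \<cdot>\<^sub>m (to_fract q \<cdot>\<^sub>m (B * C))"
    unfolding L(2)[symmetric] using B C by (simp add: mult_smult_distrib[of _ m n _ k] mult_smult_assoc_mat[of _ m n _ k])
  also have "\<dots> = fract_mat P" unfolding C(2) using q by (intro eq_matI) auto
  finally have "fract_mat P = fract_mat L * (inverse (to_fract q) \<cdot>\<^sub>m C)" ..
  then have "frac_factor P L"
    unfolding frac_factor_iff[OF P L(1)] using C by (intro bexI[of _ "inverse (to_fract q) \<cdot>\<^sub>m C"]) auto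
  then show ?thesis using that L by blast
qed

lemma least_frac_factor_min_degree_cols:
  assumes P: "P \<in> carrier_mat m k" and r: "normal_rank P = n"
    and L: "L \<in> carrier_mat m n" and fL: "frac_factor P L"
    and least: "\<And>M. M \<in> carrier_mat m n \<Longrightarrow> frac_factor P M \<Longrightarrow> col_degree_sum L \<le> col_degree_sum M"
  shows "min_degree_cols L"
proof -
  obtain X where X: "X \<in> carrier_mat n k" "fract_mat P = fract_mat L * X"
    using fL unfolding frac_factor_iff[OF P L] by blast
  have "vec_space.rank m (fract_mat L * X) = n"
    using r P unfolding X(2)[symmetric] normal_rank_def by simp
  then have "inj_mat (fract_mat L)" using rank_full_imp_inj_mat[OF _ X(1)] L by auto
  then have "inj_mat L" using inj_fract_mat_iff[OF L] by simp
  moreover have "col_degree_sum L \<le> col_degree_sum M" if "M \<in> carrier_mat m n" "frac_factor L M" for M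
    using least[OF that(1)] frac_factor_trans[OF fL that(2) P L that(1)] .
  ultimately show ?thesis unfolding min_degree_cols_def using L by auto
qed

lemma sorted_least_frac_factor_exists:
  assumes P: "P \<in> carrier_mat m k" and r: "normal_rank P = n"
  obtains L where "L \<in> carrier_mat m n" "frac_factor P L"
    "\<And>M. M \<in> carrier_mat m n \<Longrightarrow> frac_factor P M \<Longrightarrow> col_degree_sum L \<le> col_degree_sum M"
    "\<And>i j. i \<le> j \<Longrightarrow> j < n \<Longrightarrow> vec_degree (col L j) \<le> vec_degree (col L i)"
proof -
  obtain L0 where "L0 \<in> carrier_mat m n \<and> frac_factor P L0"
    using frac_factor_full_rank_exists[OF P r] by metis
  from ex_has_least_nat[of "\<lambda>L. L \<in> carrier_mat m n \<and> frac_factor P L", OF this, of col_degree_sum]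
  obtain L where L: "L \<in> carrier_mat m n" "frac_factor P L"
    and least: "\<And>M. M \<in> carrier_mat m n \<Longrightarrow> frac_factor P M \<Longrightarrow> col_degree_sum L \<le> col_degree_sum M"
    by blast
  define xs where "xs = rev (sort_key vec_degree (cols L))"
  define M where "M = mat_of_cols m xs"
  have mx: "mset xs = mset (cols L)" by (simp add: xs_def)
  have sx: "set xs = set (cols L)" by (simp add: xs_def)
  have len: "length xs = n" using L(1) by (simp add: xs_def)
  have M: "M \<in> carrier_mat m n" using len by (auto simp: M_def)
  have cM: "cols M = xs" unfolding M_def using sx L(1) cols_dim[of L] by (intro cols_mat_of_cols) auto
  have "ratfun_span m (set (cols L)) \<subseteq> ratfun_span m (set (cols M))" unfolding cM sx ..
  then have "frac_factor L M" using ratfun_span_cols_subset_imp[OF L(1) M] by blast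
  then have f: "frac_factor P M" using frac_factor_trans[OF L(2) _ P L(1) M] by blast
  have "mset (map vec_degree xs) = mset (map vec_degree (cols L))" using mx by simp
  then have "col_degree_sum M = col_degree_sum L"
    unfolding col_degree_sum_cols cM by (metis sum_mset_sum_list)
  moreover have "vec_degree (col M j) \<le> vec_degree (col M i)" if ij: "i \<le> j" "j < n" for i j
  proof -
    let ?s = "sort_key vec_degree (cols L)"
    have "sorted (map vec_degree ?s)" by simp
    then have "map vec_degree ?s ! (n - 1 - j) \<le> map vec_degree ?s ! (n - 1 - i)"
      using ij len by (intro sorted_nth_mono) (auto simp: xs_def)
    then have "vec_degree (?s ! (n - 1 - j)) \<le> vec_degree (?s ! (n - 1 - i))"
      using ij len by (simp add: xs_def)
    then have "vec_degree (xs ! j) \<le> vec_degree (xs ! i)"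
      using ij len unfolding xs_def by (simp add: rev_nth)
    then show ?thesis using ij M cols_nth[of _ M] unfolding cM by simp
  qed
  ultimately show ?thesis using that[OF M f] least by simp
qed

lemma eval_inj_saturated:
  fixes L :: "complex poly mat"
  assumes L: "L \<in> carrier_mat m n" and inj: "\<And>a. inj_mat (eval_mat a L)"
    and P: "P \<in> carrier_mat m k" and Y: "Y \<in> carrier_mat n k"
    and q: "q \<noteq> 0" and eq: "q \<cdot>\<^sub>m P = L * Y"
  shows "\<exists>Z \<in> carrier_mat n k. P = L * Z"
  using Y q eq
proof (induction "degree q" arbitrary: q Y)
  case 0
  then obtain c where c: "q = [:c:]" "c \<noteq> 0" by (metis degree_eq_zeroE pCons_0_0)
  have "[:1 / c:] \<cdot>\<^sub>m (q \<cdot>\<^sub>m P) = P" using c by (intro eq_matI) (auto simp flip: mult.assoc)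
  then have "P = L * ([:1 / c:] \<cdot>\<^sub>m Y)"
    using 0 L by (simp add: mult_smult_distrib[of _ m n _ k])
  then show ?case using 0 by (intro bexI[of _ "[:1 / c:] \<cdot>\<^sub>m Y"]) auto
next
  case (Suc e)
  have "\<not> constant (poly q)" using Suc.hyps(2) constant_degree[of q] by simp
  then obtain a where a: "poly q a = 0" using fundamental_theorem_of_algebra by blast
  obtain q' where q': "q = [:-a, 1:] * q'" using a poly_eq_0_iff_dvd dvd_def by metis
  have "eval_mat a L * eval_mat a Y = eval_mat a L * 0\<^sub>m n k"
  proof -
    have "eval_mat a L * eval_mat a Y = eval_mat a (q \<cdot>\<^sub>m P)"
      unfolding Suc.prems(3) eval_mat_def using L Suc.prems(1) by (intro hom_mult_mat[OF poly_eval_hom, symmetric]) auto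
    also have "\<dots> = 0\<^sub>m m k" using P a by (intro eq_matI) auto
    finally show ?thesis using L by simp
  qed
  then have Y0: "eval_mat a Y = 0\<^sub>m n k"
    using inj_mat_cancel[OF inj, of a m n "eval_mat a Y" k "0\<^sub>m n k"] L Suc.prems(1) by auto
  have "\<exists>z. Y $$ (i,j) = [:-a, 1:] * z" if "i < n" "j < k" for i j
  proof -
    have "poly (Y $$ (i,j)) a = 0" using arg_cong[OF Y0, of "\<lambda>A. A $$ (i,j)"] that Suc.prems(1) by simp
    then show ?thesis using poly_eq_0_iff_dvd dvd_def by metis
  qed
  then obtain z where z: "\<And>i j. i < n \<Longrightarrow> j < k \<Longrightarrow> Y $$ (i,j) = [:-a, 1:] * z i j" by metis
  define Y' where "Y' = mat n k (\<lambda>(i,j). z i j)"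
  have Y': "Y' \<in> carrier_mat n k" by (simp add: Y'_def)
  have YY': "Y = [:-a, 1:] \<cdot>\<^sub>m Y'" using Suc.prems(1) z by (intro eq_matI) (auto simp: Y'_def)
  have "[:-a, 1:] \<cdot>\<^sub>m (q' \<cdot>\<^sub>m P) = q \<cdot>\<^sub>m P" unfolding q' by (rule eq_matI) (auto simp only: index_smult_mat mult.assoc)
  also have "\<dots> = [:-a, 1:] \<cdot>\<^sub>m (L * Y')" unfolding Suc.prems(3) YY' using L Y' by (rule mult_smult_distrib)
  finally have *: "[:-a, 1:] \<cdot>\<^sub>m (q' \<cdot>\<^sub>m P) = [:-a, 1:] \<cdot>\<^sub>m (L * Y')" .
  have "q' \<cdot>\<^sub>m P = L * Y'"
  proof (rule eq_matI)
    fix i j assume ij: "i < dim_row (L * Y')" "j < dim_col (L * Y')"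
    then have "[:-a, 1:] * (q' \<cdot>\<^sub>m P) $$ (i,j) = [:-a, 1:] * (L * Y') $$ (i,j)"
      using arg_cong[OF *, of "\<lambda>A. A $$ (i,j)"] P L Y'
      by (simp only: index_smult_mat carrier_matD index_mult_mat(2,3))
    then show "(q' \<cdot>\<^sub>m P) $$ (i,j) = (L * Y') $$ (i,j)" by (metis mult_left_cancel pCons_eq_0_iff one_neq_zero)
  qed (use P L Y' in auto)
  moreover have "q' \<noteq> 0" using q' Suc.prems(2) by auto
  moreover have "e = degree q'"
  proof -
    have "degree q = degree [:-a, 1:] + degree q'"
      unfolding q' using \<open>q' \<noteq> 0\<close> by (intro degree_mult_eq) auto
    then show ?thesis using Suc.hyps(2) by simp
  qed
  ultimately show ?case using Suc.hyps(1)[of q' Y'] Y' by blast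
qed

lemma skew_congruence_factor:
  assumes P: "P \<in> carrier_mat m m" and skew: "P\<^sup>T = - P"
    and L: "L \<in> carrier_mat m n" and mc: "min_degree_cols L" and f: "frac_factor P L"
  obtains Q where "Q \<in> carrier_mat n n" "Q\<^sup>T = - Q" "P = L * Q * L\<^sup>T"
proof -
  have inj: "inj_mat L" and ev: "\<And>a. inj_mat (eval_mat a L)"
    using mc min_degree_cols_eval_inj[OF L mc] unfolding min_degree_cols_def by auto
  obtain q Y where q: "q \<noteq> 0" "Y \<in> carrier_mat n m" "q \<cdot>\<^sub>m P = L * Y"
    using f P L unfolding frac_factor_def by auto
  obtain Z where Z: "Z \<in> carrier_mat n m" "P = L * Z"
    using eval_inj_saturated[OF L ev P q(2,1,3)] by blast
  have "inj_mat (fract_mat L)" using inj_fract_mat_iff[OF L] inj by simp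
  then obtain N where N: "N \<in> carrier_mat n m" "N * fract_mat L = 1\<^sub>m n"
    using inj_mat_left_inverse[of "fract_mat L" m n] L by auto
  obtain s M where s: "s \<noteq> 0" and M: "M \<in> carrier_mat n m" "to_fract s \<cdot>\<^sub>m N = fract_mat M"
    using clear_denominators_mat[OF N(1)] by metis
  have "fract_mat (M * L) = fract_mat (s \<cdot>\<^sub>m 1\<^sub>m n)"
  proof -
    have "fract_mat (M * L) = to_fract s \<cdot>\<^sub>m (N * fract_mat L)"
      unfolding fract_mat_mult[OF M(1) L] M(2)[symmetric] using N(1) L
      by (intro mult_smult_assoc_mat) auto
    then show ?thesis unfolding N(2) by (intro eq_matI) auto
  qed
  then have MsL: "M * L = s \<cdot>\<^sub>m 1\<^sub>m n" by (rule fract_mat_inj)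
  have PT: "P = - (Z\<^sup>T * L\<^sup>T)"
  proof -
    have "P\<^sup>T = Z\<^sup>T * L\<^sup>T" unfolding Z(2) using L Z(1) by (rule transpose_mult)
    then have "- (Z\<^sup>T * L\<^sup>T) = - (- P)" using skew by simp
    also have "\<dots> = P" by (rule eq_matI) auto
    finally show ?thesis ..
  qed
  have "s \<cdot>\<^sub>m Z = M * L * Z" unfolding MsL using Z(1) by (simp add: mult_smult_assoc_mat[of _ n n _ m])
  also have "\<dots> = M * (L * Z)" using M(1) L Z(1) by (simp add: mat_mult_assoc)
  also have "\<dots> = M * (- (Z\<^sup>T * L\<^sup>T))" using Z(2) PT by simp
  also have "\<dots> = (- (M * Z\<^sup>T)) * L\<^sup>T" using M(1) L Z(1) by (simp add: mat_mult_assoc)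
  finally have "(s \<cdot>\<^sub>m Z)\<^sup>T = ((- (M * Z\<^sup>T)) * L\<^sup>T)\<^sup>T" by simp
  also have "\<dots> = L\<^sup>T\<^sup>T * (- (M * Z\<^sup>T))\<^sup>T" using M(1) L Z(1) by (intro transpose_mult) auto
  also have "(s \<cdot>\<^sub>m Z)\<^sup>T = s \<cdot>\<^sub>m Z\<^sup>T" by (rule eq_matI) auto
  finally have sZ: "s \<cdot>\<^sub>m Z\<^sup>T = L * (- (M * Z\<^sup>T))\<^sup>T" by simp
  have "Z\<^sup>T \<in> carrier_mat m n" "(- (M * Z\<^sup>T))\<^sup>T \<in> carrier_mat n n" using M(1) Z(1) by auto
  then obtain W where W: "W \<in> carrier_mat n n" "Z\<^sup>T = L * W"
    using eval_inj_saturated[OF L ev _ _ s sZ] by blast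
  define Q where "Q = W\<^sup>T"
  have Q: "Q \<in> carrier_mat n n" using W by (simp add: Q_def)
  have "Z = (L * W)\<^sup>T" using W(2) by (metis transpose_transpose)
  also have "\<dots> = Q * L\<^sup>T" unfolding Q_def using L W(1) by (rule transpose_mult)
  finally have PQ: "P = L * Q * L\<^sup>T" using Z(2) L Q by (simp add: mat_mult_assoc)
  have "L * (Q\<^sup>T * L\<^sup>T) = L * ((- Q) * L\<^sup>T)"
  proof -
    have "L * (Q\<^sup>T * L\<^sup>T) = P\<^sup>T" unfolding PQ transpose_congruence[OF L Q] using L Q by (simp add: mat_mult_assoc)
    also have "\<dots> = - (L * Q * L\<^sup>T)" using skew PQ by simp
    also have "\<dots> = L * ((- Q) * L\<^sup>T)" using L Q by (simp add: mat_mult_assoc)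
    finally show ?thesis .
  qed
  then have "Q\<^sup>T * L\<^sup>T = (- Q) * L\<^sup>T" using inj_mat_cancel[OF inj L, of "Q\<^sup>T * L\<^sup>T" m "(- Q) * L\<^sup>T"] L Q by auto
  then have "(Q\<^sup>T * L\<^sup>T)\<^sup>T = ((- Q) * L\<^sup>T)\<^sup>T" by simp
  then have "L\<^sup>T\<^sup>T * Q\<^sup>T\<^sup>T = L\<^sup>T\<^sup>T * (- Q)\<^sup>T" using L Q by (simp only: transpose_mult[of _ n n _ m] transpose_carrier_mat uminus_carrier_iff_mat)
  then have "L * Q = L * (- Q)\<^sup>T" by simp
  then have "Q = (- Q)\<^sup>T" using inj_mat_cancel[OF inj L, of Q n "(- Q)\<^sup>T"] Q by auto
  then have "Q\<^sup>T = - Q" by (metis transpose_transpose)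
  then show ?thesis using that[OF Q _ PQ] by blast
qed

section \<open>Pairing of the column degrees\<close>

lemma coeff_prod_degree_le:
  fixes f :: "'b \<Rightarrow> 'a :: comm_semiring_1 poly"
  assumes "finite I" "\<And>i. i \<in> I \<Longrightarrow> degree (f i) \<le> d"
  shows "degree (prod f I) \<le> card I * d \<and> coeff (prod f I) (card I * d) = (\<Prod>i\<in>I. coeff (f i) d)"
  using assms
proof (induction I rule: finite_induct)
  case (insert i I)
  then have IH: "degree (prod f I) \<le> card I * d" "coeff (prod f I) (card I * d) = (\<Prod>i\<in>I. coeff (f i) d)"
    by auto
  have "degree (f i * prod f I) \<le> d + card I * d"
    using IH(1) insert.prems by (intro order.trans[OF degree_mult_le] add_mono) auto
  moreover have "coeff (f i * prod f I) (d + card I * d) = coeff (f i) d * coeff (prod f I) (card I * d)"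
    using IH(1) insert.prems by (intro coeff_mult_degree_le) auto
  ultimately show ?case using insert.hyps IH(2) by simp
qed simp

lemma coeff_signof_mult:
  "coeff (signof p * q) k = signof p * coeff (q :: 'a :: comm_ring_1 poly) k"
  by (auto simp: sign_def)

lemma coeff_det_degree_le:
  fixes R :: "'a :: comm_ring_1 poly mat"
  assumes R: "R \<in> carrier_mat n n" and deg: "\<And>i j. i < n \<Longrightarrow> j < n \<Longrightarrow> degree (R $$ (i,j)) \<le> d"
  shows "coeff (det R) (n * d) = det (coeff_mat R d)"
proof -
  have C: "coeff_mat R d \<in> carrier_mat n n" using R by (simp add: coeff_mat_def)
  have "coeff (\<Prod>i = 0..<n. R $$ (i, p i)) (n * d) = (\<Prod>i = 0..<n. coeff_mat R d $$ (i, p i))"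
    if p: "p permutes {0..<n}" for p
  proof -
    have pi: "p i < n" if "i < n" for i using permutes_in_image[OF p, of i] that by simp
    have "coeff (\<Prod>i = 0..<n. R $$ (i, p i)) (card {0..<n} * d) = (\<Prod>i = 0..<n. coeff (R $$ (i, p i)) d)"
      using coeff_prod_degree_le[of "{0..<n}" "\<lambda>i. R $$ (i, p i)" d] deg pi by auto
    also have "\<dots> = (\<Prod>i = 0..<n. coeff_mat R d $$ (i, p i))"
      using R pi by (intro prod.cong) (auto simp: coeff_mat_def)
    finally show ?thesis by simp
  qed
  then show ?thesis unfolding det_def'[OF R] det_def'[OF C] coeff_sum coeff_signof_mult
    by (intro sum.cong) auto
qed

lemma det_weighted_mat:
  fixes Q :: "'a :: comm_ring_1 poly mat"
  assumes Q: "Q \<in> carrier_mat n n"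
  shows "det (weighted_mat e Q) = monom 1 (2 * (\<Sum>i<n. e i)) * det Q"
proof -
  have W: "weighted_mat e Q \<in> carrier_mat n n" using Q by (simp add: weighted_mat_def)
  have monom: "(\<Prod>i\<in>I. monom (1::'a) (g i)) = monom 1 (sum g I)" if "finite I" for g :: "nat \<Rightarrow> nat" and I
    using that by (induction I rule: finite_induct) (auto simp: mult_monom)
  have "(\<Prod>i = 0..<n. weighted_mat e Q $$ (i, p i)) = monom 1 (2 * (\<Sum>i<n. e i)) * (\<Prod>i = 0..<n. Q $$ (i, p i))"
    if p: "p permutes {0..<n}" for p
  proof -
    have pi: "p i < n" if "i < n" for i using permutes_in_image[OF p, of i] that by simp
    have "(\<Prod>i = 0..<n. weighted_mat e Q $$ (i, p i)) = (\<Prod>i = 0..<n. monom 1 (e i + e (p i)) * Q $$ (i, p i))"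
      using Q pi by (intro prod.cong) (auto simp: weighted_mat_def)
    also have "\<dots> = monom 1 (\<Sum>i = 0..<n. e i + e (p i)) * (\<Prod>i = 0..<n. Q $$ (i, p i))"
      by (simp add: prod.distrib monom)
    also have "(\<Sum>i = 0..<n. e i + e (p i)) = 2 * (\<Sum>i<n. e i)"
      using sum.permute[OF p, of e] by (simp add: sum.distrib comp_def atLeast0LessThan)
    finally show ?thesis .
  qed
  then show ?thesis unfolding det_def'[OF W] det_def'[OF Q] sum_distrib_left
    by (intro sum.cong) (auto simp: mult_ac)
qed

lemma inj_congruence_eq_0:
  fixes L :: "'a :: comm_ring_1 mat"
  assumes "inj_mat L" and L: "L \<in> carrier_mat m n" and Q: "Q \<in> carrier_mat n n"
    and 0: "L * Q * L\<^sup>T = 0\<^sub>m m m"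
  shows "Q = 0\<^sub>m n n"
proof -
  have "L * (Q * L\<^sup>T) = L * 0\<^sub>m n m" using 0 L Q by (simp add: mat_mult_assoc)
  then have "Q * L\<^sup>T = 0\<^sub>m n m" using inj_mat_cancel[OF assms(1) L, of "Q * L\<^sup>T" m "0\<^sub>m n m"] L Q by auto
  then have "(Q * L\<^sup>T)\<^sup>T = (0\<^sub>m n m)\<^sup>T" by simp
  then have "L * Q\<^sup>T = 0\<^sub>m m n" using L Q transpose_mult[of Q n n "L\<^sup>T" m] by (auto simp: mat_eq_iff)
  then have "L * Q\<^sup>T = L * 0\<^sub>m n n" using L by simp
  then have "Q\<^sup>T = 0\<^sub>m n n" using inj_mat_cancel[OF assms(1) L, of "Q\<^sup>T" n "0\<^sub>m n n"] Q by auto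
  then show ?thesis by (metis transpose_transpose zero_transpose_mat)
qed

lemma congruence_predictable_degree:
  fixes L :: "complex poly mat"
  assumes L: "L \<in> carrier_mat m n" and inj: "inj_mat (lead_coeff_cols L)"
    and Q: "Q \<in> carrier_mat n n" and deg: "mat_degree (L * Q * L\<^sup>T) \<le> d"
    and ij: "i < n" "j < n" "Q $$ (i,j) \<noteq> 0"
  shows "degree (Q $$ (i,j)) + vec_degree (col L i) + vec_degree (col L j) \<le> d"
proof (rule ccontr)
  let ?e = "\<lambda>i. vec_degree (col L i)"
  let ?K = "{(i,j). i < n \<and> j < n \<and> Q $$ (i,j) \<noteq> 0}"
  let ?f = "\<lambda>(i,j). degree (Q $$ (i,j)) + ?e i + ?e j"
  assume neg: "\<not> ?thesis"
  have fin: "finite ?K" by (rule finite_subset[of _ "{..<n} \<times> {..<n}"]) auto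
  have "?K \<noteq> {}" using ij by auto
  then obtain k where k: "k \<in> ?K" "Max (?f ` ?K) = ?f k" by (rule obtains_MAX[OF fin])
  obtain a b where ab: "k = (a,b)" "a < n" "b < n" "Q $$ (a,b) \<noteq> 0" using k(1) by auto
  define D where "D = ?f (a,b)"
  have le: "degree (Q $$ (i,j)) + ?e i + ?e j \<le> D" if "i < n" "j < n" "Q $$ (i,j) \<noteq> 0" for i j
  proof -
    have "?f (i,j) \<le> Max (?f ` ?K)" using fin that by (intro Max_ge finite_imageI imageI) auto
    then show ?thesis unfolding k(2) ab(1) D_def by simp
  qed
  have "d < D" using neg le[OF ij] by simp
  have dL: "degree (L $$ (a,i)) \<le> ?e i" if "a < m" "i < n" for a i
    using vec_degree_le_iff[of "col L i" "?e i"] that L by auto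
  let ?P = "L * Q * L\<^sup>T"
  let ?W = "coeff_mat (weighted_mat ?e Q) D"
  have P: "?P \<in> carrier_mat m m" using L Q by (intro mult_carrier_mat[of _ m n]) auto
  have "coeff_mat ?P D = 0\<^sub>m m m"
  proof (rule eq_matI)
    fix i j assume "i < dim_row (0\<^sub>m m m :: complex mat)" "j < dim_col (0\<^sub>m m m :: complex mat)"
    then have "i < m" "j < m" by auto
    moreover from this have "degree (?P $$ (i,j)) \<le> d" using deg P unfolding mat_degree_le_iff by auto
    ultimately show "coeff_mat ?P D $$ (i,j) = 0\<^sub>m m m $$ (i,j)"
      using L \<open>d < D\<close> by (simp add: coeff_mat_def coeff_eq_0 del: index_mult_mat(1))
  qed (use P in \<open>auto simp: coeff_mat_def\<close>)
  moreover have "mat m n (\<lambda>(a,i). coeff (L $$ (a,i)) (?e i)) = lead_coeff_cols L"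
    using L by (simp add: lead_coeff_cols_def)
  ultimately have "lead_coeff_cols L * ?W * (lead_coeff_cols L)\<^sup>T = 0\<^sub>m m m"
    using congruence_coeff_mat[OF L Q, of ?e D, OF dL le] by simp
  moreover have "lead_coeff_cols L \<in> carrier_mat m n" "?W \<in> carrier_mat n n"
    using L Q by (auto simp: lead_coeff_cols_def weighted_mat_def coeff_mat_def)
  ultimately have "?W = 0\<^sub>m n n" using inj_congruence_eq_0[OF inj] by blast
  then have "?W $$ (a,b) = 0" using ab by simp
  then have "coeff (Q $$ (a,b)) (degree (Q $$ (a,b))) = 0"
    using ab Q by (simp add: coeff_mat_def weighted_mat_def D_def coeff_monom_mult)
  then show False using ab by simp
qed

text \<open>
  The top coefficient of \<open>det (weighted_mat e Q)\<close> bounds the sum of the column degrees from below. A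
  permutation with a nonzero product in the expansion of \<open>det Q\<close>, together with the pigeonhole
  principle, bounds each \<open>e i + e (n - 1 - i)\<close> from above.
\<close>

lemma congruence_degree_pairing:
  fixes L :: "complex poly mat"
  assumes L: "L \<in> carrier_mat m n" and mc: "min_degree_cols L" and Q: "Q \<in> carrier_mat n n"
    and P: "P = L * Q * L\<^sup>T" and deg: "mat_degree P \<le> d"
    and reval: "\<And>a. vec_space.rank m (eval_mat a P) = n"
    and rtop: "vec_space.rank m (coeff_mat P d) = n"
    and sorted: "\<And>i j. i \<le> j \<Longrightarrow> j < n \<Longrightarrow> vec_degree (col L j) \<le> vec_degree (col L i)"
    and i: "i < n"
  shows "vec_degree (col L i) + vec_degree (col L (n - 1 - i)) = d"
proof -
  let ?e = "\<lambda>i. vec_degree (col L i)"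
  let ?W = "weighted_mat ?e Q"
  have W: "?W \<in> carrier_mat n n" using Q by (simp add: weighted_mat_def)
  have le: "degree (Q $$ (i,j)) + ?e i + ?e j \<le> d" if "i < n" "j < n" "Q $$ (i,j) \<noteq> 0" for i j
    using congruence_predictable_degree[OF L min_degree_cols_lead_inj[OF L mc] Q] deg that unfolding P by blast
  have dL: "degree (L $$ (a,i)) \<le> ?e i" if "a < m" "i < n" for a i
    using vec_degree_le_iff[of "col L i" "?e i"] that L by auto
  have "mat m n (\<lambda>(a,i). coeff (L $$ (a,i)) (?e i)) = lead_coeff_cols L"
    using L by (simp add: lead_coeff_cols_def)
  then have "coeff_mat P d = lead_coeff_cols L * coeff_mat ?W d * (lead_coeff_cols L)\<^sup>T"
    unfolding P using congruence_coeff_mat[OF L Q, of ?e d, OF dL le] by simp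
  moreover have "lead_coeff_cols L \<in> carrier_mat m n" "coeff_mat ?W d \<in> carrier_mat n n"
    using L W by (auto simp: lead_coeff_cols_def coeff_mat_def)
  ultimately have detW: "det (coeff_mat ?W d) \<noteq> 0"
    using rank_inj_congruence[OF min_degree_cols_lead_inj[OF L mc]] rtop by simp
  have "poly (det Q) a \<noteq> 0" for a
  proof -
    have "det (eval_mat a Q) \<noteq> 0"
      using rank_inj_congruence[OF min_degree_cols_eval_inj[OF L mc], where m = m and n = n and Q = "eval_mat a Q"]
        L Q reval[of a] unfolding P eval_congruence[OF L Q] by simp
    moreover have "det (eval_mat a Q) = poly (det Q) a"
      unfolding eval_mat_def by (rule comm_ring_hom.hom_det[OF poly_eval_hom])
    ultimately show ?thesis by simp
  qed
  then have "constant (poly (det Q))" using fundamental_theorem_of_algebra by blast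
  then have degdet: "degree (det Q) = 0" by (simp add: constant_degree)
  have det0: "det Q \<noteq> 0" using \<open>poly (det Q) 0 \<noteq> 0\<close> by auto
  have "degree (?W $$ (i,j)) \<le> d" if "i < n" "j < n" for i j
  proof (cases "Q $$ (i,j) = 0")
    case False
    then have "degree (?W $$ (i,j)) = ?e i + ?e j + degree (Q $$ (i,j))"
      using that Q by (simp add: weighted_mat_def degree_mult_eq degree_monom_eq)
    then show ?thesis using le[OF that False] by simp
  qed (use that Q in \<open>simp add: weighted_mat_def\<close>)
  then have "coeff (det ?W) (n * d) \<noteq> 0" using coeff_det_degree_le[OF W] detW by simp
  then have "n * d \<le> degree (det ?W)" by (rule le_degree)
  also have "\<dots> = 2 * (\<Sum>i<n. ?e i)"
    unfolding det_weighted_mat[OF Q] using det0 degdet by (simp add: degree_mult_eq degree_monom_eq)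
  finally have lower: "n * d \<le> 2 * (\<Sum>i<n. ?e i)" .
  obtain p where p: "p permutes {0..<n}" "(\<Prod>i = 0..<n. Q $$ (i, p i)) \<noteq> 0"
    using det0 unfolding det_def'[OF Q] by (metis (mono_tags, lifting) mem_Collect_eq mult_zero_right sum.neutral)
  have pi: "p i < n" if "i < n" for i using permutes_in_image[OF p(1), of i] that by simp
  have pe: "?e i + ?e (p i) \<le> d" if "i < n" for i
    using le[OF that pi[OF that]] p(2) that by simp
  have upper: "?e i + ?e (n - 1 - i) \<le> d" if i: "i < n" for i
  proof (rule ccontr)
    assume neg: "\<not> ?thesis"
    have "p ` {..i} \<subseteq> {n - i..<n}"
    proof
      fix x assume "x \<in> p ` {..i}"
      then obtain k where k: "k \<le> i" "x = p k" by auto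
      have "?e (p k) < ?e (n - 1 - i)" using pe[of k] sorted[OF k(1) i] neg k i by simp
      then have "\<not> p k \<le> n - 1 - i" using sorted[of "p k" "n - 1 - i"] i by auto
      then show "x \<in> {n - i..<n}" using pi[of k] k i by auto
    qed
    then have "card (p ` {..i}) \<le> i" using card_mono[of "{n - i..<n}" "p ` {..i}"] i by simp
    moreover have "card (p ` {..i}) = i + 1"
      using card_image[of p "{..i}"] permutes_inj[OF p(1)] by (simp add: inj_on_def)
    ultimately show False by simp
  qed
  have reflect: "(\<Sum>i<n. ?e (n - 1 - i)) = (\<Sum>i<n. ?e i)" using sum.nat_diff_reindex[of ?e n] by simp
  show ?thesis
  proof (rule ccontr)
    assume "\<not> ?thesis"
    then have lt: "?e i + ?e (n - 1 - i) < d" using upper[OF i] by simp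
    have "(\<Sum>i<n. ?e i + ?e (n - 1 - i)) < (\<Sum>i<n. d)"
      using upper lt i by (intro sum_strict_mono_ex1) auto
    then show False using lower reflect by (simp add: sum.distrib)
  qed
qed

section \<open>Symplectic normal form\<close>

text \<open>
  This is \<open>degree p \<le> b - a\<close>, where only the zero polynomial satisfies a negative bound.
\<close>

definition deg_shift_le :: "'a::zero poly \<Rightarrow> nat \<Rightarrow> nat \<Rightarrow> bool" where
  "deg_shift_le p a b \<longleftrightarrow> (p \<noteq> 0 \<longrightarrow> degree p + a \<le> b)"

lemma deg_shift_le_sum:
  assumes "\<And>i. i \<in> I \<Longrightarrow> deg_shift_le (f i) a b"
  shows "deg_shift_le (sum f I) a b"
proof (cases "a \<le> b")
  case True
  have "degree (sum f I) \<le> b - a"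
  proof (cases "finite I")
    case True
    then show ?thesis
    proof (rule degree_sum_le)
      fix i assume "i \<in> I"
      then show "degree (f i) \<le> b - a" using assms[of i] unfolding deg_shift_le_def by (cases "f i = 0") auto
    qed
  qed simp
  then show ?thesis using True unfolding deg_shift_le_def by (simp add: le_diff_conv2)
next
  case False
  then have "f i = 0" if "i \<in> I" for i using assms[OF that] unfolding deg_shift_le_def by auto
  then show ?thesis unfolding deg_shift_le_def by (simp add: sum.neutral)
qed

lemma deg_shift_le_add:
  "deg_shift_le p a b \<Longrightarrow> deg_shift_le q a b \<Longrightarrow> deg_shift_le (p + q) a b"
  using deg_shift_le_sum[of "{0,1::nat}" "\<lambda>i. if i = 0 then p else q" a b] by auto

lemma deg_shift_le_mult:
  fixes p q :: "'a :: idom poly"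
  assumes "deg_shift_le p a b" "deg_shift_le q c d" "a + c + f = b + d + e"
  shows "deg_shift_le (p * q) e f"
  using assms unfolding deg_shift_le_def by (auto simp: degree_mult_eq)

locale graded_skew =
  fixes m n r d :: nat and e :: "nat \<Rightarrow> nat" and P :: "complex poly mat"
  assumes n: "2 * r = n"
    and pairing: "\<And>i. i < n \<Longrightarrow> e i + e (n - 1 - i) = d"
    and antitone: "\<And>i j. i \<le> j \<Longrightarrow> j < n \<Longrightarrow> e j \<le> e i"
    and rank: "normal_rank P = n"
begin

definition graded_factor :: "complex poly mat \<Rightarrow> complex poly mat \<Rightarrow> bool" where
  "graded_factor L Q \<longleftrightarrow> L \<in> carrier_mat m n \<and> Q \<in> carrier_mat n n \<and> P = L * Q * L\<^sup>T \<and> Q\<^sup>T = - Q \<and>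
     (\<forall>a<m. \<forall>j<n. degree (L $$ (a,j)) \<le> e j) \<and>
     (\<forall>i<n. \<forall>j<n. deg_shift_le (Q $$ (i,j)) (e i + e j) d)"

lemma graded_factor_change_basis:
  assumes gf: "graded_factor L Q"
    and S: "S \<in> carrier_mat n n" and T: "T \<in> carrier_mat n n" and TS: "T * S = 1\<^sub>m n"
    and dS: "\<And>i j. i < n \<Longrightarrow> j < n \<Longrightarrow> deg_shift_le (S $$ (i,j)) (e i) (e j)"
    and dT: "\<And>i j. i < n \<Longrightarrow> j < n \<Longrightarrow> deg_shift_le (T $$ (i,j)) (e i) (e j)"
  shows "graded_factor (L * T) (S * Q * S\<^sup>T)"
proof -
  have L: "L \<in> carrier_mat m n" and Q: "Q \<in> carrier_mat n n" and P: "P = L * Q * L\<^sup>T" and skew: "Q\<^sup>T = - Q"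
    and dL: "\<And>a j. a < m \<Longrightarrow> j < n \<Longrightarrow> degree (L $$ (a,j)) \<le> e j"
    and dQ: "\<And>i j. i < n \<Longrightarrow> j < n \<Longrightarrow> deg_shift_le (Q $$ (i,j)) (e i + e j) d"
    using gf unfolding graded_factor_def by auto
  have ST: "S\<^sup>T * T\<^sup>T = 1\<^sub>m n" using transpose_mult[OF T S] TS by simp
  have "L * T * (S * Q * S\<^sup>T) * (L * T)\<^sup>T = L * (T * S) * Q * (S\<^sup>T * T\<^sup>T) * L\<^sup>T"
    unfolding transpose_mult[OF L T] using L Q S T by (simp add: mat_mult_assoc)
  then have "P = L * T * (S * Q * S\<^sup>T) * (L * T)\<^sup>T" unfolding TS ST P using L Q by simp
  moreover have "(S * Q * S\<^sup>T)\<^sup>T = - (S * Q * S\<^sup>T)"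
    unfolding transpose_congruence[OF S Q] skew using S Q by simp
  moreover have "degree ((L * T) $$ (a,j)) \<le> e j" if aj: "a < m" "j < n" for a j
  proof -
    have "(L * T) $$ (a,j) = (\<Sum>i<n. L $$ (a,i) * T $$ (i,j))"
      using aj L T by (simp add: scalar_prod_def atLeast0LessThan)
    also have "degree \<dots> \<le> e j"
    proof (rule degree_sum_le)
      fix i assume "i \<in> {..<n}"
      then show "degree (L $$ (a,i) * T $$ (i,j)) \<le> e j"
        using dL[of a i] dT[of i j] aj degree_mult_le[of "L $$ (a,i)" "T $$ (i,j)"]
        unfolding deg_shift_le_def by (cases "T $$ (i,j) = 0") auto
    qed simp
    finally show ?thesis .
  qed
  moreover have "deg_shift_le ((S * Q * S\<^sup>T) $$ (i,j)) (e i + e j) d" if ij: "i < n" "j < n" for i j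
    unfolding congruence_index[OF S Q ij]
  proof (intro deg_shift_le_sum)
    fix a b assume "a \<in> {..<n}" "b \<in> {..<n}"
    then have ab: "a < n" "b < n" by auto
    have "deg_shift_le (S $$ (i,a) * Q $$ (a,b)) (e i + e b) d"
      by (rule deg_shift_le_mult[OF dS[OF ij(1) ab(1)] dQ[OF ab]]) simp
    then show "deg_shift_le (S $$ (i,a) * Q $$ (a,b) * S $$ (j,b)) (e i + e j) d"
      by (rule deg_shift_le_mult[OF _ dS[OF ij(2) ab(2)]]) simp
  qed
  moreover have "L * T \<in> carrier_mat m n" "S * Q * S\<^sup>T \<in> carrier_mat n n" using L Q S T by auto
  ultimately show ?thesis unfolding graded_factor_def by blast
qed

lemma graded_factor_det:
  assumes "graded_factor L Q"
  shows "det Q \<noteq> 0"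
proof -
  have L: "L \<in> carrier_mat m n" and Q: "Q \<in> carrier_mat n n" and P: "P = L * Q * L\<^sup>T"
    using assms unfolding graded_factor_def by auto
  have "fract_mat P = fract_mat (L * Q) * fract_mat (L\<^sup>T)"
    unfolding P using L Q by (intro fract_mat_mult[of _ m n _ m]) auto
  also have "fract_mat (L * Q) = fract_mat L * fract_mat Q" by (rule fract_mat_mult[OF L Q])
  finally have FP: "fract_mat P = fract_mat L * fract_mat Q * fract_mat (L\<^sup>T)" .
  have "n = vec_space.rank m (fract_mat P)" using rank L unfolding normal_rank_def P by simp
  also have "\<dots> \<le> vec_space.rank m (fract_mat L * fract_mat Q)"
    unfolding FP using L Q by (intro rank_mult_le_left[of _ m n _ m]) auto
  also have "\<dots> \<le> vec_space.rank n (fract_mat Q)"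
    using L Q by (intro rank_mult_le_right[of _ m n _ n]) auto
  finally have "det (fract_mat Q) \<noteq> 0"
    using vec_space.det_zero_low_rank[of "fract_mat Q" n] Q by auto
  then show ?thesis using comm_ring_hom.hom_det[OF to_fract_comm_ring_hom, of Q] by auto
qed

text \<open>After \<open>k\<close> steps the first \<open>k\<close> and the last \<open>k\<close> rows have their final form.\<close>

definition outer :: "nat \<Rightarrow> nat \<Rightarrow> bool" where
  "outer k i \<longleftrightarrow> i < k \<or> n - k \<le> i"

definition normalized :: "nat \<Rightarrow> complex poly mat \<Rightarrow> bool" where
  "normalized k Q \<longleftrightarrow> (\<forall>i<n. \<forall>j<n. outer k i \<longrightarrow> Q $$ (i,j) = exchange_mat r $$ (i,j))"

lemma exchange_index:
  "i < n \<Longrightarrow> j < n \<Longrightarrow>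
   exchange_mat r $$ (i,j) = (if i + j + 1 = n then (if i < r then 1 else - 1) else 0 :: complex poly)"
  using n by (simp add: exchange_mat_def)

lemma graded_factor_skew:
  assumes "graded_factor L Q" "i < n" "j < n"
  shows "Q $$ (j,i) = - Q $$ (i,j)"
proof -
  have "Q\<^sup>T $$ (i,j) = (- Q) $$ (i,j)" and "Q \<in> carrier_mat n n"
    using assms unfolding graded_factor_def by auto
  then show ?thesis using assms by simp
qed

lemma graded_factor_diag: "graded_factor L Q \<Longrightarrow> i < n \<Longrightarrow> Q $$ (i,i) = 0"
  using graded_factor_skew[of L Q i i] by (simp add: equal_neg_zero)

text \<open>The entries of row \<open>k\<close> in the remaining columns are constants, since \<open>e k + e j \<ge> d\<close> there.\<close>

lemma pivot_exists:
  assumes gf: "graded_factor L Q" and norm: "normalized k Q" and k: "k < r"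
  obtains j c where "k < j" "j < n - k" "e j = e (n - 1 - k)" "Q $$ (k,j) = [:c:]" "c \<noteq> 0"
proof -
  have Q: "Q \<in> carrier_mat n n" using gf unfolding graded_factor_def by simp
  have kn: "k < n" using k n by simp
  have "\<exists>j<n. Q $$ (k,j) \<noteq> 0"
  proof (rule ccontr)
    assume "\<not> ?thesis"
    then have "col Q\<^sup>T k = 0\<^sub>v n" using Q kn by (intro eq_vecI) auto
    then have "Q\<^sup>T *\<^sub>v unit_vec n k = 0\<^sub>v n" using mult_mat_unit_vec[of "Q\<^sup>T" n n k] Q kn by simp
    then have "det Q\<^sup>T = 0"
      unfolding det_0_iff_vec_prod_zero[OF transpose_carrier_mat[THEN iffD2, OF Q]]
      using unit_vec_nonzero[OF kn] by (intro exI[of _ "unit_vec n k"]) auto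
    then show False using graded_factor_det[OF gf] det_transpose[OF Q] by simp
  qed
  then obtain j where j: "j < n" "Q $$ (k,j) \<noteq> 0" by blast
  have "\<not> outer k j"
  proof
    assume o: "outer k j"
    then have "Q $$ (j,k) = exchange_mat r $$ (j,k)" using norm j kn unfolding normalized_def by blast
    also have "\<dots> = 0" using o k kn j n by (auto simp: exchange_index outer_def)
    finally show False using graded_factor_skew[OF gf kn j(1)] j by simp
  qed
  moreover have "j \<noteq> k" using graded_factor_diag[OF gf kn] j by auto
  ultimately have kj: "k < j" "j < n - k" unfolding outer_def by auto
  have "degree (Q $$ (k,j)) + (e k + e j) \<le> d"
    using gf kn j unfolding graded_factor_def deg_shift_le_def by auto
  moreover have "e (n - 1 - k) \<le> e j" using kj k n by (intro antitone) auto
  ultimately have "e j = e (n - 1 - k)" "degree (Q $$ (k,j)) = 0" using pairing[OF kn] by auto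
  moreover obtain c where "Q $$ (k,j) = [:c:]" using \<open>degree (Q $$ (k,j)) = 0\<close> by (rule degree_eq_zeroE)
  ultimately show ?thesis using that[OF kj] j by auto
qed

lemma normalize_pivot:
  assumes gf: "graded_factor L Q" and norm: "normalized k Q" and k: "k < r"
  obtains L' Q' where "graded_factor L' Q'" "normalized k Q'" "Q' $$ (k, n - 1 - k) = 1"
proof -
  define l where "l = n - 1 - k"
  have Q: "Q \<in> carrier_mat n n" using gf unfolding graded_factor_def by simp
  have kl: "k < l" "l < n" "k < n" using k n by (auto simp: l_def)
  obtain j0 c where j0: "k < j0" "j0 < n - k" and ej: "e j0 = e l" and c: "Q $$ (k,j0) = [:c:]" "c \<noteq> 0"
    using pivot_exists[OF gf norm k] unfolding l_def .
  define \<tau> where "\<tau> i = (if i = j0 then l else if i = l then j0 else i)" for i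
  define s where "s i = (if i = l then 1 / c else 1)" for i
  have \<tau>: "\<tau> (\<tau> i) = i" "i < n \<Longrightarrow> \<tau> i < n" "e (\<tau> i) = e i" for i
    using j0 kl ej by (auto simp: \<tau>_def)
  have s0: "s i \<noteq> 0" for i using c by (simp add: s_def)
  define S where "S = mat n n (\<lambda>(i,b). if b = \<tau> i then [:s i:] else 0)"
  define T where "T = mat n n (\<lambda>(b,i). if b = \<tau> i then [:1 / s i:] else 0)"
  have S: "S \<in> carrier_mat n n" and T: "T \<in> carrier_mat n n" by (auto simp: S_def T_def)
  have TS: "T * S = 1\<^sub>m n"
  proof (rule eq_matI)
    fix a b assume "a < dim_row (1\<^sub>m n :: complex poly mat)" "b < dim_col (1\<^sub>m n :: complex poly mat)"
    then have ab: "a < n" "b < n" by auto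
    have "(T * S) $$ (a,b) = (\<Sum>i<n. T $$ (a,i) * S $$ (i,b))"
      using ab S T by (simp add: scalar_prod_def atLeast0LessThan)
    also have "\<dots> = (\<Sum>i<n. if i = \<tau> a then (if a = b then 1 else 0) else 0)"
    proof (rule sum.cong)
      fix i assume "i \<in> {..<n}"
      moreover have "a = \<tau> i \<longleftrightarrow> i = \<tau> a" using \<tau>(1) by metis
      ultimately show "T $$ (a,i) * S $$ (i,b) = (if i = \<tau> a then (if a = b then 1 else 0) else 0)"
        using ab \<tau>(1) s0[of i] by (auto simp: S_def T_def one_pCons)
    qed simp
    also have "\<dots> = 1\<^sub>m n $$ (a,b)" using ab \<tau>(2)[of a] by simp
    finally show "(T * S) $$ (a,b) = 1\<^sub>m n $$ (a,b)" .
  qed (use S T in auto)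
  have gf': "graded_factor (L * T) (S * Q * S\<^sup>T)"
    using \<tau> by (intro graded_factor_change_basis[OF gf S T TS]) (auto simp: S_def T_def deg_shift_le_def)
  have entry: "(S * Q * S\<^sup>T) $$ (i,j) = [:s i:] * Q $$ (\<tau> i, \<tau> j) * [:s j:]" if ij: "i < n" "j < n" for i j
  proof -
    have "(S * Q * S\<^sup>T) $$ (i,j) = (\<Sum>a<n. \<Sum>b<n. S $$ (i,a) * Q $$ (a,b) * S $$ (j,b))"
      by (rule congruence_index[OF S Q ij])
    also have "\<dots> = (\<Sum>a<n. \<Sum>b<n. if a = \<tau> i then (if b = \<tau> j then [:s i:] * Q $$ (a,b) * [:s j:] else 0) else 0)"
      using ij by (intro sum.cong refl) (simp add: S_def mult.commute)
    also have "\<dots> = (\<Sum>a<n. if a = \<tau> i then (\<Sum>b<n. if b = \<tau> j then [:s i:] * Q $$ (a,b) * [:s j:] else 0) else 0)"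
      by (intro sum.cong refl) simp
    finally show ?thesis using \<tau>(2) ij by simp
  qed
  have "(S * Q * S\<^sup>T) $$ (k,l) = 1"
  proof -
    have "\<tau> k = k" "\<tau> l = j0" "s k = 1" using kl j0 by (auto simp: \<tau>_def s_def)
    then show ?thesis using entry[OF kl(3,2)] c by (simp add: s_def one_pCons)
  qed
  moreover have "normalized k (S * Q * S\<^sup>T)"
    unfolding normalized_def
  proof (intro allI impI)
    fix i j assume ij: "i < n" "j < n" and o: "outer k i"
    have i: "i \<noteq> j0" "i \<noteq> l" using o j0 kl k n by (auto simp: outer_def l_def)
    then have "\<tau> i = i" "s i = 1" by (auto simp: \<tau>_def s_def)
    moreover have "Q $$ (i, \<tau> j) = exchange_mat r $$ (i, \<tau> j)"
      using norm o ij \<tau>(2) unfolding normalized_def by blast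
    ultimately have "(S * Q * S\<^sup>T) $$ (i,j) = exchange_mat r $$ (i, \<tau> j) * [:s j:]"
      using entry[OF ij] by (simp add: one_pCons)
    also have "\<dots> = exchange_mat r $$ (i,j)"
    proof (cases "j = j0 \<or> j = l")
      case True
      then have "exchange_mat r $$ (i,j) = (0 :: complex poly)" "exchange_mat r $$ (i,\<tau> j) = (0 :: complex poly)"
        using o j0 kl k n ij \<tau>(2)[OF ij(2)] by (auto simp: exchange_index outer_def l_def \<tau>_def)
      then show ?thesis by simp
    next
      case False
      then show ?thesis by (simp add: \<tau>_def s_def one_pCons)
    qed
    finally show "(S * Q * S\<^sup>T) $$ (i,j) = exchange_mat r $$ (i,j)" .
  qed
  ultimately show ?thesis using that gf' unfolding l_def by blast
qed

lemma eliminate_pivot: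
  assumes gf: "graded_factor L Q" and norm: "normalized k Q" and k: "k < r"
    and piv: "Q $$ (k, n - 1 - k) = 1"
  obtains L' Q' where "graded_factor L' Q'" "normalized (Suc k) Q'"
proof -
  define l where "l = n - 1 - k"
  have Q: "Q \<in> carrier_mat n n" using gf unfolding graded_factor_def by simp
  have kl: "k < l" "l < n" "k < n" "l + k + 1 = n" "\<not> l < r" using k n by (auto simp: l_def)
  have Qkl: "Q $$ (k,l) = 1" "Q $$ (l,k) = -1" "Q $$ (k,k) = 0" "Q $$ (l,l) = 0"
    using piv graded_factor_skew[OF gf kl(3,2)] graded_factor_diag[OF gf] kl by (auto simp: l_def)
  have dQ: "\<And>i j. i < n \<Longrightarrow> j < n \<Longrightarrow> deg_shift_le (Q $$ (i,j)) (e i + e j) d"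
    using gf unfolding graded_factor_def by auto
  have ekl: "e k + e l = d" using pairing[OF kl(3)] by (simp add: l_def)
  \<comment> \<open>\<open>E 1\<close> projects the other basis vectors to the complement of the hyperbolic pair \<open>k, l\<close>.\<close>
  define x where "x i = (if i = k \<or> i = l then 0 else Q $$ (l,i))" for i
  define y where "y i = (if i = k \<or> i = l then 0 else - Q $$ (k,i))" for i
  define E where "E z = mat n n (\<lambda>(i,j). (if i = j then 1 else 0) + (if j = k then z * x i else 0)
      + (if j = l then z * y i else 0))" for z :: "complex poly"
  have E: "E z \<in> carrier_mat n n" for z by (simp add: E_def)
  have left: "(E z * X) $$ (i,j) = X $$ (i,j) + z * x i * X $$ (k,j) + z * y i * X $$ (l,j)"
    if "X \<in> carrier_mat n n" "i < n" "j < n" for X z i j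
  proof -
    have "(E z * X) $$ (i,j) = (\<Sum>a<n. E z $$ (i,a) * X $$ (a,j))"
      using that E[of z] by (simp add: scalar_prod_def atLeast0LessThan)
    also have "\<dots> = (\<Sum>a<n. (if i = a then X $$ (a,j) else 0)
        + (if a = k then z * x i * X $$ (a,j) else 0) + (if a = l then z * y i * X $$ (a,j) else 0))"
      using that by (intro sum.cong refl) (simp add: E_def distrib_right)
    finally show ?thesis using that kl by (simp add: sum.distrib)
  qed
  have right: "(X * (E z)\<^sup>T) $$ (i,j) = X $$ (i,j) + z * x j * X $$ (i,k) + z * y j * X $$ (i,l)"
    if "X \<in> carrier_mat n n" "i < n" "j < n" for X z i j
  proof -
    have "(X * (E z)\<^sup>T) $$ (i,j) = (\<Sum>a<n. X $$ (i,a) * E z $$ (j,a))"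
      using that E[of z] by (simp add: scalar_prod_def atLeast0LessThan)
    also have "\<dots> = (\<Sum>a<n. (if j = a then X $$ (i,a) else 0)
        + (if a = k then z * x j * X $$ (i,a) else 0) + (if a = l then z * y j * X $$ (i,a) else 0))"
      using that by (intro sum.cong refl) (simp add: E_def distrib_left mult.commute)
    finally show ?thesis using that kl by (simp add: sum.distrib)
  qed
  have TS: "E (-1) * E 1 = 1\<^sub>m n"
  proof (rule eq_matI)
    fix i j assume "i < dim_row (1\<^sub>m n :: complex poly mat)" "j < dim_col (1\<^sub>m n :: complex poly mat)"
    then have ij: "i < n" "j < n" by auto
    have "x k = 0" "x l = 0" "y k = 0" "y l = 0" by (auto simp: x_def y_def)
    then have "E 1 $$ (k,j) = (if k = j then 1 else 0)" "E 1 $$ (l,j) = (if l = j then 1 else 0)"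
      using ij kl(2,3) by (simp_all add: E_def)
    then show "(E (-1) * E 1) $$ (i,j) = 1\<^sub>m n $$ (i,j)"
      unfolding left[OF E ij] using ij by (simp add: E_def)
  qed (use E in auto)
  have dE: "deg_shift_le (E z $$ (i,j)) (e i) (e j)" if "i < n" "j < n" "z = 1 \<or> z = -1" for z i j
  proof -
    have "deg_shift_le (if i = j then 1 else 0 :: complex poly) (e i) (e j)" by (simp add: deg_shift_le_def)
    moreover have "deg_shift_le (if j = k then z * x i else 0) (e i) (e j)"
      using dQ[OF kl(2) that(1)] ekl that(3) by (auto simp: x_def deg_shift_le_def)
    moreover have "deg_shift_le (if j = l then z * y i else 0) (e i) (e j)"
      using dQ[OF kl(3) that(1)] ekl that(3) by (auto simp: y_def deg_shift_le_def)
    ultimately show ?thesis using that by (auto simp: E_def intro!: deg_shift_le_add)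
  qed
  let ?Q = "E 1 * Q * (E 1)\<^sup>T"
  have gf': "graded_factor (L * E (-1)) ?Q"
    using dE by (intro graded_factor_change_basis[OF gf E E TS]) auto
  have EQ: "E 1 * Q \<in> carrier_mat n n" using E[of 1] Q by auto
  have entry: "?Q $$ (i,j) = Q $$ (i,j) + x i * Q $$ (k,j) + y i * Q $$ (l,j)
      + x j * (Q $$ (i,k) + x i * Q $$ (k,k) + y i * Q $$ (l,k))
      + y j * (Q $$ (i,l) + x i * Q $$ (k,l) + y i * Q $$ (l,l))" if ij: "i < n" "j < n" for i j
    unfolding right[OF EQ ij] left[OF Q ij] left[OF Q ij(1) kl(3)] left[OF Q ij(1) kl(2)] by simp
  have "normalized (Suc k) ?Q"
    unfolding normalized_def
  proof (intro allI impI)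
    fix i j assume ij: "i < n" "j < n" and o: "outer (Suc k) i"
    then consider "outer k i" | "i = k" | "i = l" unfolding outer_def l_def by linarith
    then show "?Q $$ (i,j) = exchange_mat r $$ (i,j)"
    proof cases
      case 1
      have J: "Q $$ (i,b) = exchange_mat r $$ (i,b)" if "b < n" for b
        using norm 1 ij(1) that unfolding normalized_def by blast
      have "exchange_mat r $$ (i,k) = (0 :: complex poly)" "exchange_mat r $$ (i,l) = (0 :: complex poly)"
        using 1 kl ij k n by (auto simp: exchange_index outer_def)
      then have Q0: "Q $$ (i,k) = 0" "Q $$ (i,l) = 0" using J kl by auto
      have "x i = 0" "y i = 0"
        using Q0 graded_factor_skew[OF gf ij(1) kl(3)] graded_factor_skew[OF gf ij(1) kl(2)]
        by (auto simp: x_def y_def)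
      then show ?thesis unfolding entry[OF ij] using Q0 J[OF ij(2)] by simp
    next
      case 2
      have "x i = 0" "y i = 0" using 2 by (auto simp: x_def y_def)
      then show ?thesis unfolding entry[OF ij] using 2 Qkl kl ij k
        by (auto simp: exchange_index x_def y_def)
    next
      case 3
      have "x i = 0" "y i = 0" using 3 by (auto simp: x_def y_def)
      then show ?thesis unfolding entry[OF ij] using 3 Qkl kl ij k
        by (auto simp: exchange_index x_def y_def)
    qed
  qed
  with gf' show ?thesis using that by blast
qed

lemma normal_form_exists:
  assumes "graded_factor L Q"
  obtains L' where "graded_factor L' (exchange_mat r)"
proof -
  have "\<exists>L' Q'. graded_factor L' Q' \<and> normalized k Q'" if "k \<le> r" for k
    using that
  proof (induction k)
    case 0
    have "normalized 0 Q" by (simp add: normalized_def outer_def)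
    with assms show ?case by blast
  next
    case (Suc k)
    then obtain L1 Q1 where 1: "graded_factor L1 Q1" "normalized k Q1" by auto
    have k: "k < r" using Suc.prems by simp
    obtain L2 Q2 where 2: "graded_factor L2 Q2" "normalized k Q2" "Q2 $$ (k, n - 1 - k) = 1"
      using normalize_pivot[OF 1 k] .
    obtain L3 Q3 where "graded_factor L3 Q3" "normalized (Suc k) Q3" using eliminate_pivot[OF 2(1,2) k 2(3)] .
    then show ?case by blast
  qed
  then obtain L' Q' where 1: "graded_factor L' Q'" "normalized r Q'" by blast
  have "Q' \<in> carrier_mat n n" using 1 unfolding graded_factor_def by simp
  then have "Q' = exchange_mat r"
  proof (intro eq_matI)
    fix i j assume "i < dim_row (exchange_mat r :: complex poly mat)" "j < dim_col (exchange_mat r :: complex poly mat)"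
    then have "i < n" "j < n" "outer r i" using n by (auto simp: outer_def)
    then show "Q' $$ (i,j) = exchange_mat r $$ (i,j)" using 1(2) unfolding normalized_def by blast
  qed (use n in auto)
  then show ?thesis using that 1 by blast
qed

end

lemma POL_ss_neig_factorization:
  assumes P: "P \<in> POL_ss_neig d (2 * r) m"
  obtains L where "L \<in> carrier_mat m (2 * r)" "P = L * exchange_mat r * L\<^sup>T" "min_degree_cols L"
    "\<And>i j. i \<le> j \<Longrightarrow> j < 2 * r \<Longrightarrow> vec_degree (col L j) \<le> vec_degree (col L i)"
    "\<And>i. i < 2 * r \<Longrightarrow> vec_degree (col L i) + vec_degree (col L (2 * r - 1 - i)) = d"
proof -
  define n where "n = 2 * r"
  have Pc: "P \<in> carrier_mat m m" and skew: "P\<^sup>T = - P" and deg: "mat_degree P = d"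
    and nr: "normal_rank P = n" and reval: "\<And>a. vec_space.rank m (eval_mat a P) = n"
    and rtop: "vec_space.rank m (coeff_mat P d) = n"
    using P unfolding POL_ss_neig_iff n_def by auto
  obtain L where L: "L \<in> carrier_mat m n" and fL: "frac_factor P L"
    and least: "\<And>M. M \<in> carrier_mat m n \<Longrightarrow> frac_factor P M \<Longrightarrow> col_degree_sum L \<le> col_degree_sum M"
    and sorted: "\<And>i j. i \<le> j \<Longrightarrow> j < n \<Longrightarrow> vec_degree (col L j) \<le> vec_degree (col L i)"
    using sorted_least_frac_factor_exists[OF Pc nr] by blast
  have mc: "min_degree_cols L" using least_frac_factor_min_degree_cols[OF Pc nr L fL least] .
  obtain Q where Q: "Q \<in> carrier_mat n n" "Q\<^sup>T = - Q" "P = L * Q * L\<^sup>T"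
    using skew_congruence_factor[OF Pc skew L mc fL] .
  define e where "e i = vec_degree (col L i)" for i
  have pairing: "e i + e (n - 1 - i) = d" if "i < n" for i
    unfolding e_def using congruence_degree_pairing[OF L mc Q(1,3) eq_refl[OF deg] reval rtop sorted that] .
  interpret graded_skew m n r d e P
    by unfold_locales (use n_def pairing sorted nr in \<open>auto simp: e_def\<close>)
  have dL: "degree (L $$ (a,j)) \<le> e j" if "a < m" "j < n" for a j
    using vec_degree_le_iff[of "col L j" "e j"] that L by (auto simp: e_def)
  have dQ: "deg_shift_le (Q $$ (i,j)) (e i + e j) d" if "i < n" "j < n" for i j
    using congruence_predictable_degree[OF L min_degree_cols_lead_inj[OF L mc] Q(1), of d i j] deg that
    unfolding deg_shift_le_def Q(3)[symmetric] e_def by auto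
  have "graded_factor L Q" unfolding graded_factor_def using L Q dL dQ by blast
  then obtain M where gM: "graded_factor M (exchange_mat r)" using normal_form_exists by blast
  then have M: "M \<in> carrier_mat m n" and PM: "P = M * exchange_mat r * M\<^sup>T"
    and dM: "\<And>a j. a < m \<Longrightarrow> j < n \<Longrightarrow> degree (M $$ (a,j)) \<le> e j"
    unfolding graded_factor_def by auto
  have J: "exchange_mat r \<in> carrier_mat n n" by (simp add: n_def)
  have "1 \<cdot>\<^sub>m P = P" by (rule eq_matI) auto
  also have "P = M * (exchange_mat r * M\<^sup>T)" unfolding PM using M by (intro assoc_mult_mat[OF M J]) simp
  finally have "1 \<cdot>\<^sub>m P = M * (exchange_mat r * M\<^sup>T)" .
  then have fM: "frac_factor P M" using M J Pc
    by (intro frac_factorI[of 1 "exchange_mat r * M\<^sup>T" n m M m P] mult_carrier_mat[of _ n n]) auto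
  have le: "vec_degree (col M j) \<le> e j" if "j < n" for j
    unfolding vec_degree_le_iff using dM that M by auto
  have sL: "col_degree_sum L = (\<Sum>j<n. e j)" using L by (simp add: col_degree_sum_def e_def)
  have sM: "col_degree_sum M = (\<Sum>j<n. vec_degree (col M j))" using M by (simp add: col_degree_sum_def)
  have eq: "vec_degree (col M j) = e j" if "j < n" for j
  proof (rule ccontr)
    assume "vec_degree (col M j) \<noteq> e j"
    then have "vec_degree (col M j) < e j" using le[OF that] by simp
    then have "col_degree_sum M < col_degree_sum L"
      unfolding sL sM using le that by (intro sum_strict_mono_ex1) auto
    then show False using least[OF M fM] by simp
  qed
  then have "col_degree_sum M = col_degree_sum L" unfolding sL sM by simp
  then have "min_degree_cols M" using least least_frac_factor_min_degree_cols[OF Pc nr M fM] by simp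
  then show ?thesis
    using that[of M] M PM eq pairing sorted unfolding n_def e_def by auto
qed

theorem theorem3p5:
  fixes m r d :: nat
  assumes "d \<ge> 1" and "2 \<le> 2 * r" and "2 * r \<le> m - 1"
  shows "POL_ss_neig d (2 * r) m =
    {L * skew_block_mat r * transpose_mat L | L.
       L \<in> carrier_mat m (2 * r) \<and>
       minimal_basis_mat L \<and>
       (\<forall>i j. i \<le> j \<longrightarrow> j < 2 * r \<longrightarrow> vec_degree (col L i) \<ge> vec_degree (col L j)) \<and>
       (\<forall>i < 2 * r. vec_degree (col L i) + vec_degree (col L (2 * r - 1 - i)) = d)}"
proof (intro equalityI subsetI)
  fix P assume "P \<in> POL_ss_neig d (2 * r) m"
  then obtain L where L: "L \<in> carrier_mat m (2 * r)" "P = L * exchange_mat r * L\<^sup>T" "min_degree_cols L"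
    "\<And>i j. i \<le> j \<Longrightarrow> j < 2 * r \<Longrightarrow> vec_degree (col L j) \<le> vec_degree (col L i)"
    "\<And>i. i < 2 * r \<Longrightarrow> vec_degree (col L i) + vec_degree (col L (2 * r - 1 - i)) = d"
    using POL_ss_neig_factorization by blast
  then show "P \<in> {L * skew_block_mat r * transpose_mat L | L.
       L \<in> carrier_mat m (2 * r) \<and>
       minimal_basis_mat L \<and>
       (\<forall>i j. i \<le> j \<longrightarrow> j < 2 * r \<longrightarrow> vec_degree (col L i) \<ge> vec_degree (col L j)) \<and>
       (\<forall>i < 2 * r. vec_degree (col L i) + vec_degree (col L (2 * r - 1 - i)) = d)}"
    using minimal_basis_mat_iff[OF L(1)] unfolding skew_block_mat_eq by blast
next
  fix P assume "P \<in> {L * skew_block_mat r * transpose_mat L | L.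
       L \<in> carrier_mat m (2 * r) \<and>
       minimal_basis_mat L \<and>
       (\<forall>i j. i \<le> j \<longrightarrow> j < 2 * r \<longrightarrow> vec_degree (col L i) \<ge> vec_degree (col L j)) \<and>
       (\<forall>i < 2 * r. vec_degree (col L i) + vec_degree (col L (2 * r - 1 - i)) = d)}"
  then obtain L where L: "L \<in> carrier_mat m (2 * r)" "P = L * exchange_mat r * L\<^sup>T" "minimal_basis_mat L"
    "\<And>i. i < 2 * r \<Longrightarrow> vec_degree (col L i) + vec_degree (col L (2 * r - 1 - i)) = d"
    unfolding skew_block_mat_eq by blast
  then show "P \<in> POL_ss_neig d (2 * r) m"
    using skew_congruence_in_POL_ss_neig[OF _ L(1)] minimal_basis_mat_iff[OF L(1)] assms(2) by auto
qed

end
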